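(* There exist fixed universal constants $C, C'\in\mathbb{R}^+$ such that the following holds. Let $M\in\mathbb{C}^{D\times d}$, $D=(2\delta-1)d$, be the local correlation measurement matrix built from the masks $$(\mathbf{m}_l)_i = \begin{cases}\dfrac{e^{-i/a}}{\sqrt[4]{2\delta-1}}\cdot e^{\frac{2\pi\mathrm{i}\,(i-1)(l-1)}{2\delta-1}} & \text{if } i\le\delta,\\ 0 & \text{if } i>\delta,\end{cases}\qquad 1\le l\le 2\delta-1,\ 1\le i\le d,\qquad a:=\max\left\{4,\tfrac{\delta-1}{2}\right\}$$ (in the exponent, the roman $\mathrm{i}$ is the imaginary unit and the italic $i$ is the index). Suppose that $\mathbf{x}\in\mathbb{C}^d$ is $\left\lfloor\frac{\delta-3}{2}\right\rfloor$-flat with $d>2$, and that $\|\mathbf{x}\|_2^2\geq C(\delta-1)d^2\|\mathbf{n}\|_2$, where $\mathbf{n}\in\mathbb{R}^D$. Then the algorithm BlockPR, given the arbitrarily noisy input measurements $\mathbf{b}=|M\mathbf{x}|^2+\mathbf{n}\in\mathbb{R}^D$, is guaranteed to recover an $\tilde{\mathbf{x}}\in\mathbb{C}^d$ with $$\min_{\theta\in[0,2\pi]}\left\|\mathbf{x}-e^{\mathrm{i}\theta}\tilde{\mathbf{x}}\right\|_2^2\leq C' d^2(\delta-1)\|\mathbf{n}\|_2 .$$ Furthermore, BlockPR requires just $\mathcal{O}(\delta\cdot d\log d)$ operations for this choice of $M$.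
   Context: $|\cdot|^2$ denotes the componentwise squared magnitude of a vector. For an integer $n$, $[n]=\{1,\dots,n\}$. Flatness. Let $m\in[d]$. A vector $\mathbf{x}\in\mathbb{C}^d$ is $m$-flat if it can be partitioned into at least $\lfloor d/m\rfloor$ blocks of consecutive entries such that (1) every block contains either $m$ or $m+1$ neighboring entries of $\mathbf{x}$, and (2) every block contains at least one entry of magnitude $\geq\frac{\|\mathbf{x}\|_2}{2\sqrt d}$. Local correlation measurements. Let $d,\delta$ be positive integers with $\delta < \lfloor d/2 \rfloor$ and $D := (2\delta-1)d$. Indices of vectors in $\mathbb{C}^d$ are taken modulo $d$ in $\{1,\dots,d\}$. Let $\mathbf{m}_1,\dots,\mathbf{m}_{2\delta-1}\in\mathbb{C}^d$ be masks with $(\mathbf{m}_l)_i = 0$ for all $i>\delta$. The matrix $M\in\mathbb{C}^{D\times d}$ is the vertical stack of the circulant blocks $M_1,\dots,M_{2\delta-1}\in\mathbb{C}^{d\times d}$ with $(M_l)_{i,j} = \overline{(\mathbf{m}_l)}_{((j-i) \bmod d)+1}$, so $(|M_l\mathbf{x}|^2)_i = \left|\sum_{k=1}^{\delta}\overline{(\mathbf{m}_l)}_k x_{i+k-1}\right|^2$. The permutation matrix $P\in\{0,1\}^{D\times D}$ is given by $(P\mathbf{v})_{(i-1)(2\delta-1)+l} = v_{(l-1)d+i}$ for $i\in[d]$, $l\in[2\delta-1]$. The vector $\mathbf{y}\in\mathbb{C}^D$ is defined, for $c\in[d]$, by $y_{(c-1)(2\delta-1)+j} = \overline{x}_c\,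 x_{c+j-1}$ for $1\le j\le\delta$ and $y_{(c-1)(2\delta-1)+j} = \overline{x}_{c+1}\,x_{c+1+j-2\delta}$ for $\delta+1\le j\le 2\delta-1$. Thus $\mathbf{y}$ lists exactly once each product $x_i\overline{x}_j$ with $|(i-j) \bmod d|<\delta$ (residues in $\{-\lceil d/2\rceil+1,\dots,\lfloor d/2\rfloor\}$); $k(i,j)\in[D]$ denotes the position of $x_i\overline{x}_j$ in $\mathbf{y}$. The lifted matrix $M'\in\mathbb{C}^{D\times D}$ is the block circulant matrix whose $(r,c)$ block ($r,c\in[d]$), of size $(2\delta-1)\times(2\delta-1)$, is $M'_l$ with $l=((c-r)\bmod d)+1$ if $l\le\delta$ and $0$ otherwise, where $(M'_l)_{i,j} = (\mathbf{m}_i)_l\overline{(\mathbf{m}_i)}_{j+l-1}$ if $1\le j\le\delta-l+1$; $(M'_l)_{i,j} = (\mathbf{m}_i)_{l+1}\overline{(\mathbf{m}_i)}_{l+j-2\delta+1}$ if $l<\delta$ and $2\delta-l\le j\le 2\delta-1$; and $(M'_l)_{i,j}=0$ otherwise. One has $P|M\mathbf{x}|^2 = M'\mathbf{y}$. BlockPR (Algorithm 1), for $M$ with $M'$ invertible and input $\mathbf{b}=|M\mathbf{x}|^2+\mathbf{n}\in\mathbb{R}^D$: (1) compute $\tilde{\mathbf{y}} = (M')^{-1}P\mathbf{b}$; (2) compute phases $\tilde\phi_1,\dots,\tilde\phi_d$ by Algorithm 2 below; (3) output $\tilde{\mathbf{x}}$ with $\tilde{x}_j = \sqrt{|\tilde{y}_{k(j,j)}|}\,e^{\mathrm{i}\tilde\phi_j}$.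 Algorithm 2 (greedy angular synchronization): let $a$ maximize $|\tilde{y}_{k(j,j)}|$ over $j$ (ties broken arbitrarily), set $\tilde\phi_a=0$, mark $a$ as done and all other indices as not done, and set $j=a$. While some index among $j+1,\dots,j+\delta-1$ (mod $d$) is not done: for each $i=1-\delta,\dots,\delta-1$ such that $j+i$ (mod $d$) is not done, set $\tilde\phi_{j+i} = \tilde\phi_j + \frac12\left(\arg(\tilde{y}_{k(j+i,j)}) - \arg(\tilde{y}_{k(j,j+i)})\right)$ and mark $j+i$ as done; then replace $j$ by $j+i^*$ (mod $d$), where $i^*$ maximizes $|\tilde{y}_{k(j+i,j+i)}|$ over $0<i<\delta$. Here the two numbers $\tilde{y}_{k(j+i,j)}$ and $\tilde{y}_{k(j,j+i)}$ are complex conjugates of each other, and their arguments are taken in $[-\pi,\pi]$ with opposite values, $\arg(\overline{z})=-\arg(z)$. *)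

theory Defs
  imports "HOL-Analysis.Analysis" "Jordan_Normal_Form.Matrix" "HOL-Library.Disjoint_Sets"
begin

unbundle no vec_syntax

text \<open>
  All indices are 0-based: the entry \<open>i\<close> in \<open>{1..d}\<close> of the usual notation is entry \<open>i - 1\<close> here,
  and similarly for the masks \<open>l\<close>, the blocks of a matrix and the positions in vectors of length
  \<open>(2 * \<delta> - 1) * d\<close>.
\<close>

definition l2norm :: "'a::real_normed_vector vec \<Rightarrow> real" where
  "l2norm v = L2_set (\<lambda>i. norm (v $ i)) {..<dim_vec v}"

definition idx :: "nat \<Rightarrow> int \<Rightarrow> nat" where
  "idx d k = nat (k mod int d)"


subsection \<open>Flat vectors\<close>

definition flat :: "nat \<Rightarrow> complex vec \<Rightarrow> bool" where
  "flat m x \<longleftrightarrow> 1 \<le> m \<and> m \<le> dim_vec x \<and>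
     (\<exists>\<B>. partition_on {..<dim_vec x} \<B> \<and> dim_vec x div m \<le> card \<B> \<and>
        (\<forall>B\<in>\<B>. (\<exists>s. B = {s..<s + m} \<or> B = {s..<s + (m + 1)}) \<and>
               (\<exists>i\<in>B. l2norm x / (2 * sqrt (real (dim_vec x))) \<le> cmod (x $ i))))"


subsection \<open>Local correlation measurements\<close>

definition meas_dim :: "nat \<Rightarrow> nat \<Rightarrow> nat" where
  "meas_dim d \<delta> = (2 * \<delta> - 1) * d"

definition meas_mat :: "nat \<Rightarrow> nat \<Rightarrow> (nat \<Rightarrow> complex vec) \<Rightarrow> complex mat" where
  "meas_mat d \<delta> m = mat (meas_dim d \<delta>) d
     (\<lambda>(r, j). let l = r div d; i = r mod d in cnj (m l $ idx d (int j - int i)))"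

definition perm_mat :: "nat \<Rightarrow> nat \<Rightarrow> complex mat" where
  "perm_mat d \<delta> = mat (meas_dim d \<delta>) (meas_dim d \<delta>)
     (\<lambda>(p, q). let i = p div (2 * \<delta> - 1); l = p mod (2 * \<delta> - 1) in if q = l * d + i then 1 else 0)"

definition lifted_block :: "nat \<Rightarrow> (nat \<Rightarrow> complex vec) \<Rightarrow> nat \<Rightarrow> nat \<Rightarrow> nat \<Rightarrow> complex" where
  "lifted_block \<delta> m l i j =
     (if l + j < \<delta> then m i $ l * cnj (m i $ (l + j))
      else if l + 1 < \<delta> \<and> 2 * \<delta> \<le> l + j + 2
        then m i $ (l + 1) * cnj (m i $ (l + j + 2 - 2 * \<delta>))
      else 0)"

definition lifted_mat :: "nat \<Rightarrow> nat \<Rightarrow> (nat \<Rightarrow> complex vec) \<Rightarrow> complex mat" where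
  "lifted_mat d \<delta> m = mat (meas_dim d \<delta>) (meas_dim d \<delta>)
     (\<lambda>(p, q). let r = p div (2 * \<delta> - 1); i = p mod (2 * \<delta> - 1);
                   c = q div (2 * \<delta> - 1); j = q mod (2 * \<delta> - 1);
                   l = idx d (int c - int r)
               in if l < \<delta> then lifted_block \<delta> m l i j else 0)"

definition lifted_vec :: "nat \<Rightarrow> nat \<Rightarrow> complex vec \<Rightarrow> complex vec" where
  "lifted_vec d \<delta> x = vec (meas_dim d \<delta>)
     (\<lambda>p. let c = p div (2 * \<delta> - 1); j = p mod (2 * \<delta> - 1)
          in if j < \<delta> then cnj (x $ c) * x $ idx d (int c + int j)
             else cnj (x $ idx d (int c + 1)) * x $ idx d (int c + int j + 2 - 2 * int \<delta>))"

text \<open>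
  \<open>pos d \<delta> i j\<close> is the position of \<open>x\<^sub>i * cnj x\<^sub>j\<close> in \<open>lifted_vec d \<delta> x\<close>,
  see \<open>lifted_vec_pos\<close> and \<open>pos_less\<close> below.
  It is meaningful only if \<open>i\<close> and \<open>j\<close> have cyclic distance less than \<open>\<delta>\<close>.
\<close>

definition pos :: "nat \<Rightarrow> nat \<Rightarrow> nat \<Rightarrow> nat \<Rightarrow> nat" where
  "pos d \<delta> i j =
     (let s = idx d (int i - int j) in
      if s < \<delta> then j * (2 * \<delta> - 1) + s
      else idx d (int j - 1) * (2 * \<delta> - 1) + (2 * \<delta> - 1 - idx d (int j - int i)))"

definition meas :: "nat \<Rightarrow> nat \<Rightarrow> (nat \<Rightarrow> complex vec) \<Rightarrow> complex vec \<Rightarrow> real vec" where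
  "meas d \<delta> m x = map_vec (\<lambda>z. (cmod z)\<^sup>2) (meas_mat d \<delta> m *\<^sub>v x)"


subsection \<open>Greedy angular synchronization\<close>

text \<open>
  A run of the loop: \<open>sync_loop d \<delta> y \<phi> S j \<psi>\<close> means that, started with phases \<open>\<phi>\<close>, set \<open>S\<close> of
  finished indices and current index \<open>j\<close>, the loop can stop with phases \<open>\<psi>\<close>. Ties in the choice of
  the next index are broken arbitrarily. The test of the loop guarantees that every iteration
  enlarges \<open>S\<close>, so there are no infinite runs. For a negative real number both \<open>pi\<close> and
  \<open>- pi\<close> are admissible arguments, and for \<open>0\<close> every number in \<open>{- pi..pi}\<close> is.
\<close>

inductive sync_loop ::
  "nat \<Rightarrow> nat \<Rightarrow> complex vec \<Rightarrow> (nat \<Rightarrow> real) \<Rightarrow> nat set \<Rightarrow> nat \<Rightarrow> (nat \<Rightarrow> real) \<Rightarrow> bool"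
  for d \<delta> :: nat and y :: "complex vec"
where
  stop: "(\<forall>i. 0 < i \<and> i < \<delta> \<longrightarrow> (j + i) mod d \<in> S) \<Longrightarrow> sync_loop d \<delta> y \<phi> S j \<phi>"
| step: "\<lbrakk> \<exists>i. 0 < i \<and> i < \<delta> \<and> (j + i) mod d \<notin> S;
           N = {idx d (int j + i) | i. 1 - int \<delta> \<le> i \<and> i \<le> int \<delta> - 1} - S;
           \<forall>p. p \<notin> N \<longrightarrow> \<phi>' p = \<phi> p;
           \<forall>p\<in>N. \<exists>\<alpha>\<in>{- pi..pi}. \<exists>\<beta>\<in>{- pi..pi}.
              is_Arg (y $ pos d \<delta> p j) \<alpha> \<and> is_Arg (y $ pos d \<delta> j p) \<beta> \<and> \<beta> = - \<alpha> \<and>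
              \<phi>' p = \<phi> j + (\<alpha> - \<beta>) / 2;
           is_arg_max (\<lambda>i. cmod (y $ pos d \<delta> ((j + i) mod d) ((j + i) mod d)))
             (\<lambda>i. 0 < i \<and> i < \<delta>) i;
           sync_loop d \<delta> y \<phi>' (S \<union> N) ((j + i) mod d) \<psi> \<rbrakk>
         \<Longrightarrow> sync_loop d \<delta> y \<phi> S j \<psi>"

text \<open>The initial phases of the indices other than \<open>a\<close> are arbitrary (uninitialized).\<close>

definition greedy_sync :: "nat \<Rightarrow> nat \<Rightarrow> complex vec \<Rightarrow> (nat \<Rightarrow> real) \<Rightarrow> bool" where
  "greedy_sync d \<delta> y \<phi> \<longleftrightarrow>
     (\<exists>a \<phi>\<^sub>0. is_arg_max (\<lambda>j. cmod (y $ pos d \<delta> j j)) (\<lambda>j. j < d) a \<and>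
             \<phi>\<^sub>0 a = 0 \<and> sync_loop d \<delta> y \<phi>\<^sub>0 {a} a \<phi>)"


subsection \<open>BlockPR\<close>

text \<open>\<open>block_pr d \<delta> m b z\<close>: with masks \<open>m\<close> and input \<open>b\<close> the algorithm can output \<open>z\<close>. In
  particular this entails that the lifted matrix is invertible.\<close>

definition block_pr ::
  "nat \<Rightarrow> nat \<Rightarrow> (nat \<Rightarrow> complex vec) \<Rightarrow> real vec \<Rightarrow> complex vec \<Rightarrow> bool" where
  "block_pr d \<delta> m b z \<longleftrightarrow>
     (\<exists>B y \<phi>. inverts_mat (lifted_mat d \<delta> m) B \<and> inverts_mat B (lifted_mat d \<delta> m) \<and>
        y = B *\<^sub>v (perm_mat d \<delta> *\<^sub>v map_vec complex_of_real b) \<and>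
        greedy_sync d \<delta> y \<phi> \<and>
        z = vec d (\<lambda>j. complex_of_real (sqrt (cmod (y $ pos d \<delta> j j))) * exp (\<i> * complex_of_real (\<phi> j))))"


subsection \<open>Exponential masks\<close>

definition exp_mask :: "nat \<Rightarrow> nat \<Rightarrow> nat \<Rightarrow> complex vec" where
  "exp_mask d \<delta> l = vec d
     (\<lambda>i. if i < \<delta>
          then complex_of_real (exp (- real (i + 1) / max 4 ((real \<delta> - 1) / 2)) / root 4 (2 * real \<delta> - 1))
               * exp (2 * complex_of_real pi * \<i> * of_nat i * of_nat l / of_nat (2 * \<delta> - 1))
          else 0)"


subsection \<open>Operation counts\<close>

text \<open>
  Operations are counted in programs over complex registers that branch on comparisons (algebraic
  computation trees). Every arithmetic operation, every elementary function, every comparison and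
  every loading of a constant costs one operation. Only natural numbers, \<open>pi\<close> and \<open>\<i>\<close> are available
  as constants, so all quantities derived from the masks (roots of unity, entries of the lifted
  matrix and of its inverse) have to be computed at run time and are counted.
\<close>

datatype operation =
    Const nat | ConstPi | ConstI
  | Add nat nat | Sub nat nat | Mul nat nat | Div nat nat
  | Conj nat | Modulus nat | Sqrt nat | Exp nat | Angle nat

fun op_val :: "operation \<Rightarrow> (nat \<Rightarrow> complex) \<Rightarrow> complex" where
  "op_val (Const n) R = of_nat n"
| "op_val ConstPi R = complex_of_real pi"
| "op_val ConstI R = \<i>"
| "op_val (Add i j) R = R i + R j"
| "op_val (Sub i j) R = R i - R j"
| "op_val (Mul i j) R = R i * R j"
| "op_val (Div i j) R = R i / R j"
| "op_val (Conj i) R = cnj (R i)"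
| "op_val (Modulus i) R = complex_of_real (cmod (R i))"
| "op_val (Sqrt i) R = csqrt (R i)"
| "op_val (Exp i) R = exp (R i)"
| "op_val (Angle i) R = complex_of_real (Arg (R i))"

text \<open>\<open>Return rs\<close> outputs the contents of the registers \<open>rs\<close>; \<open>Assign r e t\<close> stores the result of
  \<open>e\<close> in register \<open>r\<close> and continues with \<open>t\<close>; \<open>Branch i j t u\<close> compares real parts.\<close>

datatype prog =
    Return "nat list"
  | Assign nat operation prog
  | Branch nat nat prog prog

fun prog_out :: "prog \<Rightarrow> (nat \<Rightarrow> complex) \<Rightarrow> complex list" where
  "prog_out (Return rs) R = map R rs"
| "prog_out (Assign r e t) R = prog_out t (R(r := op_val e R))"
| "prog_out (Branch i j t u) R = (if Re (R i) \<le> Re (R j) then prog_out t R else prog_out u R)"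

fun prog_cost :: "prog \<Rightarrow> (nat \<Rightarrow> complex) \<Rightarrow> nat" where
  "prog_cost (Return rs) R = 0"
| "prog_cost (Assign r e t) R = 1 + prog_cost t (R(r := op_val e R))"
| "prog_cost (Branch i j t u) R = 1 + (if Re (R i) \<le> Re (R j) then prog_cost t R else prog_cost u R)"

definition input_regs :: "real vec \<Rightarrow> nat \<Rightarrow> complex" where
  "input_regs b i = (if i < dim_vec b then complex_of_real (b $ i) else 0)"


subsection \<open>The positions in the lifted vector\<close>

lemma idx_add_right: "idx d (int (idx d a) + b) = idx d (a + b)" if "d > 0"
  using that by (simp add: idx_def mod_add_left_eq)

lemma idx_of_nat: "idx d (int i) = i" if "i < d"
  using that by (simp add: idx_def)

lemma idx_less: "idx d k < d" if "d > 0"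
  using that by (simp add: idx_def nat_less_iff)

lemma idx_uminus: "idx d (- k) = d - idx d k" if "d > 0" "idx d k > 0"
proof -
  have "k mod int d \<noteq> 0" using that by (auto simp: idx_def)
  then have "(- k) mod int d = int d - k mod int d"
    by (simp add: zmod_zminus1_eq_if)
  moreover have "0 \<le> k mod int d" "k mod int d < int d" using that by auto
  ultimately show ?thesis by (simp add: idx_def nat_diff_distrib)
qed

lemma block_index_less:
  fixes a b d w :: nat
  assumes "a < d" "b < w" shows "a * w + b < w * d"
proof -
  have "a * w + b < (a + 1) * w" using assms by simp
  also have "\<dots> \<le> d * w" using assms by (intro mult_right_mono) auto
  finally show ?thesis by (simp add: mult.commute)
qed

lemma block_index_div: "(a * w + b) div w = a" if "b < w" for a b w :: nat
  using that by simp

lemma block_index_mod: "(a * w + b) mod w = b" if "b < w" for a b w :: nat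
  using that by simp

context
  fixes d \<delta> i j :: nat
  assumes \<delta>: "0 < \<delta>" "\<delta> < d div 2" and ij: "i < d" "j < d"
    and near: "idx d (int i - int j) < \<delta> \<or> idx d (int j - int i) < \<delta>"
begin

lemma pos_less: "pos d \<delta> i j < meas_dim d \<delta>"
proof -
  have "idx d (int j - 1) < d" using \<delta> by (intro idx_less) auto
  moreover have "idx d (int j - int i) > 0" if "\<not> idx d (int i - int j) < \<delta>"
    using that \<delta> idx_uminus[of d "int i - int j"] idx_less[of d "int i - int j"] by auto
  ultimately show ?thesis
    unfolding pos_def meas_dim_def Let_def using \<delta> ij
    by (auto intro!: block_index_less)
qed

lemma lifted_vec_pos: "lifted_vec d \<delta> x $ pos d \<delta> i j = x $ i * cnj (x $ j)"
proof (cases "idx d (int i - int j) < \<delta>")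
  case True
  have "idx d (int j + int (idx d (int i - int j))) = i"
    using \<delta> ij idx_add_right[of d "int i - int j" "int j"]
    by (simp add: idx_of_nat add.commute)
  then show ?thesis
    using True \<delta> pos_less by (simp add: lifted_vec_def pos_def Let_def mult.commute)
next
  case False
  define t where "t = idx d (int j - int i)"
  define c where "c = idx d (int j - 1)"
  have t: "0 < t" "t < \<delta>"
    using False near \<delta> idx_uminus[of d "int i - int j"] idx_less[of d "int i - int j"]
    by (auto simp: t_def)
  have p: "pos d \<delta> i j = c * (2 * \<delta> - 1) + (2 * \<delta> - 1 - t)"
    using False by (simp add: pos_def t_def c_def)
  have "2 * \<delta> - 1 - t < 2 * \<delta> - 1" using t by auto
  then have dm: "pos d \<delta> i j div (2 * \<delta> - 1) = c" "pos d \<delta> i j mod (2 * \<delta> - 1) = 2 * \<delta> - 1 - t"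
    unfolding p by (simp_all only: block_index_div block_index_mod)
  have ge: "\<not> 2 * \<delta> - 1 - t < \<delta>" using t by auto
  have e1: "idx d (int c + 1) = j"
    using \<delta> ij idx_add_right[of d "int j - 1" 1] by (simp add: c_def idx_of_nat)
  have "int c + int (2 * \<delta> - 1 - t) + 2 - 2 * int \<delta> = int c + (1 - int t)"
    using t by simp
  also have "idx d \<dots> = idx d (int j - int t)"
    using \<delta> idx_add_right[of d "int j - 1" "1 - int t"] by (simp add: c_def)
  also have "\<dots> = idx d (int i)"
    using \<delta> ij by (simp add: t_def idx_def mod_diff_right_eq)
  finally have e2: "idx d (int c + int (2 * \<delta> - 1 - t) + 2 - 2 * int \<delta>) = i"
    using ij by (simp add: idx_of_nat)
  show ?thesis
    unfolding lifted_vec_def index_vec[OF pos_less] Let_def dm e1 e2 if_not_P[OF ge]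
    by (rule mult.commute)
qed

end

end

theory Submission
  imports Defs "Jordan_Normal_Form.Determinant"
begin

text \<open>
  For these masks the lifted matrix can be inverted by hand. In the product of two entries of the
  mask \<open>l\<close>, the phase depends only on the difference of the positions and the modulus only on their
  sum. Hence the lifted matrix is a discrete Fourier transform of length \<open>N = 2 * \<delta> - 1\<close> in
  every block, composed with \<open>N\<close> cyclic convolutions along the blocks, one for each offset, and each
  convolution kernel is a finite geometric progression with ratio \<open>q = exp (- 2 / a)\<close>. Such a
  progression telescopes: if \<open>u\<close> is the convolution of \<open>f\<close> with \<open>\<kappa>, \<kappa> q, \<dots>, \<kappa> q ^ (L - 1)\<close>, then
  \<open>u r - q * u (r + 1) = \<kappa> * (f r - q ^ L * f (r + L))\<close>, and this recurrence can be solved on the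
  cycle because \<open>q < 1\<close>. The outcome is a closed formula for the solution
  (\<open>lifted_system_solution\<close>). It shows that the lifted matrix is invertible, that noise \<open>n\<close> disturbs
  every entry of the solution by at most \<open>E = 2 * exp 3 * (\<delta> - 1) * l2norm n\<close>
  (\<open>inverse_lift_error\<close>; the factor \<open>\<delta> - 1\<close> is \<open>1 / (1 - q)\<close> up to a constant), and that the
  solution is Hermitian for all real data.

  Recovery. The moduli are the square roots of diagonal entries, so their errors contribute at most
  \<open>d * E\<close> to the squared distance. For the phases, flatness puts an entry of modulus at least
  \<open>l2norm x / (2 * sqrt d)\<close> among any \<open>\<delta> - 1\<close> cyclically consecutive ones (\<open>flat_window\<close>). Thus each
  index \<open>j\<close> that the greedy algorithm uses as a reference satisfies \<open>\<beta> \<le> cmod (x $ j)\<close>, where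
  \<open>\<beta>\<^sup>2 = (l2norm x)\<^sup>2 / (8 * d)\<close>, and passing from one reference to the next costs a relative phase
  error of at most \<open>2 * E / \<beta>\<^sup>2\<close>. There are fewer than \<open>d\<close> such steps, as every iteration finishes a
  new index, and the finished indices form a cyclic interval that can stop growing only when
  it is everything (\<open>reachable_stop\<close>). Summing the squared errors gives multiples of
  \<open>(d\<^sup>2 * E / (l2norm x)\<^sup>2) * d\<^sup>2 * E\<close> and of \<open>d * E\<close>; the hypothesis on the noise bounds
  \<open>d\<^sup>2 * E / (l2norm x)\<^sup>2\<close> (\<open>recovery_error\<close>).

  Cost. The closed formula is also the algorithm. The transforms of odd length \<open>N\<close> are reduced to
  transforms whose length is a power of two by the chirp identity
  \<open>j * k = (j + k choose 2) - (j choose 2) - (k choose 2)\<close>, and the geometric sums over the cycle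
  are computed by repeated doubling of their length. Together with the synchronization, in which all
  branching takes place, this needs \<open>O(\<delta> * d * ln d)\<close> operations. Registers are avoided: \<open>solves\<close>
  describes computation trees by the functions of the input that have been computed so far, and
  \<open>solves_prog\<close> turns such a tree into a program.
\<close>

section \<open>Roots of unity and the discrete Fourier transform\<close>

text \<open>
  The primitive \<open>n\<close>-th root of unity to the power \<open>k\<close>, in the form in which the masks contain it.
  Exponents are natural numbers; inverses are expressed by \<open>cnj\<close>.
\<close>

definition unity_root :: "nat \<Rightarrow> nat \<Rightarrow> complex" where
  "unity_root n k = exp (2 * complex_of_real pi * \<i> * of_nat k / of_nat n)"

lemma unity_root_add: "unity_root n (j + k) = unity_root n j * unity_root n k"
  by (simp add: unity_root_def ring_distribs add_divide_distrib exp_add)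

lemma unity_root_0 [simp]: "unity_root n 0 = 1"
  by (simp add: unity_root_def)

lemma unity_root_mult: "unity_root n (j * k) = unity_root n j ^ k"
  by (induction k) (simp_all add: unity_root_add)

lemma unity_root_full: "unity_root n n = 1"
  by (cases "n = 0") (simp_all add: unity_root_def mult.commute)

lemma unity_root_multiple [simp]: "unity_root n (n * k) = 1"
  by (simp add: unity_root_mult unity_root_full)

lemma unity_root_mod: "unity_root n (k mod n) = unity_root n k"
proof -
  have "unity_root n k = unity_root n (n * (k div n) + k mod n)" by simp
  also have "\<dots> = unity_root n (k mod n)" by (subst unity_root_add) simp
  finally show ?thesis by simp
qed

lemma norm_unity_root [simp]: "cmod (unity_root n k) = 1"
proof -
  have "2 * complex_of_real pi * \<i> * of_nat k / of_nat n = \<i> * complex_of_real (2 * pi * real k / real n)"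
    by (simp add: mult_ac)
  then show ?thesis unfolding unity_root_def by (simp only: norm_exp_i_times)
qed

lemma unity_root_cnj [simp]: "unity_root n k * cnj (unity_root n k) = 1"
  by (simp add: complex_norm_square [symmetric])

text \<open>
  The product of the two roots of unity is \<open>1\<close>, and the inverse of a number of modulus \<open>1\<close> is its
  conjugate. This turns negative exponents into natural ones.
\<close>

lemma cnj_unity_root: "cnj (unity_root n j) = unity_root n k" if "n dvd j + k"
proof -
  from that obtain l where l: "j + k = n * l" ..
  have "unity_root n j * unity_root n k = 1" by (simp add: unity_root_add [symmetric] l)
  then have "cnj (unity_root n j) * (unity_root n j * unity_root n k) = cnj (unity_root n j)" by simp
  moreover have "cnj (unity_root n j) * (unity_root n j * unity_root n k) = unity_root n k"
    by (metis unity_root_cnj mult.assoc mult.commute mult_1)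
  ultimately show ?thesis by simp
qed

lemma unity_root_double: "unity_root (2 * n) (2 * k) = unity_root n k"
proof -
  have "2 * complex_of_real pi * \<i> * of_nat (2 * k) / of_nat (2 * n)
      = (2 * (2 * complex_of_real pi * \<i> * of_nat k)) / (2 * of_nat n)"
    by simp
  also have "\<dots> = 2 * complex_of_real pi * \<i> * of_nat k / of_nat n"
    by (rule mult_divide_mult_cancel_left) simp
  finally show ?thesis by (simp only: unity_root_def)
qed

text \<open>
  With \<open>z\<close> the quotient of the two roots, the sum is a geometric sum of \<open>n\<close> powers of \<open>z\<close>, and
  \<open>z ^ n = 1\<close>. So it vanishes unless \<open>z = 1\<close>.
\<close>

lemma unity_root_orthogonal:
  assumes "j < n" "k < n"
  shows "(\<Sum>i<n. unity_root n (j * i) * cnj (unity_root n (k * i))) = (if j = k then of_nat n else 0)"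
proof -
  define z where "z = unity_root n j * cnj (unity_root n k)"
  have z: "unity_root n (j * i) * cnj (unity_root n (k * i)) = z ^ i" for i
    by (simp add: z_def unity_root_mult power_mult_distrib)
  have z1: "z = 1 \<longleftrightarrow> j = k"
  proof
    assume "z = 1"
    then have "z * unity_root n k = unity_root n k" by simp
    moreover have "z * unity_root n k = unity_root n j"
      by (metis z_def unity_root_cnj mult.assoc mult.commute mult_1)
    ultimately have "unity_root n j = unity_root n k" by simp
    then show "j = k"
      using complex_root_unity_eq[of n j k] assms by (simp add: unity_root_def)
  qed (simp add: z_def)
  have zn: "z ^ n = 1"
    by (simp add: z_def power_mult_distrib unity_root_mult [symmetric] mult.commute[of _ n]
        flip: complex_cnj_power)
  show ?thesis
  proof (cases "j = k")
    case True
    then show ?thesis using z1 by (simp add: z)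
  next
    case False
    then show ?thesis using z1 zn sum_gp_strict[of z n] by (simp add: z)
  qed
qed

text \<open>
  The sign of the exponent is that of the inverse transform in the usual normalization, because the
  lifted system is solved, not applied; no factor \<open>1 / n\<close> is included.
\<close>

definition dft :: "nat \<Rightarrow> (nat \<Rightarrow> complex) \<Rightarrow> nat \<Rightarrow> complex" where
  "dft n f s = (\<Sum>t<n. f t * unity_root n (t * s))"

lemma dft_mod: "dft n f (s mod n) = dft n f s"
proof -
  have "unity_root n (t * (s mod n)) = unity_root n (t * s)" for t
    by (metis unity_root_mod mod_mult_right_eq)
  then show ?thesis by (simp add: dft_def)
qed

lemma dft_cnj_dft:
  assumes "j < n"
  shows "dft n (\<lambda>i. \<Sum>k<n. f k * cnj (unity_root n (k * i))) j = of_nat n * f j"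
proof -
  have "dft n (\<lambda>i. \<Sum>k<n. f k * cnj (unity_root n (k * i))) j
      = (\<Sum>i<n. \<Sum>k<n. f k * (unity_root n (j * i) * cnj (unity_root n (k * i))))"
    by (simp add: dft_def sum_distrib_right sum_distrib_left mult_ac)
  also have "\<dots> = (\<Sum>k<n. f k * (\<Sum>i<n. unity_root n (j * i) * cnj (unity_root n (k * i))))"
    by (subst sum.swap) (simp add: sum_distrib_left)
  also have "\<dots> = (\<Sum>k<n. f k * (if j = k then of_nat n else 0))"
    by (intro sum.cong refl) (use assms in \<open>subst unity_root_orthogonal, auto\<close>)
  also have "\<dots> = of_nat n * f j"
    using assms by (simp add: if_distrib cong: if_cong)
  finally show ?thesis .
qed

section \<open>Periodic geometric deconvolution\<close>

lemma periodic_mod: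
  fixes f :: "nat \<Rightarrow> 'a"
  assumes "\<And>r. f (r + d) = f r"
  shows "f (r mod d) = f r"
proof -
  have "f (s + d * k) = f s" for s k
  proof (induction k)
    case (Suc k)
    then show ?case using assms[of "s + d * k"] by (simp add: algebra_simps)
  qed simp
  from this[of "r mod d" "r div d"] show ?thesis by simp
qed

lemma periodic_multiple:
  fixes f :: "nat \<Rightarrow> 'a"
  assumes "\<And>r. f (r + d) = f r"
  shows "f (r + d * k) = f r"
  using periodic_mod[of f d, OF assms, of "r + d * k"] periodic_mod[of f d, OF assms, of r] by simp

text \<open>
  Iterating \<open>f r = g r + \<rho> * f (r + L)\<close> \<open>n\<close> times leaves these terms in front of
  \<open>\<rho> ^ n * f (r + n * L)\<close>; see \<open>geom_sum_recurrence\<close>.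
\<close>

definition geom_sum :: "'a::comm_semiring_1 \<Rightarrow> nat \<Rightarrow> (nat \<Rightarrow> 'a) \<Rightarrow> nat \<Rightarrow> nat \<Rightarrow> 'a" where
  "geom_sum \<rho> L g n r = (\<Sum>t<n. \<rho> ^ t * g (r + t * L))"

lemma geom_sum_add:
  "geom_sum \<rho> L g (m + n) r = geom_sum \<rho> L g m r + \<rho> ^ m * geom_sum \<rho> L g n (r + m * L)"
  by (induction n) (simp_all add: geom_sum_def algebra_simps power_add)

lemma geom_sum_recurrence:
  fixes \<rho> :: "'a::comm_ring_1"
  assumes "\<And>r. f r - \<rho> * f (r + L) = g r"
  shows "geom_sum \<rho> L g n r = f r - \<rho> ^ n * f (r + n * L)"
proof (induction n)
  case (Suc n)
  have "geom_sum \<rho> L g (Suc n) r = geom_sum \<rho> L g n r + \<rho> ^ n * g (r + n * L)"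
    by (simp add: geom_sum_def)
  also have "g (r + n * L) = f (r + n * L) - \<rho> * f (r + n * L + L)" using assms by metis
  finally show ?case using Suc by (simp add: algebra_simps)
qed (simp add: geom_sum_def)

text \<open>
  The telescoping step \<open>u r - q * u (r + 1)\<close> leaves only the first and the last term of the
  convolution, that is, \<open>f r - q ^ L * f (r + L)\<close>. After \<open>d\<close> steps of length \<open>L\<close> the resulting
  recurrence is back at its starting point, because \<open>d * L\<close> is a multiple of the period; this holds
  whether or not \<open>L\<close> is coprime to \<open>d\<close>.
\<close>

lemma geometric_deconvolution:
  fixes f u :: "nat \<Rightarrow> complex"
  assumes period: "\<And>r. f (r + d) = f r"
    and conv: "\<And>r. (\<Sum>l<L. \<kappa> * q ^ l * f (r + l)) = u r"
    and \<kappa>: "\<kappa> \<noteq> 0" and q: "q ^ (L * d) \<noteq> 1"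
  shows "f r = geom_sum (q ^ L) L (\<lambda>r. (u r - q * u (Suc r)) / \<kappa>) d r / (1 - q ^ (L * d))"
proof -
  have "f r - q ^ L * f (r + L) = (u r - q * u (Suc r)) / \<kappa>" for r
  proof -
    have "u r - q * u (Suc r) = \<kappa> * ((\<Sum>l<L. q ^ l * f (r + l)) - (\<Sum>l<L. q ^ Suc l * f (r + Suc l)))"
      by (simp add: conv [symmetric] sum_distrib_left right_diff_distrib mult_ac)
    also have "(\<Sum>l<L. q ^ l * f (r + l)) - (\<Sum>l<L. q ^ Suc l * f (r + Suc l))
        = f r - q ^ L * f (r + L)"
      using sum_lessThan_telescope'[of "\<lambda>l. q ^ l * f (r + l)" L]
      by (simp add: sum_subtractf)
    finally show ?thesis using \<kappa> by simp
  qed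
  then have "geom_sum (q ^ L) L (\<lambda>r. (u r - q * u (Suc r)) / \<kappa>) d r
      = f r - (q ^ L) ^ d * f (r + d * L)"
    by (rule geom_sum_recurrence)
  also have "f (r + d * L) = f r" using periodic_multiple[of f d, OF period] .
  finally show ?thesis using q by (simp add: power_mult field_simps)
qed

lemma norm_geom_sum_le:
  fixes g :: "nat \<Rightarrow> complex" and q :: real
  assumes g: "\<And>r. cmod (g r) \<le> b" and q: "0 < q" "q < 1"
  shows "cmod (geom_sum (complex_of_real q) L g n r) \<le> b * (1 - q ^ n) / (1 - q)"
proof -
  have "cmod (geom_sum (complex_of_real q) L g n r) \<le> (\<Sum>t<n. q ^ t * b)"
    unfolding geom_sum_def
    by (rule order_trans[OF norm_sum], intro sum_mono)
      (use g q in \<open>auto simp: norm_mult norm_power intro!: mult_left_mono\<close>)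
  also have "\<dots> = b * (1 - q ^ n) / (1 - q)"
    using q by (simp add: sum_distrib_right [symmetric] sum_gp_strict)
  finally show ?thesis .
qed


lemma geom_sum_mod:
  assumes "\<And>r. g (r mod d) = g r"
  shows "geom_sum \<rho> L g n (r mod d) = geom_sum \<rho> L g n r"
proof -
  have "g (r mod d + t * L) = g (r + t * L)" for t
    using assms[of "r mod d + t * L"] assms[of "r + t * L"] by (simp add: mod_add_left_eq)
  then show ?thesis by (simp add: geom_sum_def)
qed


section \<open>The lifted linear system\<close>

locale local_correlation =
  fixes d \<delta> :: nat
  assumes \<delta>_pos: "0 < \<delta>" and \<delta>_less: "\<delta> < d div 2"
begin

abbreviation N :: nat where "N \<equiv> 2 * \<delta> - 1"

lemma d_pos: "0 < d" and \<delta>_less_d: "\<delta> < d" and N_pos: "0 < N" and \<delta>_double: "2 * \<delta> + 2 \<le> d"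
  and d_ge: "4 \<le> d"
  using \<delta>_pos \<delta>_less by auto

lemma idx_nat: "idx d (int k) = k mod d"
  by (simp add: idx_def nat_mod_distrib)

lemma sum_blocks: "(\<Sum>q<meas_dim d \<delta>. f q) = (\<Sum>c<d. \<Sum>j<N. f (c * N + j))"
proof -
  have "(\<Sum>q<meas_dim d \<delta>. f q) = (\<Sum>c<d. sum f {c * N..<c * N + N})"
    using sum.nat_group[of f N d] by (simp add: meas_dim_def mult.commute)
  also have "\<dots> = (\<Sum>c<d. \<Sum>j<N. f (c * N + j))"
  proof (rule sum.cong [OF refl])
    fix c
    show "sum f {c * N..<c * N + N} = (\<Sum>j<N. f (c * N + j))"
      using sum.shift_bounds_nat_ivl[of f 0 "c * N" N] by (simp add: atLeast0LessThan add.commute)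
  qed
  finally show ?thesis .
qed

lemma idx_shift: "idx d (int ((r + l) mod d) - int r) = l" if "l < d"
proof -
  have "idx d (int ((r + l) mod d) - int r) = idx d (int l)"
    by (simp add: idx_def of_nat_mod mod_diff_left_eq)
  then show ?thesis using that by (simp add: idx_of_nat)
qed

text \<open>
  Summation over block columns \<open>c\<close> becomes summation over the cyclic distance \<open>l\<close> from block row \<open>r\<close>,
  on which the blocks of the lifted matrix depend.
\<close>

lemma sum_cyclic: "(\<Sum>c<d. f c) = (\<Sum>l<d. f ((r + l) mod d))"
proof (rule sum.reindex_bij_witness[where i = "\<lambda>l. (r + l) mod d" and j = "\<lambda>c. idx d (int c - int r)"])
  fix c assume "c \<in> {..<d}"
  then show "(r + idx d (int c - int r)) mod d = c"
    using idx_add_right[of d "int c - int r" "int r"] d_pos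
    by (metis add.commute diff_add_cancel idx_nat idx_of_nat lessThan_iff of_nat_add)
  then show "f ((r + idx d (int c - int r)) mod d) = f c" by simp
  show "idx d (int c - int r) \<in> {..<d}" using idx_less d_pos by simp
qed (use d_pos idx_shift in auto)

lemma index_less: "r < d \<Longrightarrow> i < N \<Longrightarrow> r * N + i < meas_dim d \<delta>"
  unfolding meas_dim_def by (rule block_index_less)

lemma index_div_mod: "k < meas_dim d \<delta> \<Longrightarrow> k div N < d \<and> k mod N < N \<and> k = (k div N) * N + k mod N"
  using N_pos by (auto simp: meas_dim_def less_mult_imp_div_less mult.commute)

lemma lifted_mat_carrier: "lifted_mat d \<delta> m \<in> carrier_mat (meas_dim d \<delta>) (meas_dim d \<delta>)"
  by (simp add: lifted_mat_def)

lemma perm_mat_carrier: "perm_mat d \<delta> \<in> carrier_mat (meas_dim d \<delta>) (meas_dim d \<delta>)"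
  by (simp add: perm_mat_def)

lemma lifted_mat_mult_index:
  assumes r: "r < d" and i: "i < N" and w: "w \<in> carrier_vec (meas_dim d \<delta>)"
  shows "(lifted_mat d \<delta> m *\<^sub>v w) $ (r * N + i)
    = (\<Sum>l<\<delta>. \<Sum>j<N. lifted_block \<delta> m l i j * w $ (((r + l) mod d) * N + j))"
proof -
  have "(lifted_mat d \<delta> m *\<^sub>v w) $ (r * N + i)
      = (\<Sum>q<meas_dim d \<delta>. lifted_mat d \<delta> m $$ (r * N + i, q) * w $ q)"
    using w index_less[OF r i]
    by (simp add: lifted_mat_def scalar_prod_def atLeast0LessThan)
  also have "\<dots> = (\<Sum>c<d. \<Sum>j<N. lifted_mat d \<delta> m $$ (r * N + i, c * N + j) * w $ (c * N + j))"
    by (rule sum_blocks)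
  also have "\<dots> = (\<Sum>c<d. \<Sum>j<N. (if idx d (int c - int r) < \<delta>
        then lifted_block \<delta> m (idx d (int c - int r)) i j else 0) * w $ (c * N + j))"
    by (intro sum.cong refl)
      (use index_less r i in \<open>simp add: lifted_mat_def Let_def block_index_div block_index_mod\<close>)
  also have "\<dots> = (\<Sum>l<d. \<Sum>j<N. (if l < \<delta> then lifted_block \<delta> m l i j else 0)
        * w $ (((r + l) mod d) * N + j))"
    by (subst sum_cyclic[of _ r], intro sum.cong refl) (simp add: idx_shift)
  also have "\<dots> = (\<Sum>l<\<delta>. \<Sum>j<N. (if l < \<delta> then lifted_block \<delta> m l i j else 0)
        * w $ (((r + l) mod d) * N + j))"
    by (rule sum.mono_neutral_right) (use \<delta>_less_d in auto)
  finally show ?thesis by simp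
qed

lemma perm_mat_mult_index:
  assumes r: "r < d" and i: "i < N" and v: "v \<in> carrier_vec (meas_dim d \<delta>)"
  shows "(perm_mat d \<delta> *\<^sub>v v) $ (r * N + i) = v $ (i * d + r)"
proof -
  have lt: "i * d + r < meas_dim d \<delta>"
    using block_index_less[OF i r] by (simp add: meas_dim_def mult.commute)
  have "(perm_mat d \<delta> *\<^sub>v v) $ (r * N + i)
      = (\<Sum>q<meas_dim d \<delta>. perm_mat d \<delta> $$ (r * N + i, q) * v $ q)"
    using v index_less[OF r i] by (simp add: perm_mat_def scalar_prod_def atLeast0LessThan)
  also have "\<dots> = (\<Sum>q<meas_dim d \<delta>. if q = i * d + r then v $ q else 0)"
    by (intro sum.cong refl)
      (use index_less[OF r i] i in \<open>simp add: perm_mat_def Let_def block_index_div block_index_mod\<close>)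
  finally show ?thesis using lt by simp
qed

lemma pos_near:
  assumes s: "s < \<delta>" and t: "t < \<delta>"
  shows "pos d \<delta> ((r + t) mod d) ((r + s) mod d)
    = (if s \<le> t then ((r + s) mod d) * N + (t - s) else ((r + s - 1) mod d) * N + (N - (s - t)))"
proof (cases "s \<le> t")
  case True
  have "idx d (int ((r + t) mod d) - int ((r + s) mod d)) = idx d (int (t - s))"
    using True by (simp add: idx_def of_nat_mod mod_diff_eq)
  also have "\<dots> = t - s" using t \<delta>_less_d by (simp add: idx_of_nat)
  finally have 1: "idx d (int ((r + t) mod d) - int ((r + s) mod d)) = t - s" .
  show ?thesis unfolding pos_def Let_def 1 using True t by simp
next
  case False
  have *: "idx d (int ((r + s) mod d) - int ((r + t) mod d)) = idx d (int (s - t))"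
    using False by (simp add: idx_def of_nat_mod mod_diff_eq)
  also have "\<dots> = s - t" using s \<delta>_less_d by (simp add: idx_of_nat)
  finally have 1: "idx d (int ((r + s) mod d) - int ((r + t) mod d)) = s - t" .
  have 2: "idx d (int ((r + t) mod d) - int ((r + s) mod d)) = d - (s - t)"
    using idx_uminus[OF d_pos, of "int ((r + s) mod d) - int ((r + t) mod d)"] 1 False by simp
  have 3: "idx d (int ((r + s) mod d) - 1) = (r + s - 1) mod d"
  proof -
    have "idx d (int ((r + s) mod d) - 1) = idx d (int (r + s - 1))"
      using False by (simp add: idx_def of_nat_mod mod_diff_left_eq of_nat_diff)
    then show ?thesis by (simp add: idx_nat)
  qed
  show ?thesis unfolding pos_def Let_def 1 2 3 using False s \<delta>_double by auto
qed

text \<open>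
  The two cases in the definition of a block enumerate the pairs of mask positions \<open>(s, t)\<close> with
  \<open>s \<le> t\<close> and with \<open>t < s\<close>. In terms of pairs, a row of the lifted matrix is the Hermitian form
  which expands the squared modulus of a single measurement.
\<close>

lemma lifted_mat_mult_pairs:
  assumes r: "r < d" and i: "i < N" and w: "w \<in> carrier_vec (meas_dim d \<delta>)"
  shows "(lifted_mat d \<delta> m *\<^sub>v w) $ (r * N + i)
    = (\<Sum>s<\<delta>. \<Sum>t<\<delta>. m i $ s * cnj (m i $ t) * w $ pos d \<delta> ((r + t) mod d) ((r + s) mod d))"
proof -
  define F where "F = (\<lambda>s t. m i $ s * cnj (m i $ t) * w $ pos d \<delta> ((r + t) mod d) ((r + s) mod d))"
  have split: "(\<Sum>j<N. lifted_block \<delta> m l i j * w $ (((r + l) mod d) * N + j))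
      = (\<Sum>t=l..<\<delta>. F l t) + (if Suc l < \<delta> then \<Sum>t<Suc l. F (Suc l) t else 0)" if l: "l < \<delta>" for l
  proof -
    let ?f = "\<lambda>j. lifted_block \<delta> m l i j * w $ (((r + l) mod d) * N + j)"
    have "{..<N} = {..<\<delta> - l} \<union> {\<delta> - l..<2 * \<delta> - 2 - l} \<union> {2 * \<delta> - 2 - l..<N}"
      using l by auto
    moreover have "sum ?f ({..<\<delta> - l} \<union> {\<delta> - l..<2 * \<delta> - 2 - l} \<union> {2 * \<delta> - 2 - l..<N})
        = sum ?f {..<\<delta> - l} + sum ?f {2 * \<delta> - 2 - l..<N}" if "Suc l < \<delta>"
    proof -
      have "sum ?f {\<delta> - l..<2 * \<delta> - 2 - l} = 0"
        by (rule sum.neutral) (auto simp: lifted_block_def)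
      then show ?thesis using that
        by (subst sum.union_disjoint, simp, simp, force, subst sum.union_disjoint) auto
    qed
    moreover have "sum ?f {..<N} = sum ?f {..<\<delta> - l}" if "\<not> Suc l < \<delta>"
      by (rule sum.mono_neutral_right) (use that l in \<open>auto simp: lifted_block_def\<close>)
    moreover have "sum ?f {..<\<delta> - l} = (\<Sum>t=l..<\<delta>. F l t)"
      by (rule sum.reindex_bij_witness[where i = "\<lambda>t. t - l" and j = "\<lambda>j. l + j"])
        (use l in \<open>auto simp: F_def pos_near lifted_block_def\<close>)
    moreover have "sum ?f {2 * \<delta> - 2 - l..<N} = (\<Sum>t<Suc l. F (Suc l) t)" if sl: "Suc l < \<delta>"
    proof (rule sum.reindex_bij_witness[where i = "\<lambda>t. t + (2 * \<delta> - 2 - l)" and j = "\<lambda>j. j - (2 * \<delta> - 2 - l)"])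
      fix j assume j: "j \<in> {2 * \<delta> - 2 - l..<N}"
      then have "\<not> l + j < \<delta>" "2 * \<delta> \<le> l + j + 2" using sl by auto
      moreover have "l + j + 2 - 2 * \<delta> = j - (2 * \<delta> - 2 - l)" using j sl by auto
      moreover have "pos d \<delta> ((r + (j - (2 * \<delta> - 2 - l))) mod d) ((r + Suc l) mod d) = ((r + l) mod d) * N + j"
      proof -
        have "N - (Suc l - (j - (2 * \<delta> - 2 - l))) = j" "\<not> Suc l \<le> j - (2 * \<delta> - 2 - l)"
          "j - (2 * \<delta> - 2 - l) < \<delta>" using j sl by auto
        then show ?thesis by (subst pos_near) (use sl in auto)
      qed
      ultimately show "F (Suc l) (j - (2 * \<delta> - 2 - l)) = ?f j"
        using sl by (simp add: F_def lifted_block_def)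
    qed (use sl in auto)
    ultimately show ?thesis by auto
  qed
  have "(lifted_mat d \<delta> m *\<^sub>v w) $ (r * N + i)
      = (\<Sum>l<\<delta>. (\<Sum>t=l..<\<delta>. F l t) + (if Suc l < \<delta> then \<Sum>t<Suc l. F (Suc l) t else 0))"
    unfolding lifted_mat_mult_index[OF assms] by (intro sum.cong refl split) simp
  also have "\<dots> = (\<Sum>l<\<delta>. \<Sum>t=l..<\<delta>. F l t) + (\<Sum>l<\<delta>. if Suc l < \<delta> then \<Sum>t<Suc l. F (Suc l) t else 0)"
    by (rule sum.distrib)
  also have "(\<Sum>l<\<delta>. if Suc l < \<delta> then \<Sum>t<Suc l. F (Suc l) t else 0) = (\<Sum>s<\<delta>. \<Sum>t<s. F s t)"
  proof -
    obtain k where k: "\<delta> = Suc k" using \<delta>_pos by (cases \<delta>) auto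
    have "(\<Sum>l<Suc k. if Suc l < Suc k then \<Sum>t<Suc l. F (Suc l) t else 0) = (\<Sum>l<k. \<Sum>t<Suc l. F (Suc l) t)"
      by simp
    also have "\<dots> = (\<Sum>s<Suc k. \<Sum>t<s. F s t)" by (subst sum.lessThan_Suc_shift) simp
    finally show ?thesis unfolding k .
  qed
  also have "(\<Sum>l<\<delta>. \<Sum>t=l..<\<delta>. F l t) + \<dots> = (\<Sum>s<\<delta>. \<Sum>t<\<delta>. F s t)"
    unfolding sum.distrib [symmetric]
  proof (intro sum.cong refl)
    fix s assume "s \<in> {..<\<delta>}"
    then have *: "{..<\<delta>} = {s..<\<delta>} \<union> {..<s}" by auto
    show "(\<Sum>t=s..<\<delta>. F s t) + (\<Sum>t<s. F s t) = (\<Sum>t<\<delta>. F s t)"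
      unfolding * by (rule sum.union_disjoint [symmetric]) auto
  qed
  finally show ?thesis by (simp add: F_def)
qed

lemma meas_index:
  assumes r: "r < d" and i: "i < N" and x: "x \<in> carrier_vec d"
    and m: "\<And>k. \<delta> \<le> k \<Longrightarrow> k < d \<Longrightarrow> m i $ k = 0"
  shows "meas d \<delta> m x $ (i * d + r) = (cmod (\<Sum>k<\<delta>. cnj (m i $ k) * x $ ((r + k) mod d)))\<^sup>2"
proof -
  have lt: "i * d + r < meas_dim d \<delta>"
    using block_index_less[OF i r] by (simp add: meas_dim_def mult.commute)
  have "(meas_mat d \<delta> m *\<^sub>v x) $ (i * d + r)
      = (\<Sum>j<d. cnj (m i $ idx d (int j - int r)) * x $ j)"
    using x lt r by (simp add: meas_mat_def scalar_prod_def atLeast0LessThan Let_def)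
  also have "\<dots> = (\<Sum>k<d. cnj (m i $ k) * x $ ((r + k) mod d))"
    by (subst sum_cyclic[of _ r]) (simp add: idx_shift)
  also have "\<dots> = (\<Sum>k<\<delta>. cnj (m i $ k) * x $ ((r + k) mod d))"
    by (rule sum.mono_neutral_right) (use \<delta>_less_d m in auto)
  finally show ?thesis using lt by (simp add: meas_def meas_mat_def)
qed

lemma near_idx: "idx d (int ((r + t) mod d) - int ((r + s) mod d)) < \<delta> \<or>
    idx d (int ((r + s) mod d) - int ((r + t) mod d)) < \<delta>" if "s < \<delta>" "t < \<delta>"
proof (cases "s \<le> t")
  case True
  then have "idx d (int ((r + t) mod d) - int ((r + s) mod d)) = idx d (int (t - s))"
    by (simp add: idx_def of_nat_mod mod_diff_eq)
  also have "\<dots> < \<delta>" using that \<delta>_less_d by (simp add: idx_of_nat)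
  finally show ?thesis by simp
next
  case False
  then have "idx d (int ((r + s) mod d) - int ((r + t) mod d)) = idx d (int (s - t))"
    by (simp add: idx_def of_nat_mod mod_diff_eq)
  also have "\<dots> < \<delta>" using that \<delta>_less_d by (simp add: idx_of_nat)
  finally show ?thesis by simp
qed

lemma lifted_vec_carrier: "lifted_vec d \<delta> x \<in> carrier_vec (meas_dim d \<delta>)"
  by (simp add: lifted_vec_def)

lemma meas_carrier: "meas d \<delta> m x \<in> carrier_vec (meas_dim d \<delta>)"
  by (rule carrier_vecI) (simp add: meas_def meas_mat_def)

text \<open>
  Lifting: by \<open>lifted_mat_mult_pairs\<close>, a row of the left hand side is
  \<open>\<Sum>s t. m s * cnj (m t) * cnj (x (r + s)) * x (r + t)\<close>, a product of a complex number with its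
  conjugate.
\<close>

lemma lifted_mat_lifted_vec:
  assumes x: "x \<in> carrier_vec d" and m: "\<And>i k. \<delta> \<le> k \<Longrightarrow> k < d \<Longrightarrow> m i $ k = 0"
  shows "lifted_mat d \<delta> m *\<^sub>v lifted_vec d \<delta> x
    = perm_mat d \<delta> *\<^sub>v map_vec complex_of_real (meas d \<delta> m x)"
proof (rule eq_vecI)
  show "dim_vec (lifted_mat d \<delta> m *\<^sub>v lifted_vec d \<delta> x)
      = dim_vec (perm_mat d \<delta> *\<^sub>v map_vec complex_of_real (meas d \<delta> m x))"
    by (simp add: lifted_mat_def perm_mat_def)
next
  fix p assume "p < dim_vec (perm_mat d \<delta> *\<^sub>v map_vec complex_of_real (meas d \<delta> m x))"
  then have "p < meas_dim d \<delta>" by (simp add: perm_mat_def)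
  then obtain r i where p: "p = r * N + i" and r: "r < d" and i: "i < N"
    using index_div_mod by blast
  have lt: "i * d + r < meas_dim d \<delta>"
    using block_index_less[OF i r] by (simp add: meas_dim_def mult.commute)
  have "(lifted_mat d \<delta> m *\<^sub>v lifted_vec d \<delta> x) $ p
    = (\<Sum>s<\<delta>. \<Sum>t<\<delta>. m i $ s * cnj (m i $ t) * (x $ ((r + t) mod d) * cnj (x $ ((r + s) mod d))))"
    unfolding p lifted_mat_mult_pairs[OF r i lifted_vec_carrier]
    by (intro sum.cong refl arg_cong2[of _ _ _ _ "(*)"] lifted_vec_pos[OF \<delta>_pos \<delta>_less _ _ near_idx])
      (use d_pos in auto)
  also have "\<dots> = cnj (\<Sum>k<\<delta>. cnj (m i $ k) * x $ ((r + k) mod d))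
      * (\<Sum>k<\<delta>. cnj (m i $ k) * x $ ((r + k) mod d))"
    by (simp add: sum_product mult_ac)
  also have "\<dots> = (perm_mat d \<delta> *\<^sub>v map_vec complex_of_real (meas d \<delta> m x)) $ p"
  proof -
    have dim: "dim_vec (meas d \<delta> m x) = meas_dim d \<delta>" using meas_carrier[of m x] by auto
    then have "map_vec complex_of_real (meas d \<delta> m x) \<in> carrier_vec (meas_dim d \<delta>)"
      by (intro carrier_vecI) simp
    from perm_mat_mult_index[OF r i this]
    have "(perm_mat d \<delta> *\<^sub>v map_vec complex_of_real (meas d \<delta> m x)) $ p
        = complex_of_real (meas d \<delta> m x $ (i * d + r))"
      using lt dim by (simp add: p)
    also have "\<dots> = complex_of_real ((cmod (\<Sum>k<\<delta>. cnj (m i $ k) * x $ ((r + k) mod d)))\<^sup>2)"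
      by (subst meas_index[OF r i x m]) simp_all
    finally show ?thesis by (simp only: complex_norm_square mult.commute)
  qed
  finally show "(lifted_mat d \<delta> m *\<^sub>v lifted_vec d \<delta> x) $ p
    = (perm_mat d \<delta> *\<^sub>v map_vec complex_of_real (meas d \<delta> m x)) $ p" .
qed

end


section \<open>Elementary estimates for norms\<close>

lemma l2norm_nonneg: "0 \<le> l2norm v"
  by (simp add: l2norm_def L2_set_nonneg)

lemma l2norm_squared: "(l2norm v)\<^sup>2 = (\<Sum>i<dim_vec v. (norm (v $ i))\<^sup>2)"
  by (simp add: l2norm_def L2_set_def sum_nonneg)

lemma sqrt_diff_squared_le:
  fixes a b :: real
  assumes "0 \<le> a" "0 \<le> b"
  shows "(a - sqrt b)\<^sup>2 \<le> \<bar>a\<^sup>2 - b\<bar>"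
proof -
  have "(a - sqrt b)\<^sup>2 = \<bar>a - sqrt b\<bar> * \<bar>a - sqrt b\<bar>" by (simp add: power2_eq_square flip: abs_mult)
  also have "\<dots> \<le> \<bar>a - sqrt b\<bar> * \<bar>a + sqrt b\<bar>"
    using assms real_sqrt_ge_zero[of b] by (intro mult_left_mono) (auto simp: abs_le_iff)
  also have "\<dots> = \<bar>(a - sqrt b) * (a + sqrt b)\<bar>" by (simp only: abs_mult)
  also have "(a - sqrt b) * (a + sqrt b) = a\<^sup>2 - b" using assms by (simp add: algebra_simps power2_eq_square)
  finally show ?thesis .
qed


section \<open>Inverting the lifted system of the exponential masks\<close>

context local_correlation
begin

text \<open>
  The moduli of the mask entries are values of \<open>decay\<close> at natural arguments, up to normalization, so that
  \<open>decay_add\<close> evaluates their products. The ratio of the geometric progressions is \<open>decay 2\<close>.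
\<close>

definition decay :: "nat \<Rightarrow> real" where
  "decay k = exp (- real k / max 4 ((real \<delta> - 1) / 2))"

lemma decay_add: "decay (j + k) = decay j * decay k"
proof -
  let ?a = "max 4 ((real \<delta> - 1) / 2)"
  have "- real (j + k) / ?a = (- real j + - real k) / ?a" by simp
  also have "\<dots> = - real j / ?a + - real k / ?a" by (rule add_divide_distrib)
  finally show ?thesis unfolding decay_def by (simp only: exp_add)
qed

lemma decay_pos: "0 < decay k"
  by (simp add: decay_def)

lemma decay_0 [simp]: "decay 0 = 1"
  by (simp add: decay_def)

lemma decay_mult: "decay (j * k) = decay j ^ k"
  by (induction k) (simp_all add: decay_add)

lemma decay_less_1: "0 < k \<Longrightarrow> decay k < 1"
  by (simp add: decay_def divide_neg_pos)

lemma decay_power_less_1: "0 < L \<Longrightarrow> decay 2 ^ L < 1"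
  by (simp flip: decay_mult add: decay_less_1)

abbreviation mask :: "nat \<Rightarrow> complex vec" where "mask \<equiv> exp_mask d \<delta>"

lemma mask_zero: "\<delta> \<le> k \<Longrightarrow> k < d \<Longrightarrow> mask l $ k = 0"
  by (simp add: exp_mask_def)

lemma mask_product:
  assumes "s < \<delta>" "t < \<delta>"
  shows "mask i $ s * cnj (mask i $ t)
    = complex_of_real (decay (s + t + 2) / sqrt (real N))
      * (unity_root N (i * s) * cnj (unity_root N (i * t)))"
proof -
  define g where "g = root 4 (2 * real \<delta> - 1)"
  have N: "real N = 2 * real \<delta> - 1" using \<delta>_pos by simp
  have "root 4 x * root 4 x = sqrt x" if "x \<ge> 0" for x
    using real_root_mult_exp[of 2 2 x] that by (simp add: sqrt_def [symmetric])
  then have gg: "g * g = sqrt (real N)" using N by (simp add: g_def)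
  have entry: "mask i $ k = complex_of_real (decay (k + 1) / g) * unity_root N (i * k)" if "k < \<delta>" for k
    using that \<delta>_less_d by (simp add: exp_mask_def decay_def unity_root_def g_def mult_ac)
  have "mask i $ s * cnj (mask i $ t) = complex_of_real (decay (s + 1) * decay (t + 1) / (g * g))
      * (unity_root N (i * s) * cnj (unity_root N (i * t)))"
    by (simp add: entry assms)
  also have "decay (s + 1) * decay (t + 1) = decay (s + t + 2)"
    by (simp add: decay_add [symmetric])
  finally show ?thesis by (simp only: gg)
qed

text \<open>
  Column \<open>j\<close> of the block \<open>l\<close>, stripped of its normalized Fourier factor (\<open>lifted_block_mask\<close>). As a function of
  \<open>l\<close> it is a geometric progression with ratio \<open>decay 2\<close>. It starts at \<open>l = 0\<close> for \<open>j < \<delta>\<close> and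
  at \<open>l = N - j - 1\<close> otherwise. Up to this shift the kernels of \<open>j\<close> and \<open>N - j\<close> agree.
\<close>

definition mask_kernel :: "nat \<Rightarrow> nat \<Rightarrow> real" where
  "mask_kernel l j = (if j < \<delta> then if l + j < \<delta> then decay (j + 2) * decay 2 ^ l else 0
     else if N \<le> l + j + 1 \<and> l + 1 < \<delta> then decay (N - j + 2) * decay 2 ^ (l + 1 - (N - j)) else 0)"

text \<open>
  For \<open>l + j < \<delta>\<close> the two mask positions are \<open>l\<close> and \<open>l + j\<close>, in the other case \<open>l + 1\<close> and
  \<open>l + 1 - (N - j)\<close>. Their difference is \<open>- j\<close> modulo \<open>N\<close> both times, which gives the Fourier factor;
  their sum gives the exponent of the decay.
\<close>

lemma lifted_block_mask:
  assumes l: "l < \<delta>" and j: "j < N"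
  shows "lifted_block \<delta> mask l i j
    = complex_of_real (mask_kernel l j / sqrt (real N)) * cnj (unity_root N (j * i))"
proof (cases "l + j < \<delta>")
  case True
  have "unity_root N (i * l) * cnj (unity_root N (i * (l + j)))
      = (unity_root N (i * l) * cnj (unity_root N (i * l))) * cnj (unity_root N (j * i))"
    by (simp only: distrib_left unity_root_add complex_cnj_mult mult_ac)
  then have u: "unity_root N (i * l) * cnj (unity_root N (i * (l + j))) = cnj (unity_root N (j * i))"
    by simp
  have "decay (l + (l + j) + 2) = decay ((j + 2) + 2 * l)" by (rule arg_cong[of _ _ decay]) simp
  also have "\<dots> = decay (j + 2) * decay 2 ^ l" by (simp only: decay_add decay_mult)
  finally have k: "decay (l + (l + j) + 2) = mask_kernel l j" using True by (simp add: mask_kernel_def)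
  have "lifted_block \<delta> mask l i j = mask i $ l * cnj (mask i $ (l + j))"
    using True by (simp add: lifted_block_def)
  also have "\<dots> = complex_of_real (mask_kernel l j / sqrt (real N)) * cnj (unity_root N (j * i))"
    using mask_product[OF l True, of i] unfolding u k .
  finally show ?thesis .
next
  case False
  show ?thesis
  proof (cases "N \<le> l + j + 1 \<and> l + 1 < \<delta>")
    case T: True
    define t where "t = l + j + 2 - 2 * \<delta>"
    have t: "t < \<delta>" "2 * \<delta> \<le> l + j + 2" "\<not> j < \<delta>" "l + 1 = t + (N - j)" using T j by (auto simp: t_def)
    have "cnj (unity_root N (j * i)) = unity_root N ((N - j) * i)"
    proof (rule cnj_unity_root)
      have "j * i + (N - j) * i = (j + (N - j)) * i" by (rule distrib_right [symmetric])
      also have "j + (N - j) = N" using j by (intro le_add_diff_inverse) (rule less_imp_le)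
      finally show "N dvd j * i + (N - j) * i" by (simp only: dvd_triv_left)
    qed
    moreover have "unity_root N (i * (l + 1)) * cnj (unity_root N (i * t))
        = unity_root N ((N - j) * i) * (unity_root N (i * t) * cnj (unity_root N (i * t)))"
      unfolding t(4) by (simp only: distrib_left unity_root_add mult_ac)
    ultimately have u: "unity_root N (i * (l + 1)) * cnj (unity_root N (i * t)) = cnj (unity_root N (j * i))"
      by simp
    have "decay ((l + 1) + t + 2) = decay ((N - j + 2) + 2 * t)"
      unfolding t(4) by (rule arg_cong[of _ _ decay]) simp
    also have "\<dots> = decay (N - j + 2) * decay 2 ^ t" by (simp only: decay_add decay_mult)
    also have "\<dots> = mask_kernel l j"
    proof -
      have "l + 1 - (N - j) = t" unfolding t(4) by (rule add_diff_cancel_right')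
      then show ?thesis unfolding mask_kernel_def if_not_P[OF t(3)] if_P[OF T] by (rule ssubst) (rule refl)
    qed
    finally have k: "decay ((l + 1) + t + 2) = mask_kernel l j" .
    have "lifted_block \<delta> mask l i j = mask i $ (l + 1) * cnj (mask i $ t)"
      using False T t(2) by (simp add: lifted_block_def t_def)
    also have "\<dots> = complex_of_real (mask_kernel l j / sqrt (real N)) * cnj (unity_root N (j * i))"
      using mask_product[OF conjunct2[OF T] t(1), of i] unfolding u k .
    finally show ?thesis .
  next
    case F: False
    then have "lifted_block \<delta> mask l i j = 0" using False by (auto simp: lifted_block_def)
    moreover have "mask_kernel l j = 0" using F False by (auto simp: mask_kernel_def)
    ultimately show ?thesis by simp
  qed
qed

text \<open>
  The measurements of block \<open>r\<close> after the inverse of the unitary Fourier transform. Reducing \<open>r\<close>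
  modulo \<open>d\<close> makes it a periodic function on the natural numbers.
\<close>

definition spectrum :: "real vec \<Rightarrow> nat \<Rightarrow> nat \<Rightarrow> complex" where
  "spectrum b j r = dft N (\<lambda>i. complex_of_real (b $ (i * d + r mod d))) j / complex_of_real (sqrt (real N))"

lemma spectrum_mod: "spectrum b j (r mod d) = spectrum b j r"
  by (simp add: spectrum_def)

text \<open>
  The data are real.
\<close>

lemma spectrum_cnj: "j \<le> N \<Longrightarrow> spectrum b (N - j) r = cnj (spectrum b j r)"
proof -
  assume j: "j \<le> N"
  have "unity_root N (i * (N - j)) = cnj (unity_root N (i * j))" for i
  proof -
    have "i * j + i * (N - j) = i * (j + (N - j))" by (rule distrib_left [symmetric])
    also have "j + (N - j) = N" using j by (rule le_add_diff_inverse)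
    finally have "N dvd i * j + i * (N - j)" by (simp only: dvd_triv_right)
    then show ?thesis by (rule cnj_unity_root [symmetric])
  qed
  then show ?thesis by (simp add: spectrum_def dft_def)
qed

text \<open>
  The Fourier factors in \<open>lifted_block_mask\<close> are undone by orthogonality. What remains of the lifted
  system is one cyclic convolution along the blocks for every offset \<open>j\<close>.
\<close>

lemma lifted_system_spectrum:
  assumes b: "b \<in> carrier_vec (meas_dim d \<delta>)" and w: "w \<in> carrier_vec (meas_dim d \<delta>)"
    and eq: "lifted_mat d \<delta> mask *\<^sub>v w = perm_mat d \<delta> *\<^sub>v map_vec complex_of_real b"
    and j: "j < N"
  shows "(\<Sum>l<\<delta>. complex_of_real (mask_kernel l j) * w $ (((r + l) mod d) * N + j)) = spectrum b j r"
proof -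
  define X where "X = (\<lambda>j. \<Sum>l<\<delta>. complex_of_real (mask_kernel l j) * w $ (((r + l) mod d) * N + j))"
  define c where "c = complex_of_real (sqrt (real N))"
  have c: "c \<noteq> 0" using N_pos by (simp add: c_def)
  have cc: "c * c = of_nat N"
    unfolding c_def of_real_mult [symmetric] real_sqrt_mult_self abs_of_nat of_real_of_nat_eq ..
  have bi: "c * complex_of_real (b $ (i * d + r mod d)) = (\<Sum>j<N. X j * cnj (unity_root N (j * i)))"
    if i: "i < N" for i
  proof -
    have rd: "r mod d < d" using d_pos by simp
    have lt: "i * d + r mod d < meas_dim d \<delta>"
      using block_index_less[OF i rd] by (simp add: meas_dim_def mult.commute)
    have "complex_of_real (b $ (i * d + r mod d))
        = (perm_mat d \<delta> *\<^sub>v map_vec complex_of_real b) $ ((r mod d) * N + i)"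
      using lt b by (subst perm_mat_mult_index[OF rd i]) auto
    also have "\<dots> = (\<Sum>l<\<delta>. \<Sum>j<N. lifted_block \<delta> mask l i j * w $ (((r + l) mod d) * N + j))"
      unfolding eq [symmetric] by (simp only: lifted_mat_mult_index[OF rd i w] mod_add_left_eq)
    also have "\<dots> = (\<Sum>l<\<delta>. \<Sum>j<N. (complex_of_real (mask_kernel l j) * w $ (((r + l) mod d) * N + j)
        * cnj (unity_root N (j * i))) / c)"
      by (intro sum.cong refl) (simp add: lifted_block_mask c_def)
    also have "\<dots> = (\<Sum>j<N. X j * cnj (unity_root N (j * i))) / c"
      by (subst sum.swap) (simp add: X_def sum_distrib_right sum_divide_distrib)
    finally show ?thesis using c by simp
  qed
  have "c * dft N (\<lambda>i. complex_of_real (b $ (i * d + r mod d))) j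
      = (\<Sum>i<N. (c * complex_of_real (b $ (i * d + r mod d))) * unity_root N (i * j))"
    by (simp add: dft_def sum_distrib_left mult_ac)
  also have "\<dots> = dft N (\<lambda>i. \<Sum>j<N. X j * cnj (unity_root N (j * i))) j"
    unfolding dft_def by (intro sum.cong refl) (simp add: bi)
  also have "\<dots> = of_nat N * X j" by (rule dft_cnj_dft [OF j])
  also have "\<dots> = c * (c * X j)" by (simp only: cc [symmetric] mult.assoc)
  finally have "dft N (\<lambda>i. complex_of_real (b $ (i * d + r mod d))) j = c * X j" using c by simp
  then show ?thesis using c by (simp add: spectrum_def c_def X_def)
qed

text \<open>
  The solution formula of \<open>geometric_deconvolution\<close> for the progression of length \<open>\<delta> - j\<close> that starts
  with \<open>decay (j + 2)\<close>.
\<close>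

definition deconvolved :: "real vec \<Rightarrow> nat \<Rightarrow> nat \<Rightarrow> complex" where
  "deconvolved b j r = geom_sum (complex_of_real (decay 2) ^ (\<delta> - j)) (\<delta> - j)
      (\<lambda>r. (spectrum b j r - complex_of_real (decay 2) * spectrum b j (Suc r)) / complex_of_real (decay (j + 2))) d r
    / (1 - complex_of_real (decay 2) ^ ((\<delta> - j) * d))"

lemma deconvolved_mod: "deconvolved b j (r mod d) = deconvolved b j r"
proof -
  have "spectrum b j (Suc (r mod d)) = spectrum b j (Suc r)" for r
    using spectrum_mod[of b j "Suc (r mod d)"] spectrum_mod[of b j "Suc r"] by (simp add: mod_Suc_eq)
  then show ?thesis unfolding deconvolved_def by (subst geom_sum_mod) (simp_all add: spectrum_mod)
qed

lemma deconvolution: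
  assumes period: "\<And>r. f (r + d) = f r" and j: "j < \<delta>"
    and conv: "\<And>r. (\<Sum>l<\<delta> - j. complex_of_real (decay (j + 2)) * complex_of_real (decay 2) ^ l * f (r + l))
      = spectrum b j r"
  shows "f r = deconvolved b j r"
  unfolding deconvolved_def
proof (rule geometric_deconvolution[OF period conv])
  show "complex_of_real (decay (j + 2)) \<noteq> 0" using decay_pos[of "j + 2"] by simp
  have "decay 2 ^ ((\<delta> - j) * d) \<noteq> 1" using decay_power_less_1[of "(\<delta> - j) * d"] j d_pos by auto
  then show "complex_of_real (decay 2) ^ ((\<delta> - j) * d) \<noteq> 1"
    by (metis of_real_eq_1_iff of_real_power)
qed

text \<open>
  The offset \<open>j\<close> with \<open>\<delta> \<le> j\<close> stands for \<open>j - N\<close>. Its entries are conjugates of those with offset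
  \<open>N - j\<close>, taken \<open>N - j - 1\<close> blocks earlier because the kernel starts that much later. The summand
  \<open>d\<close> keeps the truncated subtraction from truncating; \<open>deconvolved\<close> is periodic.
\<close>

definition inverse_lift :: "real vec \<Rightarrow> complex vec" where
  "inverse_lift b = vec (meas_dim d \<delta>) (\<lambda>k. let r = k div N; j = k mod N in
     if j < \<delta> then deconvolved b j r else cnj (deconvolved b (N - j) (r + d - (N - j - 1))))"

text \<open>
  For \<open>j < \<delta>\<close> the function \<open>\<lambda>r. w $ (r * N + j)\<close> solves the convolution equation directly. For
  \<open>j = N - i\<close> the conjugate of that function, shifted by \<open>i - 1\<close>, solves the equation of \<open>i\<close>. Uniqueness
  in \<open>geometric_deconvolution\<close> does the rest.
\<close>

lemma lifted_system_solution:
  assumes b: "b \<in> carrier_vec (meas_dim d \<delta>)" and w: "w \<in> carrier_vec (meas_dim d \<delta>)"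
    and eq: "lifted_mat d \<delta> mask *\<^sub>v w = perm_mat d \<delta> *\<^sub>v map_vec complex_of_real b"
  shows "w = inverse_lift b"
proof (rule eq_vecI)
  show "dim_vec w = dim_vec (inverse_lift b)" using w by (simp add: inverse_lift_def)
next
  fix k assume "k < dim_vec (inverse_lift b)"
  then have k: "k < meas_dim d \<delta>" by (simp add: inverse_lift_def)
  define r where "r = k div N"
  define j where "j = k mod N"
  have r: "r < d" and j: "j < N" and krj: "k = r * N + j"
    using index_div_mod[OF k] by (simp_all add: r_def j_def)
  note spec = lifted_system_spectrum[OF b w eq]
  show "w $ k = inverse_lift b $ k"
  proof (cases "j < \<delta>")
    case True
    have "w $ ((r mod d) * N + j) = deconvolved b j r"
    proof (rule deconvolution[where f = "\<lambda>r. w $ ((r mod d) * N + j)", OF _ True])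
      fix r
      have "(\<Sum>l<\<delta> - j. complex_of_real (decay (j + 2)) * complex_of_real (decay 2) ^ l
            * w $ (((r + l) mod d) * N + j))
          = (\<Sum>l<\<delta>. complex_of_real (mask_kernel l j) * w $ (((r + l) mod d) * N + j))"
        by (rule sum.mono_neutral_cong_left) (use True in \<open>auto simp: mask_kernel_def\<close>)
      also have "\<dots> = spectrum b j r" by (rule spec[OF j])
      finally show "(\<Sum>l<\<delta> - j. complex_of_real (decay (j + 2)) * complex_of_real (decay 2) ^ l
            * w $ (((r + l) mod d) * N + j)) = spectrum b j r" .
    qed simp
    then show ?thesis unfolding krj using True r index_less[OF r j]
      by (simp add: inverse_lift_def Let_def block_index_div[OF j] block_index_mod[OF j])
  next
    case False
    define i where "i = N - j"
    have i: "0 < i" "i < \<delta>" "j = N - i" using False j by (auto simp: i_def)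
    have "cnj (w $ (((r + d - (i - 1) + (i - 1)) mod d) * N + j)) = deconvolved b i (r + d - (i - 1))"
    proof (rule deconvolution[where f = "\<lambda>r. cnj (w $ (((r + (i - 1)) mod d) * N + j))", OF _ i(2)])
      fix r
      have "r + d + (i - 1) = r + (i - 1) + d" by simp
      then show "cnj (w $ ((r + d + (i - 1)) mod d * N + j)) = cnj (w $ ((r + (i - 1)) mod d * N + j))"
        by (simp only: mod_add_self2)
      have "(\<Sum>l<\<delta> - i. complex_of_real (decay (i + 2)) * complex_of_real (decay 2) ^ l
            * cnj (w $ (((r + l + (i - 1)) mod d) * N + j)))
          = (\<Sum>l\<in>{i - 1..<\<delta> - 1}. complex_of_real (mask_kernel l j) * cnj (w $ (((r + l) mod d) * N + j)))"
        by (rule sum.reindex_bij_witness[where i = "\<lambda>l. l - (i - 1)" and j = "\<lambda>l. l + (i - 1)"])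
          (use i j in \<open>auto simp: mask_kernel_def add_ac\<close>)
      also have "\<dots> = (\<Sum>l<\<delta>. complex_of_real (mask_kernel l j) * cnj (w $ (((r + l) mod d) * N + j)))"
        by (rule sum.mono_neutral_left) (use i False in \<open>auto simp: mask_kernel_def\<close>)
      also have "\<dots> = cnj (spectrum b j r)"
        by (simp flip: spec[OF j])
      also have "\<dots> = spectrum b i r"
      proof -
        have "i \<le> N" using i(2) by simp
        from spectrum_cnj[OF this, of b r] show ?thesis unfolding i(3) by simp
      qed
      finally show "(\<Sum>l<\<delta> - i. complex_of_real (decay (i + 2)) * complex_of_real (decay 2) ^ l
            * cnj (w $ (((r + l + (i - 1)) mod d) * N + j))) = spectrum b i r" .
    qed
    moreover have "(r + d - (i - 1) + (i - 1)) mod d = r" using i \<delta>_less_d r by simp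
    ultimately have "cnj (w $ k) = deconvolved b i (r + d - (i - 1))" by (simp add: krj)
    then have "w $ k = cnj (deconvolved b i (r + d - (i - 1)))" by (metis complex_cnj_cnj)
    then show ?thesis
      unfolding krj i_def inverse_lift_def index_vec[OF index_less[OF r j]] Let_def
        block_index_div[OF j] block_index_mod[OF j] if_not_P[OF False] .
  qed
qed

text \<open>
  The position of \<open>x\<^sub>p * cnj x\<^sub>c\<close>, with \<open>p\<close> ahead of \<open>c\<close> by less than \<open>\<delta>\<close>, lies in the first part of a
  block, the position of \<open>x\<^sub>c * cnj x\<^sub>p\<close> in the second part (\<open>inverse_lift_pos_cnj\<close>). The shift in
  \<open>inverse_lift\<close> is exactly what makes the two entries conjugate to each other.
\<close>

lemma inverse_lift_pos:
  assumes p: "p < d" and c: "c < d" and near: "idx d (int p - int c) < \<delta>"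
  shows "inverse_lift b $ pos d \<delta> p c = deconvolved b (idx d (int p - int c)) c"
proof -
  define s where "s = idx d (int p - int c)"
  have s: "s < \<delta>" using near by (simp add: s_def)
  then have sN: "s < N" by simp
  have "pos d \<delta> p c = c * N + s" using s by (simp add: pos_def s_def)
  then show ?thesis
    using s sN index_less[OF c sN]
    by (simp add: inverse_lift_def Let_def block_index_div[OF sN] block_index_mod[OF sN] flip: s_def)
qed

lemma inverse_lift_pos_cnj:
  assumes p: "p < d" and c: "c < d" and near: "idx d (int p - int c) < \<delta>" and ne: "p \<noteq> c"
  shows "inverse_lift b $ pos d \<delta> c p = cnj (deconvolved b (idx d (int p - int c)) c)"
proof -
  define s where "s = idx d (int p - int c)"
  have sp: "(c + s) mod d = p"
    using idx_add_right[of d "int p - int c" "int c"] d_pos p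
    by (metis add.commute diff_add_cancel idx_nat idx_of_nat of_nat_add s_def)
  have s: "0 < s" "s < \<delta>" using near ne sp c by (auto simp: s_def intro!: gr0I)
  define e where "e = N - s"
  have e: "e < N" "\<not> e < \<delta>" "N - e = s" using s by (auto simp: e_def)
  have "idx d (int c - int p) = d - s"
    using idx_uminus[OF d_pos, of "int p - int c"] s by (simp add: s_def)
  then have "\<not> idx d (int c - int p) < \<delta>" using s \<delta>_double by simp
  define r where "r = idx d (int p - 1)"
  have r: "r < d" using idx_less d_pos by (simp add: r_def)
  have pos: "pos d \<delta> c p = r * N + e"
    using \<open>\<not> idx d (int c - int p) < \<delta>\<close> by (simp add: pos_def r_def s_def e_def)
  have "(r + d - (s - 1)) mod d = c"
  proof -
    have "int (r + d - (s - 1)) mod int d = (int r + int d - (int s - 1)) mod int d"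
    proof -
      have "int (r + d - (s - 1)) = int r + int d - (int s - 1)" using s \<delta>_less_d by linarith
      then show ?thesis by (simp only:)
    qed
    also have "\<dots> = (int r - (int s - 1)) mod int d"
    proof -
      have "int r + int d - (int s - 1) = (int r - (int s - 1)) + int d" by simp
      then show ?thesis by (simp only: mod_add_self2)
    qed
    also have "\<dots> = ((int p - 1) - (int s - 1)) mod int d"
      using d_pos by (simp add: r_def idx_def mod_diff_left_eq)
    also have "\<dots> = (int p - int s) mod int d" by simp
    also have "\<dots> = (int (c + s) - int s) mod int d"
      by (metis mod_diff_left_eq of_nat_mod sp)
    finally have "int ((r + d - (s - 1)) mod d) = int c" using c by (simp add: of_nat_mod)
    then show ?thesis by simp
  qed
  then have "deconvolved b s (r + d - (s - 1)) = deconvolved b s c" by (metis deconvolved_mod)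
  then show ?thesis
    unfolding pos s_def [symmetric] inverse_lift_def index_vec[OF index_less[OF r e(1)]] Let_def
      block_index_div[OF e(1)] block_index_mod[OF e(1)] if_not_P[OF e(2)] e(3) by simp
qed

lemma deconvolved_zero: "deconvolved (0\<^sub>v (meas_dim d \<delta>)) j r = 0"
proof -
  have "i * d + s mod d < meas_dim d \<delta>" if "i < N" for i s
    using block_index_less[OF that, of "s mod d" d] d_pos by (simp add: meas_dim_def mult.commute)
  then have "spectrum (0\<^sub>v (meas_dim d \<delta>)) j s = 0" for s
    by (simp add: spectrum_def dft_def)
  then show ?thesis by (simp add: deconvolved_def geom_sum_def)
qed

lemma deconvolved_add:
  assumes "b \<in> carrier_vec (meas_dim d \<delta>)" "n \<in> carrier_vec (meas_dim d \<delta>)"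
  shows "deconvolved (b + n) j r = deconvolved b j r + deconvolved n j r"
proof -
  have "i * d + s mod d < meas_dim d \<delta>" if "i < N" for i s
    using block_index_less[OF that, of "s mod d" d] d_pos by (simp add: meas_dim_def mult.commute)
  then have "spectrum (b + n) j s = spectrum b j s + spectrum n j s" for s
    using assms by (simp add: spectrum_def dft_def sum.distrib add_divide_distrib distrib_right)
  then show ?thesis
    by (simp add: deconvolved_def geom_sum_def add_divide_distrib [symmetric] sum.distrib [symmetric] algebra_simps)
qed

text \<open>
  A vector of the kernel solves the system with right hand side \<open>0\<close>, for which the formula gives \<open>0\<close>.
\<close>

lemma lifted_mat_invertible:
  "\<exists>B. inverts_mat (lifted_mat d \<delta> mask) B \<and> inverts_mat B (lifted_mat d \<delta> mask)"
proof -
  let ?A = "lifted_mat d \<delta> mask" and ?D = "meas_dim d \<delta>"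
  have A: "?A \<in> carrier_mat ?D ?D" by (rule lifted_mat_carrier)
  have "Determinant.det ?A \<noteq> 0"
  proof
    assume "Determinant.det ?A = 0"
    then obtain v where v: "v \<in> carrier_vec ?D" "v \<noteq> 0\<^sub>v ?D" "?A *\<^sub>v v = 0\<^sub>v ?D"
      using det_0_iff_vec_prod_zero[OF A] by auto
    have "perm_mat d \<delta> *\<^sub>v map_vec complex_of_real (0\<^sub>v ?D) = 0\<^sub>v ?D"
      using perm_mat_carrier by (intro eq_vecI) (auto simp: perm_mat_def scalar_prod_def)
    then have "v = inverse_lift (0\<^sub>v ?D)"
      using v by (intro lifted_system_solution) auto
    also have "\<dots> = 0\<^sub>v ?D"
      by (intro eq_vecI) (auto simp: inverse_lift_def Let_def deconvolved_zero)
    finally show False using v by simp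
  qed
  from det_non_zero_imp_unit[OF A this, of "()"] obtain B
    where "B \<in> carrier_mat ?D ?D" "?A * B = 1\<^sub>m ?D" "B * ?A = 1\<^sub>m ?D"
    unfolding Units_def ring_mat_def by auto
  then show ?thesis using A by (intro exI[of _ B]) (auto simp: inverts_mat_def)
qed

lemma inverse_eq_inverse_lift:
  assumes B: "inverts_mat (lifted_mat d \<delta> mask) B" "inverts_mat B (lifted_mat d \<delta> mask)"
    and b: "b \<in> carrier_vec (meas_dim d \<delta>)"
  shows "B *\<^sub>v (perm_mat d \<delta> *\<^sub>v map_vec complex_of_real b) = inverse_lift b"
proof -
  let ?A = "lifted_mat d \<delta> mask" and ?D = "meas_dim d \<delta>"
  let ?v = "perm_mat d \<delta> *\<^sub>v map_vec complex_of_real b"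
  have A: "?A \<in> carrier_mat ?D ?D" by (rule lifted_mat_carrier)
  have AB: "?A * B = 1\<^sub>m ?D" using B(1) A by (simp add: inverts_mat_def)
  have "dim_col B = ?D" using arg_cong[OF AB, of dim_col] by simp
  moreover have "dim_row B = ?D" using arg_cong[OF B(2)[unfolded inverts_mat_def], of dim_col] A by simp
  ultimately have Bc: "B \<in> carrier_mat ?D ?D" by auto
  have v: "?v \<in> carrier_vec ?D" using b perm_mat_carrier by auto
  have "?A *\<^sub>v (B *\<^sub>v ?v) = (?A * B) *\<^sub>v ?v" using A Bc v by (simp add: assoc_mult_mat_vec)
  also have "\<dots> = ?v" using AB v by simp
  finally show ?thesis using b Bc v by (intro lifted_system_solution) auto
qed

lemma inverse_lift_meas:
  assumes "x \<in> carrier_vec d"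
  shows "inverse_lift (meas d \<delta> mask x) = lifted_vec d \<delta> x"
  using lifted_system_solution[OF meas_carrier lifted_vec_carrier lifted_mat_lifted_vec[OF assms mask_zero]]
  by simp

text \<open>
  Cauchy-Schwarz over the \<open>N\<close> measurements of one block, all of which are entries of \<open>n\<close>.
\<close>

lemma norm_spectrum_le:
  assumes n: "n \<in> carrier_vec (meas_dim d \<delta>)"
  shows "cmod (spectrum n j r) \<le> l2norm n"
proof -
  let ?f = "\<lambda>i. n $ (i * d + r mod d)"
  have "cmod (dft N (\<lambda>i. complex_of_real (?f i)) j) \<le> (\<Sum>i<N. \<bar>?f i\<bar> * \<bar>1\<bar>)"
    unfolding dft_def by (rule order_trans[OF norm_sum]) (simp add: norm_mult)
  also have "\<dots> \<le> L2_set ?f {..<N} * L2_set (\<lambda>_. 1) {..<N}" by (rule L2_set_mult_ineq)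
  also have "L2_set (\<lambda>_. 1) {..<N} = sqrt (real N)" by (simp add: L2_set_def)
  finally have 1: "cmod (dft N (\<lambda>i. complex_of_real (?f i)) j) \<le> L2_set ?f {..<N} * sqrt (real N)" .
  have "L2_set ?f {..<N} \<le> l2norm n"
  proof -
    have inj: "inj_on (\<lambda>i. i * d + r mod d) {..<N}" using d_pos by (auto simp: inj_on_def)
    have lt: "i * d + r mod d < meas_dim d \<delta>" if "i < N" for i
      using block_index_less[OF that, of "r mod d" d] d_pos by (simp add: meas_dim_def mult.commute)
    have "(\<Sum>i<N. (?f i)\<^sup>2) = (\<Sum>k\<in>(\<lambda>i. i * d + r mod d) ` {..<N}. (n $ k)\<^sup>2)"
      using sum.reindex[OF inj, of "\<lambda>k. (n $ k)\<^sup>2"] by (simp add: o_def)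
    also have "\<dots> \<le> (\<Sum>k<meas_dim d \<delta>. (n $ k)\<^sup>2)"
      by (rule sum_mono2) (use lt in auto)
    finally show ?thesis using n by (simp add: l2norm_def L2_set_def)
  qed
  then have "L2_set ?f {..<N} * sqrt (real N) \<le> l2norm n * sqrt (real N)"
    by (intro mult_right_mono) auto
  with 1 have "cmod (dft N (\<lambda>i. complex_of_real (?f i)) j) \<le> l2norm n * sqrt (real N)" by linarith
  then show ?thesis using N_pos by (simp add: spectrum_def norm_divide divide_le_eq del: of_nat_mult of_nat_add)
qed

text \<open>
  With \<open>\<rho> = q ^ (\<delta> - j)\<close>, summing over the cycle gives \<open>(1 - \<rho> ^ d) / (1 - \<rho>)\<close> and the denominator of
  the solution formula cancels the numerator. So the bound is free of \<open>d\<close>, and \<open>1 - \<rho> \<ge> 1 - q\<close>.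
\<close>

lemma norm_deconvolved_le:
  assumes n: "n \<in> carrier_vec (meas_dim d \<delta>)" and j: "j < \<delta>"
  shows "cmod (deconvolved n j r) \<le> 2 * l2norm n / (decay (\<delta> + 1) * (1 - decay 2))"
proof -
  let ?b = "2 * l2norm n / decay (j + 2)"
  define \<rho> where "\<rho> = decay 2 ^ (\<delta> - j)"
  have q: "0 < decay 2" "decay 2 < 1" using decay_pos decay_less_1 by auto
  have \<rho>: "0 < \<rho>" "\<rho> \<le> decay 2" using q j power_decreasing[of 1 "\<delta> - j" "decay 2"] by (simp_all add: \<rho>_def)
  then have \<rho>1: "\<rho> < 1" using q by simp
  have \<rho>d: "\<rho> ^ d < 1" using \<rho> \<rho>1 d_pos by (simp add: power_less_one_iff)
  let ?g = "\<lambda>r. (spectrum n j r - complex_of_real (decay 2) * spectrum n j (Suc r)) / complex_of_real (decay (j + 2))"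
  have "cmod (?g s) \<le> ?b" for s
  proof -
    have "cmod (complex_of_real (decay 2) * spectrum n j (Suc s)) \<le> 1 * l2norm n"
      unfolding norm_mult using q norm_spectrum_le[OF n] by (intro mult_mono) auto
    then have "cmod (spectrum n j s - complex_of_real (decay 2) * spectrum n j (Suc s)) \<le> 2 * l2norm n"
      using norm_spectrum_le[OF n, of j s] by (intro order_trans[OF norm_triangle_ineq4]) linarith
    then show ?thesis using decay_pos[of "j + 2"] by (simp add: norm_divide divide_right_mono)
  qed
  then have "cmod (geom_sum (complex_of_real \<rho>) (\<delta> - j) ?g d r) \<le> ?b * (1 - \<rho> ^ d) / (1 - \<rho>)"
    using \<rho>(1) \<rho>1 by (rule norm_geom_sum_le)
  moreover have "deconvolved n j r = geom_sum (complex_of_real \<rho>) (\<delta> - j) ?g d r / complex_of_real (1 - \<rho> ^ d)"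
    by (simp add: deconvolved_def \<rho>_def power_mult)
  moreover have "\<bar>1 - \<rho> ^ d\<bar> = 1 - \<rho> ^ d" using \<rho>d by simp
  ultimately have "cmod (deconvolved n j r) \<le> ?b * (1 - \<rho> ^ d) / (1 - \<rho>) / (1 - \<rho> ^ d)"
    using \<rho>d by (simp only: norm_divide norm_of_real) (intro divide_right_mono, auto)
  also have "\<dots> = ?b / (1 - \<rho>)" using \<rho>d by simp
  also have "\<dots> = 2 * l2norm n / (decay (j + 2) * (1 - \<rho>))" by simp
  also have "\<dots> \<le> 2 * l2norm n / (decay (\<delta> + 1) * (1 - decay 2))"
  proof (intro divide_left_mono mult_mono)
    show "decay (\<delta> + 1) \<le> decay (j + 2)"
      using j by (simp add: decay_def divide_right_mono)
    show "0 < decay (j + 2) * (1 - \<rho>) * (decay (\<delta> + 1) * (1 - decay 2))"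
      using decay_pos q \<rho>1 by simp
  qed (use decay_pos[of "j+2"] \<rho> q l2norm_nonneg[of n] in auto)
  finally show ?thesis .
qed

text \<open>
  With \<open>a = max 4 ((\<delta> - 1) / 2)\<close>, the exponent \<open>(\<delta> + 1) / a\<close> is at most \<open>3\<close>, while \<open>1 - decay 2\<close> is of
  the order \<open>1 / a\<close>, since \<open>exp (- 2 / a) \<le> a / (a + 2)\<close>. The bound \<open>5 \<le> \<delta>\<close> is what flatness provides.
\<close>

lemma decay_bound:
  assumes "5 \<le> \<delta>"
  shows "2 / (decay (\<delta> + 1) * (1 - decay 2)) \<le> 2 * exp 3 * (real \<delta> - 1)"
proof -
  define a where "a = max 4 ((real \<delta> - 1) / 2)"
  have a: "4 \<le> a" "(real \<delta> - 1) / 2 \<le> a" "a \<le> real \<delta> - 1" using assms by (auto simp: a_def)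
  have "(real \<delta> + 1) \<le> 3 * a" using a assms by simp
  then have "- 3 \<le> - real (\<delta> + 1) / a" using a by (simp add: field_simps)
  then have 1: "exp (- 3) \<le> decay (\<delta> + 1)"
    unfolding decay_def a_def [symmetric] by (simp only: exp_le_cancel_iff)
  have "1 + 2 / a \<le> exp (2 / a)" by (rule exp_ge_add_one_self)
  moreover have "0 < 1 + 2 / a" using a by (simp add: add_pos_pos)
  ultimately have "exp (- (2 / a)) \<le> 1 / (1 + 2 / a)"
    unfolding exp_minus inverse_eq_divide [symmetric] by (rule le_imp_inverse_le)
  also have "\<dots> = a / (a + 2)" using a by (simp add: field_simps)
  finally have "decay 2 \<le> a / (a + 2)" by (simp add: decay_def flip: a_def)
  moreover have "1 - a / (a + 2) = 2 / (a + 2)" using a by (simp add: field_simps)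
  moreover have "1 / (real \<delta> - 1) \<le> 2 / (a + 2)" using a assms by (simp add: field_simps)
  ultimately have 2: "1 / (real \<delta> - 1) \<le> 1 - decay 2" by linarith
  have "exp (- 3) * (1 / (real \<delta> - 1)) \<le> decay (\<delta> + 1) * (1 - decay 2)"
    by (rule mult_mono[OF 1 2]) (use assms decay_pos[of "\<delta> + 1"] in auto)
  moreover have "0 < exp (- 3) * (1 / (real \<delta> - 1))" using assms by simp
  ultimately have "2 / (decay (\<delta> + 1) * (1 - decay 2)) \<le> 2 / (exp (- 3) * (1 / (real \<delta> - 1)))"
    by (intro frac_le) auto
  also have "\<dots> = 2 * exp 3 * (real \<delta> - 1)" by (simp add: exp_minus field_simps)
  finally show ?thesis .
qed

end


section \<open>Error propagation in the greedy synchronization\<close>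

text \<open>
  How an error moves along one edge: \<open>b\<close> is a reference entry with estimated phase \<open>u\<close>, and \<open>w\<close>, of
  phase \<open>g\<close>, approximates \<open>a * cnj b\<close>. Multiplying the error at \<open>a\<close> by \<open>b * cnj b\<close> exhibits it as the sum
  of the phase error of \<open>w\<close> and the error at \<open>b\<close>. The latter enters relative to \<open>cmod b\<close>, so
  that errors add up along a path of references and are not amplified.
\<close>

lemma phase_error_step:
  fixes a b c u g w :: complex
  assumes w: "w = complex_of_real (cmod w) * g" and g: "cmod g = 1"
    and E: "cmod (w - a * cnj b) \<le> E" and b: "b \<noteq> 0"
  shows "cmod (a - c * complex_of_real (cmod a) * (u * g))
    \<le> 2 * E / cmod b + cmod a * (cmod (b - c * complex_of_real (cmod b) * u) / cmod b)"
proof -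
  define v where "v = a * cnj b"
  have bb: "b * cnj b = complex_of_real (cmod b * cmod b)"
    using complex_norm_square[of b] by (simp add: power2_eq_square)
  have "complex_of_real (cmod b * cmod b) * (a - c * complex_of_real (cmod a) * (u * g))
      = (v - complex_of_real (cmod v) * g) * b
        + complex_of_real (cmod v) * g * (b - c * complex_of_real (cmod b) * u)"
    unfolding bb [symmetric] v_def norm_mult complex_mod_cnj of_real_mult
    using bb by (simp add: algebra_simps)
  then have "cmod b * cmod b * cmod (a - c * complex_of_real (cmod a) * (u * g))
      = cmod ((v - complex_of_real (cmod v) * g) * b
        + complex_of_real (cmod v) * g * (b - c * complex_of_real (cmod b) * u))"
    by (metis abs_norm_cancel norm_mult norm_of_real)
  also have "\<dots> \<le> cmod (v - complex_of_real (cmod v) * g) * cmod b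
      + cmod v * cmod (b - c * complex_of_real (cmod b) * u)"
    by (rule order_trans[OF norm_triangle_ineq]) (simp add: norm_mult g)
  also have "cmod (v - complex_of_real (cmod v) * g) \<le> 2 * E"
  proof -
    have eq: "v - complex_of_real (cmod v) * g = (v - w) + complex_of_real (cmod w - cmod v) * g"
      using w by (simp add: algebra_simps)
    have "cmod (v - complex_of_real (cmod v) * g) \<le> cmod (v - w) + \<bar>cmod w - cmod v\<bar>"
      unfolding eq using norm_triangle_ineq[of "v - w" "complex_of_real (cmod w - cmod v) * g"]
      by (simp only: norm_mult g norm_of_real mult_1_right)
    also have "\<bar>cmod w - cmod v\<bar> \<le> cmod (w - v)" by (rule norm_triangle_ineq3)
    finally show ?thesis using E by (simp add: v_def norm_minus_commute)
  qed
  finally have "cmod b * (cmod b * cmod (a - c * complex_of_real (cmod a) * (u * g)))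
      \<le> cmod b * (2 * E + cmod a * cmod (b - c * complex_of_real (cmod b) * u))"
    using b by (simp add: v_def norm_mult algebra_simps mult_right_mono)
  then have "cmod b * cmod (a - c * complex_of_real (cmod a) * (u * g))
      \<le> 2 * E + cmod a * cmod (b - c * complex_of_real (cmod b) * u)"
    using b by simp
  then show ?thesis using b by (simp add: field_simps)
qed

context local_correlation
begin

text \<open>
  The invariant of the loop: the finished indices form a cyclic interval \<open>{l..h}\<close>, counted from an
  offset \<open>a\<close>. The current index \<open>T\<close> lies in it and is close enough to its right end that the window
  \<open>{T + 1..T + \<delta> - 1}\<close> sticks out.
\<close>

definition reachable :: "nat set \<Rightarrow> nat \<Rightarrow> bool" where
  "reachable S j \<longleftrightarrow> (\<exists>a l h T :: int. l \<le> T \<and> T \<le> h \<and> h < T + int \<delta> - 1 \<and>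
     j = idx d (a + T) \<and> S = (\<lambda>t. idx d (a + t)) ` {l..h})"

lemma reachable_start:
  assumes "a < d" "2 \<le> \<delta>"
  shows "reachable {a} a"
  unfolding reachable_def
  by (rule exI[of _ "int a"], intro exI[of _ "0::int"]) (use assms in \<open>auto simp: idx_of_nat\<close>)

lemma reachable_subset: "reachable S j \<Longrightarrow> S \<subseteq> {..<d} \<and> j \<in> S"
  using idx_less[OF d_pos] by (auto simp: reachable_def)

lemma idx_nat_add: "(idx d k + i) mod d = idx d (k + int i)"
  using idx_add_right[OF d_pos, of k "int i"] idx_nat[of "idx d k + i"] by simp

text \<open>
  The index after the right end of the interval is in the window of the current index. If it is
  already finished, the interval has gone around the cycle.
\<close>

lemma reachable_stop:
  assumes "reachable S j" and stop: "\<forall>i. 0 < i \<and> i < \<delta> \<longrightarrow> (j + i) mod d \<in> S"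
  shows "S = {..<d}"
proof -
  from assms(1) obtain a l h T where lh: "l \<le> T" "T \<le> h" "h < T + int \<delta> - 1"
    and j: "j = idx d (a + T)" and S: "S = (\<lambda>t. idx d (a + t)) ` {l..h}"
    by (auto simp: reachable_def)
  define i where "i = nat (h + 1 - T)"
  have i: "0 < i" "i < \<delta>" "int i = h + 1 - T" using lh by (auto simp: i_def)
  have "(j + i) mod d = idx d (a + (h + 1))"
    unfolding j idx_nat_add i(3) by (simp add: algebra_simps)
  then have "idx d (a + (h + 1)) \<in> S" using stop i(1,2) by metis
  then obtain s where s: "s \<in> {l..h}" "idx d (a + (h + 1)) = idx d (a + s)"
    unfolding S by (elim imageE)
  have "(a + (h + 1)) mod int d = (a + s) mod int d"
    using s(2) d_pos by (simp add: idx_def eq_nat_nat_iff)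
  then have "int d dvd (a + (h + 1)) - (a + s)" by (simp only: mod_eq_dvd_iff)
  then have "int d \<le> h + 1 - s" using s(1) by (intro zdvd_imp_le) auto
  then have len: "l + int d - 1 \<le> h" using s(1) by auto
  have "p \<in> S" if "p < d" for p
  proof -
    define t where "t = l + (int p - a - l) mod int d"
    have "0 \<le> (int p - a - l) mod int d" "(int p - a - l) mod int d < int d" using d_pos by auto
    then have "t \<in> {l..h}" using len by (auto simp: t_def)
    moreover have "idx d (a + t) = p"
    proof -
      have "(a + t) mod int d = (a + l + (int p - a - l)) mod int d"
        unfolding t_def add.assoc [symmetric] by (rule mod_add_right_eq)
      then show ?thesis using that by (simp add: idx_def)
    qed
    ultimately show ?thesis unfolding S by force
  qed
  then show ?thesis using reachable_subset[OF assms(1)] by auto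
qed

lemma reachable_step:
  assumes "reachable S j" and i: "0 < i" "i < \<delta>"
  shows "reachable (S \<union> ({idx d (int j + k) | k. 1 - int \<delta> \<le> k \<and> k \<le> int \<delta> - 1} - S)) ((j + i) mod d)"
proof -
  from assms(1) obtain a l h T where lh: "l \<le> T" "T \<le> h" "h < T + int \<delta> - 1"
    and j: "j = idx d (a + T)" and S: "S = (\<lambda>t. idx d (a + t)) ` {l..h}"
    by (auto simp: reachable_def)
  have nb: "{idx d (int j + k) | k. 1 - int \<delta> \<le> k \<and> k \<le> int \<delta> - 1}
      = (\<lambda>t. idx d (a + t)) ` {T + 1 - int \<delta>..T + int \<delta> - 1}" (is "?N = ?I")
  proof
    show "?N \<subseteq> ?I"
    proof
      fix p assume "p \<in> ?N"
      then obtain k where k: "p = idx d (int j + k)" "1 - int \<delta> \<le> k" "k \<le> int \<delta> - 1" by auto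
      have "p = idx d (a + (T + k))"
        using idx_add_right[OF d_pos, of "a + T" k] by (simp add: k(1) j add.assoc)
      then show "p \<in> ?I" using k by (intro image_eqI[of _ _ "T + k"]) auto
    qed
    show "?I \<subseteq> ?N"
    proof
      fix p assume "p \<in> ?I"
      then obtain t where t: "p = idx d (a + t)" "t \<in> {T + 1 - int \<delta>..T + int \<delta> - 1}" by auto
      have "p = idx d (int j + (t - T))"
        using idx_add_right[OF d_pos, of "a + T" "t - T"] by (simp add: t(1) j)
      then show "p \<in> ?N" using t by auto
    qed
  qed
  have "{l..h} \<union> {T + 1 - int \<delta>..T + int \<delta> - 1} = {min l (T + 1 - int \<delta>)..T + int \<delta> - 1}"
    using lh by auto
  then have "S \<union> (?N - S) = (\<lambda>t. idx d (a + t)) ` {min l (T + 1 - int \<delta>)..T + int \<delta> - 1}"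
    unfolding Un_Diff_cancel nb S image_Un [symmetric] by simp
  moreover have "(j + i) mod d = idx d (a + (T + int i))"
    unfolding j idx_nat_add by (simp add: algebra_simps)
  moreover have "min l (T + 1 - int \<delta>) \<le> T + int i" "T + int i \<le> T + int \<delta> - 1"
    "T + int \<delta> - 1 < T + int i + int \<delta> - 1"
    using lh i by auto
  ultimately show ?thesis unfolding reachable_def by blast
qed

lemma near_neighbour:
  assumes j: "j < d" and k: "1 - int \<delta> \<le> k" "k \<le> int \<delta> - 1" and p: "p = idx d (int j + k)"
  shows "idx d (int p - int j) < \<delta> \<or> idx d (int j - int p) < \<delta>"
proof (cases "0 \<le> k")
  case True
  have "idx d (int p - int j) = idx d (int (nat k))"
    using True d_pos by (simp add: p idx_def mod_diff_left_eq)
  also have "\<dots> = nat k" using k \<delta>_less_d by (intro idx_of_nat) auto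
  finally show ?thesis using k True by auto
next
  case False
  have "idx d (int j - int p) = idx d (int (nat (- k)))"
    using False d_pos by (simp add: p idx_def mod_diff_right_eq)
  also have "\<dots> = nat (- k)" using k \<delta>_less_d False by (intro idx_of_nat) auto
  finally show ?thesis using k False by auto
qed

text \<open>
  The first summand of the bound is the error of the last edge, to an entry \<open>p\<close> that may be small. The
  second one is the phase error accumulated by the references before it; each iteration adds
  \<open>2 * E / \<beta>\<^sup>2\<close> to it and at least one index to \<open>S\<close>, which is why \<open>card S\<close> can count the iterations.
\<close>

lemma sync_loop_error:
  fixes x :: "complex vec"
  assumes approx: "\<And>p c. p < d \<Longrightarrow> c < d \<Longrightarrow> idx d (int p - int c) < \<delta> \<or> idx d (int c - int p) < \<delta> \<Longrightarrow>
      cmod (y $ pos d \<delta> p c - x $ p * cnj (x $ c)) \<le> E"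
    and large: "\<And>j i. j < d \<Longrightarrow> is_arg_max (\<lambda>i. cmod (y $ pos d \<delta> ((j + i) mod d) ((j + i) mod d)))
      (\<lambda>i. 0 < i \<and> i < \<delta>) i \<Longrightarrow> \<beta> \<le> cmod (x $ ((j + i) mod d))"
    and \<beta>: "0 < \<beta>" and E: "0 \<le> E"
    and loop: "sync_loop d \<delta> y \<phi> S j \<psi>"
    and "reachable S j" and "\<beta> \<le> cmod (x $ j)"
    and "\<And>p. p \<in> S \<Longrightarrow> cmod (x $ p - c * complex_of_real (cmod (x $ p)) * exp (\<i> * complex_of_real (\<phi> p)))
      \<le> 2 * E / \<beta> + cmod (x $ p) * (2 * E / \<beta>\<^sup>2) * (real (card S) - 1)"
  shows "\<forall>p<d. cmod (x $ p - c * complex_of_real (cmod (x $ p)) * exp (\<i> * complex_of_real (\<psi> p)))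
      \<le> 2 * E / \<beta> + cmod (x $ p) * (2 * E / \<beta>\<^sup>2) * (real d - 1)"
  using loop assms(6-8)
proof (induction rule: sync_loop.induct)
  case (stop j S \<phi>)
  have "S = {..<d}" using reachable_stop[OF stop.prems(1) stop.hyps] .
  then show ?case using stop.prems(3) by simp
next
  case (step j S N \<phi>' \<phi> i \<psi>)
  let ?e = "\<lambda>\<phi> p. x $ p - c * complex_of_real (cmod (x $ p)) * exp (\<i> * complex_of_real (\<phi> p))"
  have Sd: "S \<subseteq> {..<d}" and jS: "j \<in> S" using reachable_subset[OF step.prems(1)] by auto
  then have j: "j < d" and fin: "finite S" by (auto intro: finite_subset)
  have i: "0 < i" "i < \<delta>" using step.hyps(5) by (auto simp: is_arg_max_def)
  have Nd: "N \<subseteq> {..<d}" using step.hyps(2) idx_less[OF d_pos] by auto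
  obtain k where k: "0 < k" "k < \<delta>" "(j + k) mod d \<notin> S" using step.hyps(1) by auto
  have "(j + k) mod d = idx d (int j + int k)" using idx_nat[of "j + k"] by simp
  then have "(j + k) mod d \<in> N" using k step.hyps(2) by fastforce
  then have "card S < card (S \<union> N)"
    using k(3) fin finite_subset[OF Nd] by (intro psubset_card_mono) auto
  then have card: "real (card S) \<le> real (card (S \<union> N)) - 1" by simp
  have xj: "x $ j \<noteq> 0" using step.prems(2) \<beta> by auto
  have xj0: "0 < cmod (x $ j)" using xj by simp
  have ej: "cmod (?e \<phi> j) / cmod (x $ j) \<le> (2 * E / \<beta>\<^sup>2) * real (card S)"
  proof -
    have "cmod (?e \<phi> j) / cmod (x $ j)
        \<le> (2 * E / \<beta> + cmod (x $ j) * (2 * E / \<beta>\<^sup>2) * (real (card S) - 1)) / cmod (x $ j)"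
      by (intro divide_right_mono step.prems(3) jS) simp
    also have "\<dots> = 2 * E / \<beta> / cmod (x $ j) + (2 * E / \<beta>\<^sup>2) * (real (card S) - 1)"
      using xj by (simp add: add_divide_distrib)
    also have "2 * E / \<beta> / cmod (x $ j) \<le> 2 * E / \<beta> / \<beta>"
      using \<beta> E step.prems(2) by (intro divide_left_mono mult_pos_pos xj0) auto
    also have "2 * E / \<beta> / \<beta> = 2 * E / \<beta>\<^sup>2" by (simp add: power2_eq_square)
    also have "2 * E / \<beta>\<^sup>2 + (2 * E / \<beta>\<^sup>2) * (real (card S) - 1) = (2 * E / \<beta>\<^sup>2) * real (card S)"
      by (simp only: right_diff_distrib)
    finally show ?thesis by simp
  qed
  show ?case
  proof (rule step.IH)
    show "reachable (S \<union> N) ((j + i) mod d)"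
      unfolding step.hyps(2) using step.prems(1) i by (rule reachable_step)
    show "\<beta> \<le> cmod (x $ ((j + i) mod d))" using large[OF j step.hyps(5)] .
    fix p assume p: "p \<in> S \<union> N"
    have mono: "cmod (x $ p) * (2 * E / \<beta>\<^sup>2) * real (card S)
        \<le> cmod (x $ p) * (2 * E / \<beta>\<^sup>2) * (real (card (S \<union> N)) - 1)"
      using card E by (intro mult_left_mono) auto
    show "cmod (?e \<phi>' p) \<le> 2 * E / \<beta> + cmod (x $ p) * (2 * E / \<beta>\<^sup>2) * (real (card (S \<union> N)) - 1)"
    proof (cases "p \<in> N")
      case False
      then have "\<phi>' p = \<phi> p" and pS: "p \<in> S" using step.hyps(3) p by auto
      moreover have "cmod (x $ p) * (2 * E / \<beta>\<^sup>2) * (real (card S) - 1)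
          \<le> cmod (x $ p) * (2 * E / \<beta>\<^sup>2) * real (card S)"
        using E by (intro mult_left_mono) auto
      ultimately show ?thesis using step.prems(3)[OF pS] mono by simp
    next
      case True
      then obtain k where k: "p = idx d (int j + k)" "1 - int \<delta> \<le> k" "k \<le> int \<delta> - 1"
        using step.hyps(2) by auto
      obtain \<alpha> where \<alpha>: "is_Arg (y $ pos d \<delta> p j) \<alpha>" "\<phi>' p = \<phi> j + \<alpha>"
        using step.hyps(4) True by fastforce
      have pd: "p < d" using True Nd by auto
      have "cmod (y $ pos d \<delta> p j - x $ p * cnj (x $ j)) \<le> E"
        using approx[OF pd j near_neighbour[OF j k(2,3,1)]] .
      then have "cmod (x $ p - c * complex_of_real (cmod (x $ p))
          * (exp (\<i> * complex_of_real (\<phi> j)) * exp (\<i> * complex_of_real \<alpha>)))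
        \<le> 2 * E / cmod (x $ j) + cmod (x $ p) * (cmod (?e \<phi> j) / cmod (x $ j))"
        by (intro phase_error_step[where w = "y $ pos d \<delta> p j"])
          (use \<alpha>(1) xj in \<open>auto simp: is_Arg_def\<close>)
      also have "exp (\<i> * complex_of_real (\<phi> j)) * exp (\<i> * complex_of_real \<alpha>)
          = exp (\<i> * complex_of_real (\<phi>' p))"
        by (simp add: \<alpha>(2) exp_add [symmetric] distrib_left)
      also have "2 * E / cmod (x $ j) \<le> 2 * E / \<beta>"
        using \<beta> E step.prems(2) by (intro divide_left_mono mult_pos_pos xj0) auto
      also have "cmod (x $ p) * (cmod (?e \<phi> j) / cmod (x $ j))
          \<le> cmod (x $ p) * (2 * E / \<beta>\<^sup>2) * real (card S)"
        using mult_left_mono[OF ej, of "cmod (x $ p)"] by (simp add: mult.assoc)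
      also note mono
      finally show ?thesis by simp
    qed
  qed
qed

text \<open>
  A block that contains the middle index \<open>j + 1 + m\<close> of the window has at most \<open>m + 1\<close> elements and so
  stays within the \<open>2 * m + 1 \<le> \<delta> - 2\<close> indices after \<open>j\<close>.
\<close>

lemma flat_window:
  assumes flat: "flat ((\<delta> - 3) div 2) x" and x: "x \<in> carrier_vec d"
  shows "5 \<le> \<delta>"
    and "\<exists>i. 0 < i \<and> i < \<delta> \<and> l2norm x / (2 * sqrt (real d)) \<le> cmod (x $ ((j + i) mod d))"
proof -
  define m where "m = (\<delta> - 3) div 2"
  have m: "1 \<le> m" using flat by (simp add: flat_def m_def)
  then have m\<delta>: "2 * m + 3 \<le> \<delta>" by (simp add: m_def)
  with m show "5 \<le> \<delta>" by simp
  obtain \<B> where \<B>: "partition_on {..<d} \<B>"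
    and blocks: "\<And>B. B \<in> \<B> \<Longrightarrow> (\<exists>s. B = {s..<s + m} \<or> B = {s..<s + (m + 1)}) \<and>
      (\<exists>i\<in>B. l2norm x / (2 * sqrt (real d)) \<le> cmod (x $ i))"
    using flat x unfolding flat_def m_def [symmetric] by auto
  \<comment> \<open>the middle of the window \<open>{j + 1..j + 1 + 2 * m}\<close>\<close>
  define e where "e = (j + 1 + m) mod d"
  have "e < d" using d_pos by (simp add: e_def)
  then obtain B where B: "B \<in> \<B>" "e \<in> B" using \<B> by (auto simp: partition_on_def)
  then obtain s where s: "B = {s..<s + m} \<or> B = {s..<s + (m + 1)}" using blocks by blast
  obtain k where k: "k \<in> B" "l2norm x / (2 * sqrt (real d)) \<le> cmod (x $ k)" using blocks B by blast
  have kd: "k < d" using \<B> B k by (auto simp: partition_on_def)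
  have ke: "k \<le> e + m" "e \<le> k + m" using s k(1) B(2) by auto
  define i where "i = k + 1 + m - e"
  have "0 < i" "i < \<delta>" using ke m\<delta> by (auto simp: i_def)
  moreover have "(j + i) mod d = k"
  proof -
    have "j + 1 + m = d * ((j + 1 + m) div d) + e" by (simp add: e_def)
    then have "j + i = d * ((j + 1 + m) div d) + k" using ke by (simp add: i_def)
    then show ?thesis using kd by simp
  qed
  ultimately show "\<exists>i. 0 < i \<and> i < \<delta> \<and> l2norm x / (2 * sqrt (real d)) \<le> cmod (x $ ((j + i) mod d))"
    using k(2) by auto
qed

text \<open>
  The solution formula is additive in the data, and for noiseless data it returns the lifted vector.
  So the error is the formula applied to the noise.
\<close>

lemma inverse_lift_error:
  assumes x: "x \<in> carrier_vec d" and n: "n \<in> carrier_vec (meas_dim d \<delta>)" and \<delta>5: "5 \<le> \<delta>"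
    and p: "p < d" and c: "c < d"
    and near: "idx d (int p - int c) < \<delta> \<or> idx d (int c - int p) < \<delta>"
  shows "cmod (inverse_lift (meas d \<delta> mask x + n) $ pos d \<delta> p c - x $ p * cnj (x $ c))
    \<le> 2 * exp 3 * (real \<delta> - 1) * l2norm n"
proof -
  have bound: "cmod (deconvolved n j r) \<le> 2 * exp 3 * (real \<delta> - 1) * l2norm n" if "j < \<delta>" for j r
  proof -
    have "cmod (deconvolved n j r) \<le> 2 / (decay (\<delta> + 1) * (1 - decay 2)) * l2norm n"
      using norm_deconvolved_le[OF n that] by simp
    also have "\<dots> \<le> 2 * exp 3 * (real \<delta> - 1) * l2norm n"
      by (rule mult_right_mono[OF decay_bound[OF \<delta>5] l2norm_nonneg])
    finally show ?thesis .
  qed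
  have lift: "x $ p * cnj (x $ c) = inverse_lift (meas d \<delta> mask x) $ pos d \<delta> p c"
    using lifted_vec_pos[OF \<delta>_pos \<delta>_less p c near] inverse_lift_meas[OF x] by simp
  note add = deconvolved_add[OF meas_carrier n]
  show ?thesis
  proof (cases "idx d (int p - int c) < \<delta>")
    case True
    then show ?thesis unfolding lift by (simp add: inverse_lift_pos[OF p c True] add bound)
  next
    case False
    then have near': "idx d (int c - int p) < \<delta>" and ne: "c \<noteq> p" using near \<delta>_pos by (auto simp: idx_def)
    show ?thesis unfolding lift
      by (simp add: inverse_lift_pos_cnj[OF c p near' ne] add bound[OF near'] flip: complex_cnj_diff)
  qed
qed

text \<open>
  The hypothesis \<open>16 * d\<^sup>2 * E \<le> (l2norm x)\<^sup>2\<close> is used twice. It makes the chosen references as large as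
  \<open>\<beta>\<close>: they maximize the disturbed diagonal, so they reach \<open>(l2norm x)\<^sup>2 / (4 * d) - 2 * E\<close>. And it
  bounds the phase errors, which are quadratic in \<open>E\<close>, by a multiple of
  \<open>d\<^sup>2 * E\<close>. The factor \<open>c\<close> is the phase of
  the entry where the algorithm starts.
\<close>

lemma recovery_error:
  fixes x :: "complex vec"
  assumes x: "x \<in> carrier_vec d" and flat: "flat ((\<delta> - 3) div 2) x"
    and approx: "\<And>p c. p < d \<Longrightarrow> c < d \<Longrightarrow> idx d (int p - int c) < \<delta> \<or> idx d (int c - int p) < \<delta> \<Longrightarrow>
      cmod (y $ pos d \<delta> p c - x $ p * cnj (x $ c)) \<le> E"
    and E: "0 \<le> E" "16 * (real d)\<^sup>2 * E \<le> (l2norm x)\<^sup>2"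
    and sync: "greedy_sync d \<delta> y \<phi>"
  shows "\<exists>c. cmod c = 1 \<and> (\<Sum>p<d. (cmod (x $ p - c * (complex_of_real (sqrt (cmod (y $ pos d \<delta> p p)))
      * exp (\<i> * complex_of_real (\<phi> p)))))\<^sup>2) \<le> 60 * (real d)\<^sup>2 * E"
proof -
  define X where "X = (l2norm x)\<^sup>2"
  have X: "X = (\<Sum>p<d. (cmod (x $ p))\<^sup>2)" using x by (simp add: X_def l2norm_squared)
  have d1: "1 \<le> real d" using d_pos by simp
  have diag: "\<bar>(cmod (x $ p))\<^sup>2 - cmod (y $ pos d \<delta> p p)\<bar> \<le> E" if "p < d" for p
  proof -
    have "cmod (x $ p * cnj (x $ p)) = (cmod (x $ p))\<^sup>2" by (simp add: norm_mult power2_eq_square)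
    then have "\<bar>(cmod (x $ p))\<^sup>2 - cmod (y $ pos d \<delta> p p)\<bar> \<le> cmod (y $ pos d \<delta> p p - x $ p * cnj (x $ p))"
      by (metis norm_minus_commute norm_triangle_ineq3)
    also have "\<dots> \<le> E" using \<delta>_pos by (intro approx that) (simp add: idx_def)
    finally show ?thesis .
  qed
  let ?z = "\<lambda>p. complex_of_real (sqrt (cmod (y $ pos d \<delta> p p))) * exp (\<i> * complex_of_real (\<phi> p))"
  \<comment> \<open>if \<open>x = 0\<close> there is no reference entry, but then \<open>E = 0\<close> as well and the output vanishes\<close>
  show ?thesis
  proof (cases "X = 0")
    case True
    then have "E = 0" using E d1 X_def by (simp add: mult_le_0_iff)
    moreover have x0: "x $ p = 0" if "p < d" for p
      using True that unfolding X by (subst (asm) sum_nonneg_eq_0_iff) auto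
    ultimately have "?z p = 0" if "p < d" for p using diag[OF that] that by simp
    then show ?thesis using x0 \<open>E = 0\<close> by (intro exI[of _ 1]) simp
  next
    case False
    then have Xpos: "0 < X" by (simp add: X_def)
    define \<beta> where "\<beta> = sqrt (X / (8 * real d))"
    have \<beta>: "0 < \<beta>" "\<beta>\<^sup>2 = X / (8 * real d)" using Xpos d_pos by (simp_all add: \<beta>_def)
    have dE: "16 * real d * E \<le> X / real d"
      using E(2) d_pos by (simp add: X_def field_simps power2_eq_square)
    have E16: "16 * E \<le> X / real d"
      using dE E d1 mult_right_mono[of 1 "real d" E] by linarith
    \<comment> \<open>passing from \<open>x\<close> to \<open>y\<close> and back costs \<open>E\<close> each time\<close>
    have chosen: "\<beta> \<le> cmod (x $ k)" if k: "k < d" and i: "i < d"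
      and xi: "l2norm x / (2 * sqrt (real d)) \<le> cmod (x $ i)"
      and le: "cmod (y $ pos d \<delta> i i) \<le> cmod (y $ pos d \<delta> k k)" for k i
    proof -
      have "X / (4 * real d) = (l2norm x / (2 * sqrt (real d)))\<^sup>2"
        by (simp add: X_def power_divide power_mult_distrib)
      also have "\<dots> \<le> (cmod (x $ i))\<^sup>2" using xi by (intro power_mono) (auto simp: l2norm_nonneg)
      finally have "X / (4 * real d) \<le> (cmod (x $ k))\<^sup>2 + 2 * E"
        using le diag[OF k] diag[OF i] by linarith
      moreover have "X / (4 * real d) = X / (8 * real d) + X / real d / 8" using d_pos by (simp add: field_simps)
      ultimately have "\<beta>\<^sup>2 \<le> (cmod (x $ k))\<^sup>2" unfolding \<beta>(2) using E16 by linarith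
      then show ?thesis by (rule power2_le_imp_le) simp
    qed
    obtain a \<phi>\<^sub>0 where a: "is_arg_max (\<lambda>j. cmod (y $ pos d \<delta> j j)) (\<lambda>j. j < d) a"
      and \<phi>0: "\<phi>\<^sub>0 a = 0" and loop: "sync_loop d \<delta> y \<phi>\<^sub>0 {a} a \<phi>"
      using sync by (auto simp: greedy_sync_def)
    have ad: "a < d" using a by (simp add: is_arg_max_def)
    have xa: "\<beta> \<le> cmod (x $ a)"
    proof -
      obtain i where i: "l2norm x / (2 * sqrt (real d)) \<le> cmod (x $ ((0 + i) mod d))"
        using flat_window(2)[OF flat x] by blast
      have id: "(0 + i) mod d < d" using d_pos by simp
      have "\<forall>k<d. cmod (y $ pos d \<delta> k k) \<le> cmod (y $ pos d \<delta> a a)"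
        using a unfolding is_arg_max_def by (meson not_less)
      then show ?thesis using id by (intro chosen[OF ad id i]) blast
    qed
    define c where "c = sgn (x $ a)"
    have c: "cmod c = 1" using xa \<beta>(1) by (auto simp: c_def norm_sgn)
    have main: "\<forall>p<d. cmod (x $ p - c * complex_of_real (cmod (x $ p)) * exp (\<i> * complex_of_real (\<phi> p)))
      \<le> 2 * E / \<beta> + cmod (x $ p) * (2 * E / \<beta>\<^sup>2) * (real d - 1)"
    proof (rule sync_loop_error[OF approx _ \<beta>(1) E(1) loop _ xa])
      fix j i assume j: "j < d"
        and i: "is_arg_max (\<lambda>i. cmod (y $ pos d \<delta> ((j + i) mod d) ((j + i) mod d))) (\<lambda>i. 0 < i \<and> i < \<delta>) i"
      obtain i' where i': "0 < i'" "i' < \<delta>" "l2norm x / (2 * sqrt (real d)) \<le> cmod (x $ ((j + i') mod d))"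
        using flat_window(2)[OF flat x] by blast
      show "\<beta> \<le> cmod (x $ ((j + i) mod d))"
      proof (rule chosen[OF _ _ i'(3)])
        show "cmod (y $ pos d \<delta> ((j + i') mod d) ((j + i') mod d))
            \<le> cmod (y $ pos d \<delta> ((j + i) mod d) ((j + i) mod d))"
          using i i'(1,2) unfolding is_arg_max_def by (meson not_less)
      qed (use d_pos in auto)
    next
      show "reachable {a} a" using flat_window(1)[OF flat x] ad by (intro reachable_start) auto
    next
      fix p assume "p \<in> {a}"
      then have "p = a" by simp
      moreover have "x $ a = c * complex_of_real (cmod (x $ a))"
        by (simp add: c_def sgn_eq)
      ultimately show "cmod (x $ p - c * complex_of_real (cmod (x $ p)) * exp (\<i> * complex_of_real (\<phi>\<^sub>0 p)))
        \<le> 2 * E / \<beta> + cmod (x $ p) * (2 * E / \<beta>\<^sup>2) * (real (card {a}) - 1)"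
        using \<phi>0 E \<beta> by simp
    qed auto
    have each: "(cmod (x $ p - c * ?z p))\<^sup>2
        \<le> 3 * (4 * E\<^sup>2 / \<beta>\<^sup>2 + (cmod (x $ p))\<^sup>2 * (4 * E\<^sup>2 * (real d)\<^sup>2 / (\<beta>\<^sup>2)\<^sup>2) + E)" if p: "p < d" for p
    proof -
      define u where "u = 2 * E / \<beta>"
      define v where "v = cmod (x $ p) * (2 * E / \<beta>\<^sup>2) * real d"
      define w where "w = \<bar>cmod (x $ p) - sqrt (cmod (y $ pos d \<delta> p p))\<bar>"
      have "x $ p - c * ?z p = (x $ p - c * complex_of_real (cmod (x $ p)) * exp (\<i> * complex_of_real (\<phi> p)))
          + c * complex_of_real (cmod (x $ p) - sqrt (cmod (y $ pos d \<delta> p p))) * exp (\<i> * complex_of_real (\<phi> p))"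
        by (simp add: algebra_simps)
      then have "cmod (x $ p - c * ?z p)
          \<le> cmod (x $ p - c * complex_of_real (cmod (x $ p)) * exp (\<i> * complex_of_real (\<phi> p))) + w"
        using norm_triangle_ineq[of "x $ p - c * complex_of_real (cmod (x $ p)) * exp (\<i> * complex_of_real (\<phi> p))"
          "c * complex_of_real (cmod (x $ p) - sqrt (cmod (y $ pos d \<delta> p p))) * exp (\<i> * complex_of_real (\<phi> p))"]
        by (simp only: norm_mult c norm_of_real norm_exp_i_times mult_1_left mult_1_right w_def)
      also have "cmod (x $ p - c * complex_of_real (cmod (x $ p)) * exp (\<i> * complex_of_real (\<phi> p)))
          \<le> u + cmod (x $ p) * (2 * E / \<beta>\<^sup>2) * (real d - 1)"
        using main p by (simp add: u_def)
      also have "cmod (x $ p) * (2 * E / \<beta>\<^sup>2) * (real d - 1) \<le> v"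
        unfolding v_def using E by (intro mult_left_mono) auto
      finally have "(cmod (x $ p - c * ?z p))\<^sup>2 \<le> (u + v + w)\<^sup>2" by (intro power_mono) auto
      also have "\<dots> \<le> 3 * (u\<^sup>2 + v\<^sup>2 + w\<^sup>2)"
        using sum_squares_bound[of u v] sum_squares_bound[of v w] sum_squares_bound[of u w]
        by (simp add: power2_eq_square algebra_simps)
      also have "u\<^sup>2 = 4 * E\<^sup>2 / \<beta>\<^sup>2" by (simp add: u_def power_divide power_mult_distrib)
      also have "v\<^sup>2 = (cmod (x $ p))\<^sup>2 * (4 * E\<^sup>2 * (real d)\<^sup>2 / (\<beta>\<^sup>2)\<^sup>2)"
        by (simp add: v_def power_divide power_mult_distrib)
      also have "w\<^sup>2 \<le> E"
        using sqrt_diff_squared_le[of "cmod (x $ p)" "cmod (y $ pos d \<delta> p p)"] diag[OF p] by (simp add: w_def)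
      finally show ?thesis by simp
    qed
    have "(\<Sum>p<d. (cmod (x $ p - c * ?z p))\<^sup>2)
        \<le> (\<Sum>p<d. 3 * (4 * E\<^sup>2 / \<beta>\<^sup>2 + (cmod (x $ p))\<^sup>2 * (4 * E\<^sup>2 * (real d)\<^sup>2 / (\<beta>\<^sup>2)\<^sup>2) + E))"
      by (intro sum_mono each) simp
    also have "\<dots> = 3 * (real d * (4 * E\<^sup>2 / \<beta>\<^sup>2) + X * (4 * E\<^sup>2 * (real d)\<^sup>2 / (\<beta>\<^sup>2)\<^sup>2) + real d * E)"
    proof -
      have "(\<Sum>p<d. 3 * (A + (cmod (x $ p))\<^sup>2 * B + E)) = 3 * (real d * A + X * B + real d * E)" for A B
        by (simp add: X sum.distrib flip: sum_distrib_left sum_distrib_right)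
      then show ?thesis .
    qed
    also have "real d * (4 * E\<^sup>2 / \<beta>\<^sup>2) = 2 * E * (16 * (real d)\<^sup>2 * E / X)"
      unfolding \<beta>(2) using d_pos Xpos by (simp add: field_simps power2_eq_square)
    also have "X * (4 * E\<^sup>2 * (real d)\<^sup>2 / (\<beta>\<^sup>2)\<^sup>2) = 16 * (real d)\<^sup>2 * E * (16 * (real d)\<^sup>2 * E / X)"
      unfolding \<beta>(2) using d_pos Xpos by (simp add: field_simps power2_eq_square)
    finally have "(\<Sum>p<d. (cmod (x $ p - c * ?z p))\<^sup>2)
        \<le> 3 * (2 * E * (16 * (real d)\<^sup>2 * E / X) + 16 * (real d)\<^sup>2 * E * (16 * (real d)\<^sup>2 * E / X) + real d * E)" .
    also have "\<dots> \<le> 3 * (2 * E * 1 + 16 * (real d)\<^sup>2 * E * 1 + real d * E)"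
      using E Xpos by (intro mult_left_mono add_mono) (auto simp: X_def divide_le_eq)
    also have "\<dots> \<le> 60 * (real d)\<^sup>2 * E"
    proof -
      have "real d \<le> (real d)\<^sup>2" "1 \<le> (real d)\<^sup>2" using d1 mult_mono[of 1 "real d" 1 "real d"]
        by (simp_all add: power2_eq_square)
      from this [THEN mult_right_mono, OF E(1)]
      have le: "real d * E \<le> (real d)\<^sup>2 * E" "E \<le> (real d)\<^sup>2 * E" by simp_all
      have "3 * (2 * E * 1 + 16 * q * 1 + p) \<le> 60 * q" if "p \<le> q" "E \<le> q" for p q
        using that E(1) by simp
      from this[OF le] show ?thesis by (simp only: mult.assoc)
    qed
    finally show ?thesis using c by blast
  qed
qed

lemma l2norm_phase_distance:
  assumes "x \<in> carrier_vec d" "z \<in> carrier_vec d"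
  shows "(l2norm (x - a \<cdot>\<^sub>v z))\<^sup>2 = (\<Sum>p<d. (cmod (x $ p - a * z $ p))\<^sup>2)"
  using assms by (simp add: l2norm_squared)

text \<open>
  A continuous function attains its minimum over all phases, which is at most its value at \<open>c\<close>.
\<close>

lemma best_phase_exists:
  fixes x z :: "complex vec"
  assumes x: "x \<in> carrier_vec d" and z: "z \<in> carrier_vec d" and c: "cmod c = 1"
    and B: "(\<Sum>p<d. (cmod (x $ p - c * z $ p))\<^sup>2) \<le> B"
  shows "\<exists>\<theta>. is_arg_min (\<lambda>\<theta>. (l2norm (x - exp (\<i> * complex_of_real \<theta>) \<cdot>\<^sub>v z))\<^sup>2) (\<lambda>\<theta>. \<theta> \<in> {0..2 * pi}) \<theta> \<and>
    (l2norm (x - exp (\<i> * complex_of_real \<theta>) \<cdot>\<^sub>v z))\<^sup>2 \<le> B"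
proof -
  let ?f = "\<lambda>\<theta>. (l2norm (x - exp (\<i> * complex_of_real \<theta>) \<cdot>\<^sub>v z))\<^sup>2"
  have f: "?f = (\<lambda>\<theta>. \<Sum>p<d. (cmod (x $ p - exp (\<i> * complex_of_real \<theta>) * z $ p))\<^sup>2)"
    using l2norm_phase_distance[OF x z] by auto
  have "continuous_on {0..2 * pi} ?f" unfolding f by (intro continuous_intros)
  then obtain \<theta> where \<theta>: "\<theta> \<in> {0..2 * pi}" "\<And>t. t \<in> {0..2 * pi} \<Longrightarrow> ?f \<theta> \<le> ?f t"
    using continuous_attains_inf[of "{0..2 * pi}" ?f] by auto
  have "exp (\<i> * complex_of_real (Arg2pi c)) = c" using Arg2pi_eq[of c] c by simp
  then have "?f (Arg2pi c) \<le> B" using l2norm_phase_distance[OF x z, of c] B by simp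
  moreover have "Arg2pi c \<in> {0..2 * pi}" using Arg2pi_ge_0[of c] Arg2pi_lt_2pi[of c] by simp
  ultimately have "?f \<theta> \<le> B" using \<theta>(2) by fastforce
  moreover have "is_arg_min ?f (\<lambda>\<theta>. \<theta> \<in> {0..2 * pi}) \<theta>"
    unfolding is_arg_min_def using \<theta> by (auto simp: not_less)
  ultimately show ?thesis by blast
qed

lemma block_pr_recovery:
  assumes x: "x \<in> carrier_vec d" and n: "n \<in> carrier_vec (meas_dim d \<delta>)"
    and flat: "flat ((\<delta> - 3) div 2) x"
    and noise: "32 * exp 3 * (real \<delta> - 1) * (real d)\<^sup>2 * l2norm n \<le> (l2norm x)\<^sup>2"
    and z: "block_pr d \<delta> mask (meas d \<delta> mask x + n) z"
  shows "z \<in> carrier_vec d \<and>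
    (\<exists>\<theta>. is_arg_min (\<lambda>\<theta>. (l2norm (x - exp (\<i> * complex_of_real \<theta>) \<cdot>\<^sub>v z))\<^sup>2) (\<lambda>\<theta>. \<theta> \<in> {0..2 * pi}) \<theta> \<and>
      (l2norm (x - exp (\<i> * complex_of_real \<theta>) \<cdot>\<^sub>v z))\<^sup>2 \<le> 120 * exp 3 * (real d)\<^sup>2 * (real \<delta> - 1) * l2norm n)"
proof -
  let ?b = "meas d \<delta> mask x + n"
  let ?E = "2 * exp 3 * (real \<delta> - 1) * l2norm n"
  have b: "?b \<in> carrier_vec (meas_dim d \<delta>)" using meas_carrier n by simp
  obtain B y \<phi> where B: "inverts_mat (lifted_mat d \<delta> mask) B" "inverts_mat B (lifted_mat d \<delta> mask)"
    and y: "y = B *\<^sub>v (perm_mat d \<delta> *\<^sub>v map_vec complex_of_real ?b)"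
    and sync: "greedy_sync d \<delta> y \<phi>"
    and z: "z = vec d (\<lambda>j. complex_of_real (sqrt (cmod (y $ pos d \<delta> j j))) * exp (\<i> * complex_of_real (\<phi> j)))"
    using z by (auto simp: block_pr_def)
  have y': "y = inverse_lift ?b" unfolding y by (rule inverse_eq_inverse_lift[OF B b])
  note \<delta>5 = flat_window(1)[OF flat x]
  have E0: "0 \<le> ?E" using \<delta>5 l2norm_nonneg[of n] by simp
  have "16 * (real d)\<^sup>2 * ?E \<le> (l2norm x)\<^sup>2" using noise by (simp add: mult_ac)
  from recovery_error[OF x flat inverse_lift_error[OF x n \<delta>5] E0 this sync[unfolded y']]
  obtain c where c: "cmod c = 1" "(\<Sum>p<d. (cmod (x $ p - c * z $ p))\<^sup>2) \<le> 60 * (real d)\<^sup>2 * ?E"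
    by (auto simp: z y')
  have zc: "z \<in> carrier_vec d" by (simp add: z)
  have "60 * (real d)\<^sup>2 * ?E = 120 * exp 3 * (real d)\<^sup>2 * (real \<delta> - 1) * l2norm n" by simp
  then show ?thesis using best_phase_exists[OF x zc c] zc by (simp only: simp_thms)
qed

end


section \<open>Computation trees\<close>

text \<open>
  One operation of a program, seen from outside: \<open>V\<close> is the set of functions of the input that are
  held in registers, and the operation computes one further function.
\<close>

inductive one_step :: "('i \<Rightarrow> complex) set \<Rightarrow> ('i \<Rightarrow> complex) \<Rightarrow> bool" for V where
  one_step_const: "one_step V (\<lambda>_. of_nat n)"
| one_step_pi: "one_step V (\<lambda>_. complex_of_real pi)"
| one_step_i: "one_step V (\<lambda>_. \<i>)"
| one_step_add: "f \<in> V \<Longrightarrow> g \<in> V \<Longrightarrow> one_step V (\<lambda>x. f x + g x)"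
| one_step_diff: "f \<in> V \<Longrightarrow> g \<in> V \<Longrightarrow> one_step V (\<lambda>x. f x - g x)"
| one_step_mult: "f \<in> V \<Longrightarrow> g \<in> V \<Longrightarrow> one_step V (\<lambda>x. f x * g x)"
| one_step_divide: "f \<in> V \<Longrightarrow> g \<in> V \<Longrightarrow> one_step V (\<lambda>x. f x / g x)"
| one_step_cnj: "f \<in> V \<Longrightarrow> one_step V (\<lambda>x. cnj (f x))"
| one_step_modulus: "f \<in> V \<Longrightarrow> one_step V (\<lambda>x. complex_of_real (cmod (f x)))"
| one_step_sqrt: "f \<in> V \<Longrightarrow> one_step V (\<lambda>x. csqrt (f x))"
| one_step_exp: "f \<in> V \<Longrightarrow> one_step V (\<lambda>x. exp (f x))"
| one_step_Arg: "f \<in> V \<Longrightarrow> one_step V (\<lambda>x. complex_of_real (Arg (f x)))"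

text \<open>
  \<open>solves X V c P\<close>: on inputs from \<open>X\<close>, when the functions in \<open>V\<close> have been computed, an output related
  to the input by \<open>P\<close> can be reached with at most \<open>c\<close> further operations. A branch splits \<open>X\<close>, so that
  the outcome of a comparison is known in the rest of the computation.
\<close>

inductive solves ::
  "'i set \<Rightarrow> ('i \<Rightarrow> complex) set \<Rightarrow> nat \<Rightarrow> ('i \<Rightarrow> complex list \<Rightarrow> bool) \<Rightarrow> bool" where
  solves_return: "set fs \<subseteq> V \<Longrightarrow> \<forall>x\<in>X. P x (map (\<lambda>f. f x) fs) \<Longrightarrow> solves X V c P"
| solves_assign: "one_step V f \<Longrightarrow> solves X (insert f V) c P \<Longrightarrow> solves X V (Suc c) P"
| solves_branch: "f \<in> V \<Longrightarrow> g \<in> V \<Longrightarrow> solves {x \<in> X. Re (f x) \<le> Re (g x)} V c P \<Longrightarrow>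
    solves {x \<in> X. \<not> Re (f x) \<le> Re (g x)} V c P \<Longrightarrow> solves X V (Suc c) P"

lemma one_step_mono: "one_step V f \<Longrightarrow> V \<subseteq> V' \<Longrightarrow> one_step V' f"
  by (induction rule: one_step.induct) (auto intro: one_step.intros)

lemma one_step_op_val:
  assumes "one_step V f" and regs: "\<forall>f\<in>V. \<exists>r<k. \<forall>x\<in>X. R x r = f x"
  shows "\<exists>e. \<forall>x\<in>X. op_val e (R x) = f x"
  using assms(1)
proof cases
  case (one_step_const n)
  then show ?thesis by (intro exI[of _ "Const n"]) simp
next
  case one_step_pi
  then show ?thesis by (intro exI[of _ ConstPi]) simp
next
  case one_step_i
  then show ?thesis by (intro exI[of _ ConstI]) simp
next
  case (one_step_add f g)
  then obtain r s where "\<forall>x\<in>X. R x r = f x" "\<forall>x\<in>X. R x s = g x" using regs by blast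
  then show ?thesis using one_step_add by (intro exI[of _ "Add r s"]) simp
next
  case (one_step_diff f g)
  then obtain r s where "\<forall>x\<in>X. R x r = f x" "\<forall>x\<in>X. R x s = g x" using regs by blast
  then show ?thesis using one_step_diff by (intro exI[of _ "Sub r s"]) simp
next
  case (one_step_mult f g)
  then obtain r s where "\<forall>x\<in>X. R x r = f x" "\<forall>x\<in>X. R x s = g x" using regs by blast
  then show ?thesis using one_step_mult by (intro exI[of _ "Mul r s"]) simp
next
  case (one_step_divide f g)
  then obtain r s where "\<forall>x\<in>X. R x r = f x" "\<forall>x\<in>X. R x s = g x" using regs by blast
  then show ?thesis using one_step_divide by (intro exI[of _ "Div r s"]) simp
next
  case (one_step_cnj f)
  then obtain r where "\<forall>x\<in>X. R x r = f x" using regs by blast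
  then show ?thesis using one_step_cnj by (intro exI[of _ "Conj r"]) simp
next
  case (one_step_modulus f)
  then obtain r where "\<forall>x\<in>X. R x r = f x" using regs by blast
  then show ?thesis using one_step_modulus by (intro exI[of _ "Modulus r"]) simp
next
  case (one_step_sqrt f)
  then obtain r where "\<forall>x\<in>X. R x r = f x" using regs by blast
  then show ?thesis using one_step_sqrt by (intro exI[of _ "Sqrt r"]) simp
next
  case (one_step_exp f)
  then obtain r where "\<forall>x\<in>X. R x r = f x" using regs by blast
  then show ?thesis using one_step_exp by (intro exI[of _ "Exp r"]) simp
next
  case (one_step_Arg f)
  then obtain r where "\<forall>x\<in>X. R x r = f x" using regs by blast
  then show ?thesis using one_step_Arg by (intro exI[of _ "Angle r"]) simp
qed

text \<open>
  Every function gets a register of its own: those below \<open>k\<close> are in use, and an assignment writes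
  to \<open>k\<close>, so nothing is ever overwritten.
\<close>

lemma solves_prog:
  assumes "solves X V c P" and "\<forall>f\<in>V. \<exists>r<k. \<forall>x\<in>X. R x r = f x"
  shows "\<exists>t. \<forall>x\<in>X. P x (prog_out t (R x)) \<and> prog_cost t (R x) \<le> c"
  using assms
proof (induction arbitrary: k R rule: solves.induct)
  case (solves_return fs V X P c)
  have "\<forall>f\<in>V. \<exists>r. \<forall>x\<in>X. R x r = f x" using solves_return.prems by blast
  then obtain reg where "\<forall>f\<in>V. \<forall>x\<in>X. R x (reg f) = f x" by metis
  then have eq: "map (R x) (map reg fs) = map (\<lambda>f. f x) fs" if "x \<in> X" for x
    using solves_return.hyps(1) that by (auto simp: subset_iff)
  have "\<forall>x\<in>X. P x (prog_out (Return (map reg fs)) (R x)) \<and> prog_cost (Return (map reg fs)) (R x) \<le> c"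
  proof
    fix x assume x: "x \<in> X"
    show "P x (prog_out (Return (map reg fs)) (R x)) \<and> prog_cost (Return (map reg fs)) (R x) \<le> c"
      unfolding prog_out.simps prog_cost.simps eq[OF x] using solves_return.hyps(2) x by simp
  qed
  then show ?case by blast
next
  case (solves_assign V f X c P)
  obtain e where e: "\<forall>x\<in>X. op_val e (R x) = f x"
    using one_step_op_val[OF solves_assign.hyps(1) solves_assign.prems] by blast
  define R' where "R' = (\<lambda>x. (R x)(k := f x))"
  have "\<forall>g\<in>insert f V. \<exists>r<Suc k. \<forall>x\<in>X. R' x r = g x"
  proof
    fix g assume "g \<in> insert f V"
    then consider "g = f" | "g \<in> V" by blast
    then show "\<exists>r<Suc k. \<forall>x\<in>X. R' x r = g x"
    proof cases
      case 1
      then show ?thesis by (intro exI[of _ k]) (simp add: R'_def)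
    next
      case 2
      then obtain r where "r < k" "\<forall>x\<in>X. R x r = g x" using solves_assign.prems by blast
      then show ?thesis by (intro exI[of _ r]) (simp add: R'_def)
    qed
  qed
  from solves_assign.IH[OF this] obtain t
    where "\<forall>x\<in>X. P x (prog_out t (R' x)) \<and> prog_cost t (R' x) \<le> c" by blast
  then show ?case using e by (intro exI[of _ "Assign k e t"]) (simp add: R'_def)
next
  case (solves_branch f V g X c P)
  obtain r s where rs: "\<forall>x\<in>X. R x r = f x" "\<forall>x\<in>X. R x s = g x"
    using solves_branch.hyps(1,2) solves_branch.prems by meson
  have "\<forall>h\<in>V. \<exists>r<k. \<forall>x\<in>{x \<in> X. Q x}. R x r = h x" for Q using solves_branch.prems by blast
  from solves_branch.IH(1)[OF this] solves_branch.IH(2)[OF this] obtain t u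
    where "\<forall>x\<in>{x \<in> X. Re (f x) \<le> Re (g x)}. P x (prog_out t (R x)) \<and> prog_cost t (R x) \<le> c"
      and "\<forall>x\<in>{x \<in> X. \<not> Re (f x) \<le> Re (g x)}. P x (prog_out u (R x)) \<and> prog_cost u (R x) \<le> c"
    by blast
  then show ?case using rs by (intro exI[of _ "Branch r s t u"]) simp
qed

lemma solves_mono:
  assumes "solves X V c P"
  shows "X' \<subseteq> X \<Longrightarrow> V \<subseteq> V' \<Longrightarrow> c \<le> c' \<Longrightarrow> (\<And>x out. x \<in> X' \<Longrightarrow> P x out \<Longrightarrow> P' x out) \<Longrightarrow> solves X' V' c' P'"
  using assms
proof (induction arbitrary: X' V' c' rule: solves.induct[consumes 1, case_names solves_return solves_assign solves_branch])
  case (solves_return fs V X P c)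
  show ?case
    by (rule solves.solves_return[of fs]) (use solves_return in blast)+
next
  case (solves_assign V f X c P)
  then obtain c'' where c'': "c' = Suc c''" "c \<le> c''" by (cases c') auto
  have "solves X' (insert f V') c'' P'"
    using solves_assign.prems c''(2) by (intro solves_assign.IH) auto
  then show ?case unfolding c''(1) using one_step_mono[OF solves_assign.hyps(1) solves_assign.prems(2)]
    by (rule solves.solves_assign[rotated])
next
  case (solves_branch f V g X c P)
  then obtain c'' where c'': "c' = Suc c''" "c \<le> c''" by (cases c') auto
  show ?case unfolding c''(1)
  proof (rule solves.solves_branch)
    show "f \<in> V'" "g \<in> V'" using solves_branch.hyps(1,2) solves_branch.prems(2) by auto
    show "solves {x \<in> X'. Re (f x) \<le> Re (g x)} V' c'' P'"
      using solves_branch.prems c''(2) by (intro solves_branch.IH(1)) auto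
    show "solves {x \<in> X'. \<not> Re (f x) \<le> Re (g x)} V' c'' P'"
      using solves_branch.prems c''(2) by (intro solves_branch.IH(2)) auto
  qed
qed

lemma solves_cost_mono: "solves X V c P \<Longrightarrow> c \<le> c' \<Longrightarrow> solves X V c' P"
  using solves_mono[of X V c P X V c' P] by simp

text \<open>
  Comparing the winner among \<open>I\<close> with one further candidate extends the maximum; since the winner is
  known in each leaf of the tree, the computation can continue in a way that depends on it.
\<close>

lemma solves_arg_max:
  assumes "finite I" "I \<noteq> {}" and h: "\<And>i. i \<in> I \<Longrightarrow> h i \<in> V"
    and "\<And>i. i \<in> I \<Longrightarrow> solves {x \<in> X. \<forall>k\<in>I. Re (h k x) \<le> Re (h i x)} V c P"
  shows "solves X V (card I + c) P"
  using assms
proof (induction I arbitrary: c rule: finite_ne_induct)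
  case (singleton i)
  have "solves {x \<in> X. \<forall>k\<in>{i}. Re (h k x) \<le> Re (h i x)} V c P" by (rule singleton.prems) simp
  then show ?case by (rule solves_mono) auto
next
  case (insert k I)
  have "solves X V (card I + Suc c) P"
  proof (rule insert.IH)
    fix i assume i: "i \<in> I"
    show "solves {x \<in> X. \<forall>k\<in>I. Re (h k x) \<le> Re (h i x)} V (Suc c) P"
    proof (rule solves_branch)
      show "h k \<in> V" "h i \<in> V" using insert.prems(1) i by auto
      show "solves {x \<in> {x \<in> X. \<forall>k\<in>I. Re (h k x) \<le> Re (h i x)}. Re (h k x) \<le> Re (h i x)} V c P"
        using i by (intro solves_mono[OF insert.prems(2)[of i]]) auto
      show "solves {x \<in> {x \<in> X. \<forall>k\<in>I. Re (h k x) \<le> Re (h i x)}. \<not> Re (h k x) \<le> Re (h i x)} V c P"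
        using i by (intro solves_mono[OF insert.prems(2)[of k]]) (auto intro: order_trans)
    qed
  qed (use insert.prems in auto)
  then show ?case using insert.hyps by simp
qed

text \<open>
  \<open>derives V c W\<close>: from \<open>V\<close> one can compute \<open>W\<close> with \<open>c\<close> operations and without branching. It is defined by
  what it contributes to an arbitrary continuation, which makes composition trivial. The larger
  \<open>V'\<close> makes it monotone in \<open>V\<close>.
\<close>

definition derives :: "('i \<Rightarrow> complex) set \<Rightarrow> nat \<Rightarrow> ('i \<Rightarrow> complex) set \<Rightarrow> bool" where
  "derives V c W \<longleftrightarrow> (\<forall>X V' c' P. V \<subseteq> V' \<longrightarrow> solves X (V' \<union> W) c' P \<longrightarrow> solves X V' (c + c') P)"

lemma solves_derives:
  assumes "derives V c W" "solves X (V \<union> W) c' P"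
  shows "solves X V (c + c') P"
  using assms by (auto simp: derives_def)

lemma derives_mono:
  assumes "derives V c W" "V \<subseteq> V'" "c \<le> c'" "W' \<subseteq> V' \<union> W"
  shows "derives V' c' W'"
  unfolding derives_def
proof (intro allI impI)
  fix X U e P assume "V' \<subseteq> U" "solves X (U \<union> W') e P"
  then have "solves X (U \<union> W) e P" using assms(4) by (intro solves_mono[OF \<open>solves X (U \<union> W') e P\<close>]) auto
  then have "solves X U (c + e) P" using assms(1,2) \<open>V' \<subseteq> U\<close> by (auto simp: derives_def)
  from solves_mono[OF this, of X U "c' + e" P] show "solves X U (c' + e) P" using assms(3) by auto
qed

lemma derives_trans:
  assumes "derives V c W" "derives (V \<union> W) c' W'"
  shows "derives V (c + c') (W \<union> W')"
  unfolding derives_def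
proof (intro allI impI)
  fix X U e P assume U: "V \<subseteq> U" "solves X (U \<union> (W \<union> W')) e P"
  then have "solves X (U \<union> W) (c' + e) P"
    using assms(2)[unfolded derives_def, rule_format, of "U \<union> W" X e P] by (auto simp: Un_assoc)
  then show "solves X U (c + c' + e) P" using assms(1) U(1) by (auto simp: derives_def add.assoc)
qed

lemma derives_chain:
  assumes "derives V c W" "derives (V \<union> W) c' W'" "c + c' \<le> c''"
  shows "derives V c'' W'"
  by (rule derives_mono[OF derives_trans[OF assms(1,2)]]) (use assms(3) in auto)

lemma derives_subset: "W \<subseteq> V \<Longrightarrow> derives V c W"
  unfolding derives_def by (auto simp: Un_absorb2 intro: solves_mono)

lemma derives_UN:
  assumes "finite I" "\<And>i. i \<in> I \<Longrightarrow> derives V c (W i)"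
  shows "derives V (card I * c) (\<Union>i\<in>I. W i)"
  using assms
proof (induction I rule: finite_induct)
  case empty
  show ?case by (rule derives_subset) simp
next
  case (insert i I)
  have "derives V (card I * c) (\<Union>i\<in>I. W i)" using insert by auto
  then have "derives (V \<union> W i) (card I * c) (\<Union>i\<in>I. W i)" by (rule derives_mono) auto
  then have "derives V (c + card I * c) (W i \<union> (\<Union>i\<in>I. W i))"
    using insert.prems by (intro derives_trans[of V c "W i"]) auto
  then show ?case using insert.hyps by simp
qed

lemma derives_family:
  assumes "finite I" "\<And>i. i \<in> I \<Longrightarrow> derives V c {f i}" "card I * c \<le> c'" "F \<subseteq> f ` I"
  shows "derives V c' F"
  by (rule derives_mono[OF derives_UN[OF assms(1), of V c "\<lambda>i. {f i}"]]) (use assms(2-4) in auto)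

lemma derives_one_step: "one_step V f \<Longrightarrow> derives V 1 {f}"
  unfolding derives_def
  by (auto intro!: solves_assign intro: one_step_mono)

lemma derives_avail: "f \<in> V \<Longrightarrow> derives V 0 {f}"
  by (rule derives_subset) simp

text \<open>
  The costs in this lemma and the next are sums that mirror the shape of the expression, so that a
  cost is found by applying one rule per operator.
\<close>

lemma derives_unary:
  assumes "derives V a {f}" "\<And>V. f \<in> V \<Longrightarrow> one_step V h"
  shows "derives V (a + 1) {h}"
  by (rule derives_chain[OF assms(1) derives_one_step[OF assms(2)]]) auto

lemma derives_binary:
  assumes f: "derives V a {f}" and g: "derives V b {g}" and h: "\<And>V. f \<in> V \<Longrightarrow> g \<in> V \<Longrightarrow> one_step V h"
  shows "derives V (a + b + 1) {h}"
proof -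
  have "derives (V \<union> {f}) b {g}" using g by (rule derives_mono) auto
  with f have "derives V (a + b) ({f} \<union> {g})" by (rule derives_trans)
  then show ?thesis by (rule derives_chain[OF _ derives_one_step[OF h]]) auto
qed

lemmas derives_const = derives_one_step[OF one_step_const]
  and derives_pi = derives_one_step[OF one_step_pi]
  and derives_i = derives_one_step[OF one_step_i]

lemma derives_add: "derives V a {f} \<Longrightarrow> derives V b {g} \<Longrightarrow> derives V (a + b + 1) {\<lambda>x. f x + g x}"
  by (rule derives_binary) (auto intro: one_step_add)

lemma derives_diff: "derives V a {f} \<Longrightarrow> derives V b {g} \<Longrightarrow> derives V (a + b + 1) {\<lambda>x. f x - g x}"
  by (rule derives_binary) (auto intro: one_step_diff)

lemma derives_mult: "derives V a {f} \<Longrightarrow> derives V b {g} \<Longrightarrow> derives V (a + b + 1) {\<lambda>x. f x * g x}"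
  by (rule derives_binary) (auto intro: one_step_mult)

lemma derives_divide: "derives V a {f} \<Longrightarrow> derives V b {g} \<Longrightarrow> derives V (a + b + 1) {\<lambda>x. f x / g x}"
  by (rule derives_binary) (auto intro: one_step_divide)

lemma derives_cnj: "derives V a {f} \<Longrightarrow> derives V (a + 1) {\<lambda>x. cnj (f x)}"
  by (rule derives_unary) (auto intro: one_step_cnj)

lemma derives_modulus: "derives V a {f} \<Longrightarrow> derives V (a + 1) {\<lambda>x. complex_of_real (cmod (f x))}"
  by (rule derives_unary) (auto intro: one_step_modulus)

lemma derives_sqrt: "derives V a {f} \<Longrightarrow> derives V (a + 1) {\<lambda>x. csqrt (f x)}"
  by (rule derives_unary) (auto intro: one_step_sqrt)

lemma derives_exp: "derives V a {f} \<Longrightarrow> derives V (a + 1) {\<lambda>x. exp (f x)}"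
  by (rule derives_unary) (auto intro: one_step_exp)

lemma derives_Arg: "derives V a {f} \<Longrightarrow> derives V (a + 1) {\<lambda>x. complex_of_real (Arg (f x))}"
  by (rule derives_unary) (auto intro: one_step_Arg)

lemma derives_le: "derives V c W \<Longrightarrow> c \<le> c' \<Longrightarrow> derives V c' W"
  by (rule derives_mono) auto


section \<open>Fast Fourier transforms\<close>

text \<open>
  Roots of unity are computed afresh at each occurrence. This costs a constant factor and saves all
  bookkeeping of tables.
\<close>

lemma derives_unity_root: "derives V 10 {\<lambda>_. unity_root n k}"
proof -
  have "derives V (((((((1 + 1) + 1) + 1) + 1) + 1 + 1) + 1 + 1) + 1)
      {\<lambda>_. exp (of_nat 2 * complex_of_real pi * \<i> * of_nat k / of_nat n)}"
    by (intro derives_exp derives_divide derives_mult derives_const derives_pi derives_i)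
  then show ?thesis unfolding unity_root_def by (rule derives_mono) auto
qed

lemma dft_even_odd:
  "dft (2 * n) g s = dft n (\<lambda>t. g (2 * t)) s + unity_root (2 * n) s * dft n (\<lambda>t. g (2 * t + 1)) s"
proof -
  have "(\<Sum>t<2 * n. h t) = (\<Sum>t<n. h (2 * t) + h (2 * t + 1))" for h :: "nat \<Rightarrow> complex"
    by (induction n) simp_all
  then have "dft (2 * n) g s = (\<Sum>t<n. g (2 * t) * unity_root (2 * n) (2 * t * s)
      + g (2 * t + 1) * unity_root (2 * n) ((2 * t + 1) * s))"
    unfolding dft_def .
  moreover have "unity_root (2 * n) (2 * t * s) = unity_root n (t * s)" for t
    using unity_root_double[of n "t * s"] by (simp add: mult.assoc)
  moreover have "unity_root (2 * n) ((2 * t + 1) * s) = unity_root (2 * n) s * unity_root n (t * s)" for t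
    using unity_root_add[of "2 * n" s "2 * (t * s)"] unity_root_double[of n "t * s"]
    by (simp add: algebra_simps)
  ultimately show ?thesis
    by (simp add: dft_def sum.distrib sum_distrib_left mult_ac)
qed

text \<open>
  Layer \<open>k\<close> consists of the transforms of length \<open>2 ^ k\<close> of the subsequences of \<open>f\<close> with stride
  \<open>2 ^ (K - k)\<close>. A subsequence splits into two of the layer below by the parity of \<open>t\<close>, and as a
  transform of length \<open>2 ^ k\<close> is periodic, each layer has \<open>2 ^ K\<close> distinct values. A value of the next
  layer needs \<open>12\<close> operations: a root of unity, a product and a sum.
\<close>

lemma derives_fft_layers:
  assumes f: "\<And>t. t < 2 ^ K \<Longrightarrow> f t \<in> V" and "k \<le> K"
  shows "derives V (k * (12 * 2 ^ K))
    (\<Union>m\<in>{..<2 ^ (K - k)}. range (\<lambda>s x. dft (2 ^ k) (\<lambda>t. f (m + t * 2 ^ (K - k)) x) s))"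
  using \<open>k \<le> K\<close>
proof (induction k)
  case 0
  show ?case by (rule derives_subset) (auto simp: dft_def f)
next
  case (Suc k)
  let ?L = "\<lambda>k. \<Union>m\<in>{..<2 ^ (K - k)}. range (\<lambda>s x. dft (2 ^ k) (\<lambda>t. f (m + t * 2 ^ (K - k)) x) s)"
  define M :: nat where "M = 2 ^ (K - Suc k)"
  have M: "2 ^ (K - k) = 2 * M" using Suc.prems by (simp add: M_def Suc_diff_Suc flip: power_Suc)
  have IH: "derives V (k * (12 * 2 ^ K)) (?L k)" using Suc by simp
  have "derives (V \<union> ?L k) (12 * 2 ^ K) (?L (Suc k))"
  proof (rule derives_family[where I = "{..<M} \<times> {..<2 ^ Suc k}" and c = 12
        and f = "\<lambda>(m, s) x. dft (2 ^ Suc k) (\<lambda>t. f (m + t * M) x) s"])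
    fix i assume "i \<in> {..<M} \<times> {..<2 ^ Suc k :: nat}"
    then obtain m s where i: "i = (m, s)" and m: "m < M" by auto
    have e: "(\<lambda>x. dft (2 ^ k) (\<lambda>t. f (m + t * 2 ^ (K - k)) x) s) \<in> V \<union> ?L k"
      by (intro UnI2 UN_I[of m] rangeI) (use m M in auto)
    have o: "(\<lambda>x. dft (2 ^ k) (\<lambda>t. f (m + M + t * 2 ^ (K - k)) x) s) \<in> V \<union> ?L k"
      by (intro UnI2 UN_I[of "m + M"] rangeI) (use m M in auto)
    have eq: "(\<lambda>x. dft (2 ^ Suc k) (\<lambda>t. f (m + t * M) x) s)
        = (\<lambda>x. dft (2 ^ k) (\<lambda>t. f (m + t * 2 ^ (K - k)) x) s
          + unity_root (2 * 2 ^ k) s * dft (2 ^ k) (\<lambda>t. f (m + M + t * 2 ^ (K - k)) x) s)"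
    proof
      fix x
      have "m + 2 * t * M = m + t * 2 ^ (K - k)" for t by (simp add: M)
      moreover have "m + (2 * t + 1) * M = m + M + t * 2 ^ (K - k)" for t by (simp add: M algebra_simps)
      ultimately show "dft (2 ^ Suc k) (\<lambda>t. f (m + t * M) x) s
        = dft (2 ^ k) (\<lambda>t. f (m + t * 2 ^ (K - k)) x) s
          + unity_root (2 * 2 ^ k) s * dft (2 ^ k) (\<lambda>t. f (m + M + t * 2 ^ (K - k)) x) s"
        by (simp only: power_Suc dft_even_odd)
    qed
    have "derives (V \<union> ?L k) (0 + (10 + 0 + 1) + 1) {\<lambda>x. dft (2 ^ k) (\<lambda>t. f (m + t * 2 ^ (K - k)) x) s
          + unity_root (2 * 2 ^ k) s * dft (2 ^ k) (\<lambda>t. f (m + M + t * 2 ^ (K - k)) x) s}"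
      by (intro derives_add derives_mult derives_unity_root derives_avail e o)
    then show "derives (V \<union> ?L k) 12 {case i of (m, s) \<Rightarrow> \<lambda>x. dft (2 ^ Suc k) (\<lambda>t. f (m + t * M) x) s}"
      unfolding i prod.case eq by (rule derives_le) simp
  next
    have "M * 2 ^ Suc k = 2 ^ K" unfolding M_def power_add [symmetric] using Suc.prems by simp
    then show "card ({..<M} \<times> {..<2 ^ Suc k :: nat}) * 12 \<le> 12 * 2 ^ K" by (simp add: card_cartesian_product)
    show "?L (Suc k) \<subseteq> (\<lambda>(m, s) x. dft (2 ^ Suc k) (\<lambda>t. f (m + t * M) x) s) ` ({..<M} \<times> {..<2 ^ Suc k})"
    proof
      fix h assume "h \<in> ?L (Suc k)"
      then obtain m s where m: "m < M" and h: "h = (\<lambda>x. dft (2 ^ Suc k) (\<lambda>t. f (m + t * M) x) s)"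
        by (auto simp: M_def)
      have "h = (\<lambda>(m, s) x. dft (2 ^ Suc k) (\<lambda>t. f (m + t * M) x) s) (m, s mod 2 ^ Suc k)"
        by (simp only: h dft_mod prod.case)
      moreover have "(m, s mod 2 ^ Suc k) \<in> {..<M} \<times> {..<2 ^ Suc k}" using m by simp
      ultimately show "h \<in> (\<lambda>(m, s) x. dft (2 ^ Suc k) (\<lambda>t. f (m + t * M) x) s) ` ({..<M} \<times> {..<2 ^ Suc k})"
        by (rule image_eqI)
    qed
  qed simp
  with IH show ?case by (rule derives_chain) simp
qed

lemma derives_fft:
  assumes "\<And>t. t < 2 ^ K \<Longrightarrow> f t \<in> V"
  shows "derives V (K * (12 * 2 ^ K)) (range (\<lambda>s x. dft (2 ^ K) (\<lambda>t. f t x) s))"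
proof (rule derives_mono[OF derives_fft_layers[of K f V K, OF assms]])
  show "range (\<lambda>s x. dft (2 ^ K) (\<lambda>t. f t x) s)
    \<subseteq> V \<union> (\<Union>m\<in>{..<2 ^ (K - K)}. range (\<lambda>s x. dft (2 ^ K) (\<lambda>t. f (m + t * 2 ^ (K - K)) x) s))"
    by (rule le_supI2, rule order_trans[OF _ UN_upper[of 0]]) simp_all
qed auto

text \<open>
  The correlation theorem. \<open>dft n h (n - r)\<close> is the transform of \<open>h\<close> with conjugated roots, which
  a further transform inverts.
\<close>

lemma dft_correlation:
  assumes "0 < n"
  shows "dft n (\<lambda>r. dft n h (n - r) * dft n u r) s = of_nat n * (\<Sum>t<n. u t * h ((t + s) mod n))"
proof -
  have h: "dft n h (n - r) = (\<Sum>m<n. h m * cnj (unity_root n (m * r)))" if "r < n" for r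
  proof -
    have "unity_root n (m * (n - r)) = cnj (unity_root n (m * r))" for m
    proof (rule cnj_unity_root [symmetric])
      have "m * r + m * (n - r) = m * n" using that by (simp add: algebra_simps)
      then show "n dvd m * r + m * (n - r)" by simp
    qed
    then show ?thesis by (simp add: dft_def)
  qed
  have "dft n (\<lambda>r. dft n h (n - r) * dft n u r) s
      = (\<Sum>r<n. \<Sum>t<n. u t * ((\<Sum>m<n. h m * cnj (unity_root n (m * r))) * unity_root n (r * (t + s))))"
  proof -
    have "H * dft n u r * unity_root n (r * s) = (\<Sum>t<n. u t * (H * unity_root n (r * (t + s))))" for H r
      by (simp add: dft_def sum_distrib_left sum_distrib_right distrib_left unity_root_add mult_ac)
    then show ?thesis unfolding dft_def[of n _ s] by (intro sum.cong refl) (simp add: h)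
  qed
  also have "\<dots> = (\<Sum>t<n. u t * dft n (\<lambda>r. \<Sum>m<n. h m * cnj (unity_root n (m * r))) ((t + s) mod n))"
    unfolding dft_mod by (subst sum.swap) (simp add: dft_def sum_distrib_left)
  also have "\<dots> = (\<Sum>t<n. u t * (of_nat n * h ((t + s) mod n)))"
    using assms by (simp add: dft_cnj_dft)
  finally show ?thesis by (simp add: sum_distrib_left mult_ac)
qed

lemma choose_two_add: "(j + k) choose 2 = (j choose 2) + (k choose 2) + j * k"
  by (induction k) (simp_all add: numeral_2_eq_2)

text \<open>
  Since \<open>t * s = (t + s choose 2) - (t choose 2) - (s choose 2)\<close>, a transform of any length \<open>n\<close> is,
  up to factors of modulus \<open>1\<close>, a correlation with the chirp \<open>m \<mapsto> unity_root n (m choose 2)\<close>. Padding \<open>u\<close>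
  with zeros up to \<open>Q \<ge> 2 * n\<close> keeps the cyclic correlation from wrapping around. Binomial
  coefficients instead of the squares in \<open>2 * t * s = (t + s)\<^sup>2 - t\<^sup>2 - s\<^sup>2\<close> avoid a root of order
  \<open>2 * n\<close>.
\<close>

lemma dft_chirp:
  fixes v :: "nat \<Rightarrow> complex"
  assumes s: "s < n" and Q: "2 * n \<le> Q"
  defines "u \<equiv> \<lambda>t. if t < n then v t * cnj (unity_root n (t choose 2)) else 0"
  shows "dft n v s = cnj (unity_root n (s choose 2))
    * (dft Q (\<lambda>r. dft Q (\<lambda>m. unity_root n (m choose 2)) (Q - r) * dft Q u r) s / of_nat Q)"
proof -
  let ?c = "\<lambda>m. unity_root n (m choose 2)"
  have c: "cnj (?c s) * (cnj (?c t) * ?c (t + s)) = unity_root n (t * s)" for t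
  proof -
    have "?c (t + s) = ?c t * ?c s * unity_root n (t * s)"
      by (simp add: choose_two_add unity_root_add)
    then have "cnj (?c s) * (cnj (?c t) * ?c (t + s)) = (?c s * cnj (?c s)) * (?c t * cnj (?c t)) * unity_root n (t * s)"
      by (simp only: mult_ac)
    then show ?thesis by simp
  qed
  have "dft Q (\<lambda>r. dft Q ?c (Q - r) * dft Q u r) s / of_nat Q = (\<Sum>t<Q. u t * ?c ((t + s) mod Q))"
    using dft_correlation[of Q ?c u s] s Q by simp
  also have "\<dots> = (\<Sum>t<n. u t * ?c ((t + s) mod Q))"
    by (rule sum.mono_neutral_right) (use Q in \<open>auto simp: u_def\<close>)
  also have "\<dots> = (\<Sum>t<n. v t * (cnj (?c t) * ?c (t + s)))"
    by (intro sum.cong refl) (use s Q in \<open>simp add: u_def\<close>)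
  finally have "cnj (?c s) * (dft Q (\<lambda>r. dft Q ?c (Q - r) * dft Q u r) s / of_nat Q)
      = (\<Sum>t<n. v t * (cnj (?c s) * (cnj (?c t) * ?c (t + s))))"
    by (simp add: sum_distrib_left mult_ac)
  then show ?thesis by (simp only: c dft_def[of n v s])
qed

text \<open>
  Three transforms of length \<open>2 ^ K\<close> (of the chirp, of the modulated input and of their product) and
  \<open>10 + 12 + 1 + 14\<close> operations per index around them.
\<close>

lemma derives_dft:
  assumes v: "\<And>j. j < n \<Longrightarrow> v j \<in> V" and K: "2 * n \<le> 2 ^ K"
  shows "derives V ((36 * K + 38) * 2 ^ K) ((\<lambda>s x. dft n (\<lambda>j. v j x) s) ` {..<n})"
proof -
  define Q :: nat where "Q = 2 ^ K"
  have Q: "2 * n \<le> Q" "0 < Q" using K by (simp_all add: Q_def)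
  define c where "c = (\<lambda>m (x :: 'a). unity_root n (m choose 2))"
  define u where "u = (\<lambda>t x. if t < n then v t x * cnj (unity_root n (t choose 2)) else 0)"
  define F where "F = (\<lambda>f s (x :: 'a). dft Q (\<lambda>t. f t x) s)"
  define g where "g = (\<lambda>r x. F c (Q - r) x * F u r x)"
  have fft: "derives W (K * (12 * Q)) (range (F f))" if "\<And>t. t < Q \<Longrightarrow> f t \<in> W" for f W
    using derives_fft[of K f W] that by (simp add: F_def Q_def)
  have "derives V (10 * Q) (c ` {..<Q})"
    by (rule derives_family[where I = "{..<Q}" and f = c and c = 10])
      (auto simp: c_def intro: derives_unity_root)
  then have 1: "derives V (10 * Q + K * (12 * Q)) (range (F c))"
    by (rule derives_chain[OF _ fft]) auto
  have "derives V (12 * Q) (u ` {..<Q})"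
  proof (rule derives_family[where I = "{..<Q}" and f = u and c = 12])
    fix t assume "t \<in> {..<Q}"
    show "derives V 12 {u t}"
    proof (cases "t < n")
      case True
      have "derives V (0 + (10 + 1) + 1) {\<lambda>x. v t x * cnj (unity_root n (t choose 2))}"
        using True by (intro derives_mult derives_cnj derives_unity_root derives_avail v)
      then show ?thesis using True by (simp add: u_def)
    next
      case False
      have "derives V 1 {\<lambda>_. of_nat 0}" by (rule derives_const)
      then have "derives V 12 {\<lambda>_. of_nat 0}" by (rule derives_le) simp
      then show ?thesis using False by (simp add: u_def)
    qed
  qed auto
  then have 2: "derives V (12 * Q + K * (12 * Q)) (range (F u))"
    by (rule derives_chain[OF _ fft]) auto
  have 3: "derives V (10 * Q + K * (12 * Q) + (12 * Q + K * (12 * Q))) (range (F c) \<union> range (F u))"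
    by (rule derives_trans[OF 1 derives_mono[OF 2]]) auto
  have "derives (V \<union> (range (F c) \<union> range (F u))) Q (g ` {..<Q})"
  proof (rule derives_family[where I = "{..<Q}" and f = g and c = 1])
    fix r
    have "derives (V \<union> (range (F c) \<union> range (F u))) (0 + 0 + 1) {\<lambda>x. F c (Q - r) x * F u r x}"
      by (intro derives_mult derives_avail) auto
    then show "derives (V \<union> (range (F c) \<union> range (F u))) 1 {g r}" by (simp add: g_def)
  qed auto
  then have "derives (V \<union> (range (F c) \<union> range (F u))) (Q + K * (12 * Q)) (range (F g))"
    by (rule derives_chain[OF _ fft]) auto
  then have 4: "derives V (10 * Q + K * (12 * Q) + (12 * Q + K * (12 * Q)) + (Q + K * (12 * Q))) (range (F g))"
    by (rule derives_chain[OF 3]) simp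
  have "derives (V \<union> range (F g)) (14 * Q) ((\<lambda>s x. dft n (\<lambda>j. v j x) s) ` {..<n})"
  proof (rule derives_family[where I = "{..<n}" and f = "\<lambda>s x. dft n (\<lambda>j. v j x) s" and c = 14])
    fix s assume s: "s \<in> {..<n}"
    have eq: "(\<lambda>x. dft n (\<lambda>j. v j x) s) = (\<lambda>x. cnj (unity_root n (s choose 2)) * (F g s x / of_nat Q))"
      using s Q by (simp add: F_def g_def c_def u_def dft_chirp)
    have "derives (V \<union> range (F g)) ((10 + 1) + (0 + 1 + 1) + 1)
        {\<lambda>x. cnj (unity_root n (s choose 2)) * (F g s x / of_nat Q)}"
      by (intro derives_mult derives_divide derives_cnj derives_unity_root derives_const derives_avail) auto
    then show "derives (V \<union> range (F g)) 14 {\<lambda>x. dft n (\<lambda>j. v j x) s}" unfolding eq by simp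
  qed (use Q in auto)
  then show ?thesis
    by (rule derives_chain[OF 4]) (simp add: Q_def algebra_simps)
qed

text \<open>
  The sum of length \<open>2 * m\<close> arises from the sum of length \<open>m\<close> by \<open>geom_sum_add\<close>, and one more term makes
  it odd. All starting points \<open>r\<close> are treated at once; by periodicity there are \<open>d\<close> of them. The number
  \<open>e\<close> is the cost of a power of \<open>\<rho>\<close>. The initial \<open>1\<close> in the bound pays for the constant \<open>0\<close>.
\<close>

lemma derives_geom_sum:
  fixes V :: "('i \<Rightarrow> complex) set"
  assumes period: "\<And>r. g (r + d) = g r" and d: "0 < d"
    and g: "\<And>r. g r \<in> V" and \<rho>: "\<And>(U :: ('i \<Rightarrow> complex) set) m. derives U e {\<lambda>_. \<rho> ^ m}" and n: "n < 2 ^ k"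
  shows "derives V (d * (1 + k * (2 * e + 4))) (range (\<lambda>r x. geom_sum \<rho> L (\<lambda>r. g r x) n r))"
  using n
proof (induction k arbitrary: n)
  case 0
  have "derives V 1 {\<lambda>_. of_nat 0}" by (rule derives_const)
  then show ?case by (rule derives_mono) (use 0 d in \<open>auto simp: geom_sum_def\<close>)
next
  case (Suc k)
  define S where "S = (\<lambda>n. range (\<lambda>r x. geom_sum \<rho> L (\<lambda>r. g r x) n r))"
  have family: "derives U (d * (e + 2)) (range h)"
    if "\<And>r. derives U (e + 2) {h r}" and "\<And>r. h (r + d) = h r" for U and h :: "nat \<Rightarrow> 'i \<Rightarrow> complex"
  proof (rule derives_family[where I = "{..<d}" and f = h and c = "e + 2"])
    show "range h \<subseteq> h ` {..<d}"
      using periodic_mod[of h d, OF that(2)] d by (metis (no_types, lifting) image_eqI image_subsetI lessThan_iff mod_less_divisor)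
  qed (use that in auto)
  have per: "geom_sum \<rho> L (\<lambda>r. g r x) n (r + d) = geom_sum \<rho> L (\<lambda>r. g r x) n r" for x n r
  proof -
    have "g (r + d + t * L) = g (r + t * L)" for t
      using period[of "r + t * L"] by (simp add: add_ac)
    then show ?thesis by (simp add: geom_sum_def)
  qed
  have double: "derives (V \<union> S m) (d * (e + 2)) (S (m + m))" for m
    unfolding S_def
  proof (rule family)
    fix r
    have "derives (V \<union> range (\<lambda>r x. geom_sum \<rho> L (\<lambda>r. g r x) m r)) (0 + (e + 0 + 1) + 1)
        {\<lambda>x. geom_sum \<rho> L (\<lambda>r. g r x) m r + \<rho> ^ m * geom_sum \<rho> L (\<lambda>r. g r x) m (r + m * L)}"
      by (intro derives_add derives_mult derives_avail \<rho>) auto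
    then show "derives (V \<union> range (\<lambda>r x. geom_sum \<rho> L (\<lambda>r. g r x) m r)) (e + 2)
        {\<lambda>x. geom_sum \<rho> L (\<lambda>r. g r x) (m + m) r}"
      by (simp add: geom_sum_add)
  qed (simp add: per)
  have odd: "derives (V \<union> S m) (d * (e + 2)) (S (1 + m))" for m
    unfolding S_def
  proof (rule family)
    fix r
    have "derives (V \<union> range (\<lambda>r x. geom_sum \<rho> L (\<lambda>r. g r x) m r)) (0 + (e + 0 + 1) + 1)
        {\<lambda>x. g r x + \<rho> ^ 1 * geom_sum \<rho> L (\<lambda>r. g r x) m (r + 1 * L)}"
      using g by (intro derives_add derives_mult derives_avail \<rho>) auto
    moreover have "geom_sum \<rho> L (\<lambda>r. g r x) 1 r = g r x" for x by (simp add: geom_sum_def)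
    ultimately show "derives (V \<union> range (\<lambda>r x. geom_sum \<rho> L (\<lambda>r. g r x) m r)) (e + 2)
        {\<lambda>x. geom_sum \<rho> L (\<lambda>r. g r x) (1 + m) r}"
      by (simp only: geom_sum_add) simp
  qed (simp only: per)
  define m where "m = n div 2"
  have "m < 2 ^ k" using Suc.prems by (simp add: m_def less_mult_imp_div_less mult.commute)
  then have IH: "derives V (d * (1 + k * (2 * e + 4))) (S m)" using Suc.IH by (simp add: S_def)
  have even: "derives V (d * (1 + k * (2 * e + 4)) + d * (e + 2)) (S (m + m))"
    by (rule derives_chain[OF IH double]) simp
  have "derives V (d * (1 + Suc k * (2 * e + 4))) (S n)"
  proof (cases "even n")
    case True
    then have "n = m + m" by (auto simp: m_def)
    then show ?thesis using even by (auto elim!: derives_le simp: algebra_simps)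
  next
    case False
    then have "n = 1 + (m + m)" unfolding m_def by presburger
    then show ?thesis using derives_chain[OF even odd] by (simp add: algebra_simps)
  qed
  then show ?case by (simp add: S_def)
qed

lemma power2_above:
  fixes n :: nat
  assumes "0 < n"
  obtains k where "n \<le> 2 ^ k" "2 ^ k < 2 * n"
proof (cases "n = 1")
  case True
  then show ?thesis by (intro that[of 0]) auto
next
  case False
  then obtain k where "2 ^ k < n" "n \<le> 2 ^ (k + 1)" using ex_power_ivl2[of 2 n] assms by auto
  then show ?thesis by (intro that[of "k + 1"]) auto
qed


section \<open>The cost of BlockPR\<close>

lemma is_Arg_Arg: "is_Arg z (Arg z)"
  using Arg_eq[of z] by (cases "z = 0") (auto simp: is_Arg_def)

lemma is_Arg_cnj:
  assumes "is_Arg z \<alpha>"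
  shows "is_Arg (cnj z) (- \<alpha>)"
proof -
  have "cnj (complex_of_real c * exp (\<i> * complex_of_real \<alpha>)) = complex_of_real c * exp (\<i> * complex_of_real (- \<alpha>))" for c
    by (simp add: exp_cnj)
  then show ?thesis using assms unfolding is_Arg_def complex_mod_cnj by metis
qed

context local_correlation
begin

text \<open>
  The exponent is a quotient of two natural numbers, which are constants of the programs, because
  \<open>max 4 ((\<delta> - 1) / 2)\<close> is half of \<open>max 8 (\<delta> - 1)\<close>.
\<close>

lemma derives_decay: "derives V 6 {\<lambda>_. complex_of_real (decay k)}"
proof -
  have D: "derives V ((1 + 1 + 1) + 1 + 1 + 1)
      {\<lambda>_. exp ((of_nat 0 - of_nat (2 * k)) / of_nat (max 8 (\<delta> - 1)))}"
    by (intro derives_exp derives_divide derives_diff derives_const)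
  have eq: "exp ((of_nat 0 - of_nat (2 * k)) / of_nat (max 8 (\<delta> - 1))) = complex_of_real (decay k)"
  proof -
    have "real (max 8 (\<delta> - 1)) = 2 * max 4 ((real \<delta> - 1) / 2)" 
    proof -
      have "real (\<delta> - 1) = real \<delta> - 1" using \<delta>_pos by simp
      then show ?thesis unfolding of_nat_max by (auto simp: max_def)
    qed
    then have "- real k / max 4 ((real \<delta> - 1) / 2) = (real 0 - real (2 * k)) / real (max 8 (\<delta> - 1))" by simp
    then have "complex_of_real (decay k) = exp (complex_of_real ((real 0 - real (2 * k)) / real (max 8 (\<delta> - 1))))"
      unfolding decay_def exp_of_real by (simp only:)
    then show ?thesis by (simp only: of_real_divide of_real_diff of_real_of_nat_eq)
  qed
  show ?thesis using derives_le[OF D, of 6] unfolding eq by simp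
qed

lemma decay_power: "complex_of_real (decay 2) ^ m = complex_of_real (decay (2 * m))"
  by (simp add: decay_mult)

definition measured_values :: "(real vec \<Rightarrow> complex) set" where
  "measured_values = {\<lambda>b. complex_of_real (b $ k) | k. k < meas_dim d \<delta>}"

lemma derives_spectrum:
  assumes K: "2 * N \<le> 2 ^ K"
  shows "derives measured_values (d * ((36 * K + 38) * 2 ^ K + N * 3)) {\<lambda>b. spectrum b j r | j r. j < N}"
proof -
  have block: "derives measured_values ((36 * K + 38) * 2 ^ K + N * 3) ((\<lambda>j b. spectrum b j r) ` {..<N})" for r
  proof (rule derives_chain)
    show "derives measured_values ((36 * K + 38) * 2 ^ K)
        ((\<lambda>j b. dft N (\<lambda>i. complex_of_real (b $ (i * d + r mod d))) j) ` {..<N})"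
    proof (rule derives_dft[OF _ K])
      fix i assume "i < N"
      then have "i * d + r mod d < meas_dim d \<delta>"
        using block_index_less[of i N "r mod d" d] d_pos by (simp add: meas_dim_def mult.commute)
      then show "(\<lambda>b. complex_of_real (b $ (i * d + r mod d))) \<in> measured_values"
        by (auto simp: measured_values_def)
    qed
    show "derives (measured_values \<union> (\<lambda>j b. dft N (\<lambda>i. complex_of_real (b $ (i * d + r mod d))) j) ` {..<N}) (N * 3)
        ((\<lambda>j b. spectrum b j r) ` {..<N})" (is "derives ?V _ _")
    proof (rule derives_family[where I = "{..<N}" and f = "\<lambda>j b. spectrum b j r" and c = 3])
      fix j assume "j \<in> {..<N}"
      then have "derives ?V (0 + (1 + 1) + 1)
          {\<lambda>b. dft N (\<lambda>i. complex_of_real (b $ (i * d + r mod d))) j / csqrt (of_nat N)}"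
        by (intro derives_divide derives_sqrt derives_const derives_avail) auto
      moreover have "csqrt (of_nat N) = complex_of_real (sqrt (real N))"
        using csqrt_of_real_nonneg[of "real N"] by simp
      ultimately show "derives ?V 3 {\<lambda>b. spectrum b j r}"
        by (auto simp only: spectrum_def elim!: derives_le)
    qed auto
  qed simp
  show ?thesis
  proof (rule derives_mono[OF derives_UN[of "{..<d}", OF _ block]])
    show "{\<lambda>b. spectrum b j r | j r. j < N} \<subseteq> measured_values \<union> (\<Union>r\<in>{..<d}. (\<lambda>j b. spectrum b j r) ` {..<N})"
    proof
      fix h assume "h \<in> {\<lambda>b. spectrum b j r | j r. j < N}"
      then obtain j r where "j < N" and h: "h = (\<lambda>b. spectrum b j r)" by blast
      then have "h = (\<lambda>b. spectrum b j (r mod d))" by (simp only: spectrum_mod)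
      then show "h \<in> measured_values \<union> (\<Union>r\<in>{..<d}. (\<lambda>j b. spectrum b j r) ` {..<N})"
        using d_pos \<open>j < N\<close> by (intro UnI2 UN_I[of "r mod d"] image_eqI[of _ _ j]) auto
    qed
  qed auto
qed

text \<open>
  The right hand side of the recurrence that \<open>deconvolved\<close> solves, as a function of the data.
\<close>

definition increment :: "nat \<Rightarrow> nat \<Rightarrow> real vec \<Rightarrow> complex" where
  "increment j r b = (spectrum b j r - complex_of_real (decay 2) * spectrum b j (Suc r)) / complex_of_real (decay (j + 2))"

lemma increment_add_d: "increment j (r + d) = increment j r"
proof -
  have period: "spectrum b j (s + d) = spectrum b j s" for b s
    using spectrum_mod[of b j "s + d"] spectrum_mod[of b j s] by simp
  then have "spectrum b j (Suc (r + d)) = spectrum b j (Suc r)" for b using period[of b "Suc r"] by simp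
  then show ?thesis by (simp add: increment_def fun_eq_iff period)
qed

lemma derives_deconvolved:
  assumes k: "d < 2 ^ k"
  shows "derives {\<lambda>b. spectrum b j r | j r. j < N} (\<delta> * (d * 15) + \<delta> * (d * (1 + k * 16)) + \<delta> * (d * 9))
    {\<lambda>b. deconvolved b j r | j r. j < \<delta>}"
proof -
  let ?S = "{\<lambda>b. spectrum b j r | j r. j < N}" and ?G = "{increment j r | j r. j < \<delta>}"
  let ?g = "\<lambda>j r b. geom_sum (complex_of_real (decay 2) ^ (\<delta> - j)) (\<delta> - j) (\<lambda>r. increment j r b) d r"
  have "derives ?S (\<delta> * (d * 15)) ?G"
  proof (rule derives_family[where I = "{..<\<delta>} \<times> {..<d}" and f = "\<lambda>(j, r). increment j r" and c = 15])
    fix i assume "i \<in> {..<\<delta>} \<times> {..<d}"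
    then obtain j r where i: "i = (j, r)" and j: "j < \<delta>" by auto
    then have "j < N" by simp
    then have "derives ?S ((0 + (6 + 0 + 1) + 1) + 6 + 1)
        {\<lambda>b. (spectrum b j r - complex_of_real (decay 2) * spectrum b j (Suc r)) / complex_of_real (decay (j + 2))}"
      by (intro derives_divide derives_diff derives_mult derives_decay derives_avail) blast+
    moreover have "increment j r = (\<lambda>b. (spectrum b j r - complex_of_real (decay 2) * spectrum b j (Suc r)) / complex_of_real (decay (j + 2)))"
      by (simp add: increment_def fun_eq_iff)
    ultimately show "derives ?S 15 {case i of (j, r) \<Rightarrow> increment j r}" by (auto simp only: i prod.case elim!: derives_le)
  next
    show "?G \<subseteq> (\<lambda>(j, r). increment j r) ` ({..<\<delta>} \<times> {..<d})"
    proof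
      fix h assume "h \<in> ?G"
      then obtain j r where "j < \<delta>" "h = increment j r" by blast
      then have "h = (\<lambda>(j, r). increment j r) (j, r mod d)" "(j, r mod d) \<in> {..<\<delta>} \<times> {..<d}"
        using periodic_mod[of "increment j" d, OF increment_add_d] d_pos by simp_all
      then show "h \<in> (\<lambda>(j, r). increment j r) ` ({..<\<delta>} \<times> {..<d})" by (rule image_eqI)
    qed
  qed (auto simp: card_cartesian_product)
  moreover have "derives (?S \<union> ?G) (\<delta> * (d * (1 + k * 16))) (\<Union>j\<in>{..<\<delta>}. range (?g j))"
  proof -
    have "derives (?S \<union> ?G) (d * (1 + k * (2 * 6 + 4))) (range (?g j))" if j: "j \<in> {..<\<delta>}" for j
    proof (rule derives_geom_sum[where g = "increment j" and d = d, OF increment_add_d d_pos _ _ k])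
      show "increment j r \<in> ?S \<union> ?G" for r using j by auto
      show "derives U 6 {\<lambda>_. (complex_of_real (decay 2) ^ (\<delta> - j)) ^ m}" for U :: "(real vec \<Rightarrow> complex) set" and m
      proof -
        have "(complex_of_real (decay 2) ^ (\<delta> - j)) ^ m = complex_of_real (decay (2 * ((\<delta> - j) * m)))"
          by (subst power_mult [symmetric]) (rule decay_power)
        then show ?thesis by (simp only: derives_decay)
      qed
    qed
    from derives_UN[of "{..<\<delta>}", OF _ this] show ?thesis by simp
  qed
  ultimately have geom: "derives ?S (\<delta> * (d * 15) + \<delta> * (d * (1 + k * 16))) (\<Union>j\<in>{..<\<delta>}. range (?g j))"
    by (rule derives_chain) simp
  have "derives (?S \<union> (\<Union>j\<in>{..<\<delta>}. range (?g j))) (\<delta> * (d * 9)) {\<lambda>b. deconvolved b j r | j r. j < \<delta>}"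
    (is "derives ?V _ ?H")
  proof (rule derives_family[where I = "{..<\<delta>} \<times> {..<d}" and f = "\<lambda>(j, r) b. deconvolved b j r" and c = 9])
    fix i assume "i \<in> {..<\<delta>} \<times> {..<d}"
    then obtain j r where i: "i = (j, r)" and j: "j < \<delta>" by auto
    have "?g j r \<in> ?V" by (intro UnI2 UN_I[of j] rangeI) (use j in simp)
    then have "derives ?V (0 + (1 + 6 + 1) + 1)
        {\<lambda>b. ?g j r b / (of_nat 1 - complex_of_real (decay (2 * ((\<delta> - j) * d))))}"
      by (intro derives_divide derives_diff derives_decay derives_const derives_avail)
    moreover have "(\<lambda>b. ?g j r b / (of_nat 1 - complex_of_real (decay (2 * ((\<delta> - j) * d))))) = (\<lambda>b. deconvolved b j r)"
      by (simp add: deconvolved_def increment_def decay_power fun_eq_iff)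
    ultimately show "derives ?V 9 {case i of (j, r) \<Rightarrow> \<lambda>b. deconvolved b j r}"
      by (auto simp only: i prod.case elim!: derives_le)
  next
    show "?H \<subseteq> (\<lambda>(j, r) b. deconvolved b j r) ` ({..<\<delta>} \<times> {..<d})"
    proof
      fix h assume "h \<in> ?H"
      then obtain j r where j: "j < \<delta>" and h: "h = (\<lambda>b. deconvolved b j r)" by blast
      have "h = (\<lambda>(j, r) b. deconvolved b j r) (j, r mod d)" by (simp only: h prod.case deconvolved_mod)
      moreover have "(j, r mod d) \<in> {..<\<delta>} \<times> {..<d}" using j d_pos by simp
      ultimately show "h \<in> (\<lambda>(j, r) b. deconvolved b j r) ` ({..<\<delta>} \<times> {..<d})" by (rule image_eqI)
    qed
  qed (auto simp: card_cartesian_product)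
  then show ?thesis by (rule derives_chain[OF geom]) simp
qed

definition magnitudes :: "(real vec \<Rightarrow> complex) set" where
  "magnitudes = (\<lambda>p b. complex_of_real (cmod (inverse_lift b $ pos d \<delta> p p))) ` {..<d}"

text \<open>
  These are the arguments of all entries that the synchronization may look up. They are prepared
  in advance, at a cost of two operations for each of the \<open>d * N\<close> pairs, so that the tree itself only
  adds and compares.
\<close>

definition relative_phases :: "(real vec \<Rightarrow> complex) set" where
  "relative_phases = (\<lambda>(c, k) b. complex_of_real (Arg (inverse_lift b $ pos d \<delta> (idx d (int c + k)) c)))
     ` ({..<d} \<times> {1 - int \<delta>..int \<delta> - 1})"

lemma derives_magnitudes: "derives {\<lambda>b. deconvolved b j r | j r. j < \<delta>} (d * 1) magnitudes"
  unfolding magnitudes_def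
proof (rule derives_family[where I = "{..<d}" and c = 1
      and f = "\<lambda>p b. complex_of_real (cmod (inverse_lift b $ pos d \<delta> p p))"])
  fix p assume "p \<in> {..<d}"
  moreover have "idx d (int p - int p) = 0" by (simp add: idx_def)
  ultimately have "inverse_lift b $ pos d \<delta> p p = deconvolved b 0 p" for b
    using inverse_lift_pos[of p p b] \<delta>_pos by simp
  moreover have "derives {\<lambda>b. deconvolved b j r | j r. j < \<delta>} (0 + 1) {\<lambda>b. complex_of_real (cmod (deconvolved b 0 p))}"
    by (intro derives_modulus derives_avail) (use \<delta>_pos in blast)
  ultimately show "derives {\<lambda>b. deconvolved b j r | j r. j < \<delta>} 1
      {\<lambda>b. complex_of_real (cmod (inverse_lift b $ pos d \<delta> p p))}" by simp
qed auto

lemma derives_relative_phases: "derives {\<lambda>b. deconvolved b j r | j r. j < \<delta>} (d * N * 2) relative_phases"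
  unfolding relative_phases_def
proof (rule derives_family[where I = "{..<d} \<times> {1 - int \<delta>..int \<delta> - 1}" and c = 2
      and f = "\<lambda>(c, k) b. complex_of_real (Arg (inverse_lift b $ pos d \<delta> (idx d (int c + k)) c))"])
  let ?H = "{\<lambda>b. deconvolved b j r | j r. j < \<delta>}"
  fix i assume "i \<in> {..<d} \<times> {1 - int \<delta>..int \<delta> - 1}"
  then obtain c k where i: "i = (c, k)" and c: "c < d" and k: "1 - int \<delta> \<le> k" "k \<le> int \<delta> - 1" by auto
  define p where "p = idx d (int c + k)"
  have p: "p < d" using idx_less d_pos by (simp add: p_def)
  have "derives ?H 2 {\<lambda>b. complex_of_real (Arg (inverse_lift b $ pos d \<delta> p c))}"
  proof (cases "idx d (int p - int c) < \<delta>")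
    case True
    have "derives ?H (0 + 1) {\<lambda>b. complex_of_real (Arg (deconvolved b (idx d (int p - int c)) c))}"
      by (intro derives_Arg derives_avail) (use True in blast)
    then show ?thesis unfolding inverse_lift_pos[OF p c True] by (rule derives_le) simp
  next
    case False
    then have near: "idx d (int c - int p) < \<delta>" using near_neighbour[OF c k p_def] by simp
    have ne: "c \<noteq> p" using False \<delta>_pos by (auto simp: idx_def)
    have "derives ?H (0 + 1 + 1) {\<lambda>b. complex_of_real (Arg (cnj (deconvolved b (idx d (int c - int p)) p)))}"
      by (intro derives_Arg derives_cnj derives_avail) (use near in blast)
    then show ?thesis unfolding inverse_lift_pos_cnj[OF c p near ne] by (rule derives_le) simp
  qed
  then show "derives ?H 2 {case i of (c, k) \<Rightarrow> \<lambda>b. complex_of_real (Arg (inverse_lift b $ pos d \<delta> (idx d (int c + k)) c))}"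
    by (simp add: i p_def)
next
  have "nat (int \<delta> - 1 - (1 - int \<delta>) + 1) = N" by simp
  then show "card ({..<d} \<times> {1 - int \<delta>..int \<delta> - 1}) * 2 \<le> d * N * 2"
    by (simp only: card_cartesian_product card_lessThan card_atLeastAtMost_int)
qed auto

lemma inverse_lift_pos_swap:
  assumes p: "p < d" and c: "c < d" and ne: "p \<noteq> c"
    and near: "idx d (int p - int c) < \<delta> \<or> idx d (int c - int p) < \<delta>"
  shows "inverse_lift b $ pos d \<delta> c p = cnj (inverse_lift b $ pos d \<delta> p c)"
proof (cases "idx d (int p - int c) < \<delta>")
  case True
  then show ?thesis using inverse_lift_pos[OF p c True] inverse_lift_pos_cnj[OF p c True ne] by simp
next
  case False
  with near have "idx d (int c - int p) < \<delta>" by simp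
  from inverse_lift_pos[OF c p this] inverse_lift_pos_cnj[OF c p this] ne show ?thesis by simp
qed

definition recovered :: "real vec \<Rightarrow> (nat \<Rightarrow> real) \<Rightarrow> complex list" where
  "recovered b \<psi> = map (\<lambda>p. complex_of_real (sqrt (cmod (inverse_lift b $ pos d \<delta> p p)))
     * exp (\<i> * complex_of_real (\<psi> p))) [0..<d]"

lemma solves_recovered:
  assumes mag: "magnitudes \<subseteq> V" and \<phi>: "\<And>p. p < d \<Longrightarrow> (\<lambda>b. complex_of_real (\<phi> b p)) \<in> V"
    and P: "\<And>b. b \<in> X \<Longrightarrow> P b (recovered b (\<phi> b))"
  shows "solves X V (5 * d) P"
proof -
  define f where "f = (\<lambda>p b. complex_of_real (sqrt (cmod (inverse_lift b $ pos d \<delta> p p)))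
     * exp (\<i> * complex_of_real (\<phi> b p)))"
  have "derives V (5 * d) (f ` {..<d})"
  proof (rule derives_family[where I = "{..<d}" and f = f and c = 5])
    fix p assume p: "p \<in> {..<d}"
    then have "(\<lambda>b. complex_of_real (cmod (inverse_lift b $ pos d \<delta> p p))) \<in> V"
      using mag by (auto simp: magnitudes_def)
    then have D: "derives V ((0 + 1) + (1 + 0 + 1 + 1) + 1)
        {\<lambda>b. csqrt (complex_of_real (cmod (inverse_lift b $ pos d \<delta> p p))) * exp (\<i> * complex_of_real (\<phi> b p))}"
      using p \<phi> by (intro derives_mult derives_sqrt derives_exp derives_i derives_avail) auto
    have "f p = (\<lambda>b. csqrt (complex_of_real (cmod (inverse_lift b $ pos d \<delta> p p))) * exp (\<i> * complex_of_real (\<phi> b p)))"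
      by (simp add: f_def csqrt_of_real_nonneg)
    then show "derives V 5 {f p}" using derives_le[OF D, of 5] by simp
  qed auto
  moreover have "solves X (V \<union> f ` {..<d}) 0 P"
  proof (rule solves_return)
    show "set (map f [0..<d]) \<subseteq> V \<union> f ` {..<d}" by auto
    show "\<forall>b\<in>X. P b (map (\<lambda>f. f b) (map f [0..<d]))"
      using P by (simp add: recovered_def f_def o_def)
  qed
  ultimately show ?thesis using solves_derives[of V "5 * d" "f ` {..<d}" X 0 P] by simp
qed

text \<open>
  An iteration that finishes \<open>m\<close> new indices needs \<open>m\<close> additions and \<open>\<delta> - 1\<close> comparisons, and
  \<open>m + \<delta> - 1 \<le> m * \<delta>\<close> because \<open>m \<ge> 1\<close>; so \<open>\<delta>\<close> operations per index are enough. The final \<open>5 * d\<close> operations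
  assemble the output. In every leaf, \<open>S\<close> and \<open>j\<close> are fixed; only the phases depend on the input.
\<close>

lemma solves_sync_loop:
  fixes \<phi> :: "real vec \<Rightarrow> nat \<Rightarrow> real"
  assumes "magnitudes \<subseteq> V" "relative_phases \<subseteq> V"
    and "\<And>p. p < d \<Longrightarrow> (\<lambda>b. complex_of_real (\<phi> b p)) \<in> V"
    and "S \<subseteq> {..<d}" "j \<in> S"
  shows "solves X V ((d - card S) * \<delta> + 5 * d)
    (\<lambda>b out. \<exists>\<psi>. sync_loop d \<delta> (inverse_lift b) (\<phi> b) S j \<psi> \<and> out = recovered b \<psi>)"
  using assms
proof (induction "d - card S" arbitrary: S j \<phi> V X rule: less_induct)
  case less
  let ?P = "\<lambda>\<phi> S j b out. \<exists>\<psi>. sync_loop d \<delta> (inverse_lift b) (\<phi> b) S j \<psi> \<and> out = recovered b \<psi>"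
  have j: "j < d" using less.prems(4,5) by auto
  show ?case
  proof (cases "\<forall>i. 0 < i \<and> i < \<delta> \<longrightarrow> (j + i) mod d \<in> S")
    case True
    have "solves X V (5 * d) (?P \<phi> S j)"
      by (rule solves_recovered[of _ \<phi>]) (use less.prems sync_loop.stop[OF True] in blast)+
    then show ?thesis by (rule solves_mono) auto
  next
    case False
    define M where "M = {idx d (int j + i) | i. 1 - int \<delta> \<le> i \<and> i \<le> int \<delta> - 1} - S"
    \<comment> \<open>the step asks for half the difference of two opposite arguments, which is the first of them\<close>
    define \<phi>' where "\<phi>' = (\<lambda>b p. if p \<in> M then \<phi> b j + Arg (inverse_lift b $ pos d \<delta> p j) else \<phi> b p)"
    let ?W = "(\<lambda>p b. complex_of_real (\<phi>' b p)) ` M"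
    obtain k where k: "0 < k" "k < \<delta>" "(j + k) mod d \<notin> S" using False by blast
    have M: "M \<subseteq> {..<d}" using idx_less d_pos by (auto simp: M_def)
    then have fin: "finite M" "finite S" using less.prems(4) by (auto intro: finite_subset)
    have "(j + k) mod d = idx d (int j + int k)" using idx_nat[of "j + k"] by simp
    then have "(j + k) mod d \<in> M" using k by (auto simp: M_def)
    then have M1: "1 \<le> card M" using fin by (metis One_nat_def Suc_leI card_gt_0_iff empty_iff)
    have cardSM: "card (S \<union> M) = card S + card M" using fin by (intro card_Un_disjoint) (auto simp: M_def)
    have SM: "S \<union> M \<subseteq> {..<d}" using less.prems(4) M by auto
    then have cardd: "card S + card M \<le> d" using card_mono[OF _ SM] cardSM by simp
    have "derives V (card M * 1) ?W"
    proof (rule derives_family[where I = M and f = "\<lambda>p b. complex_of_real (\<phi>' b p)" and c = 1])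
      fix p assume p: "p \<in> M"
      then obtain i where "p = idx d (int j + i)" "i \<in> {1 - int \<delta>..int \<delta> - 1}" by (auto simp: M_def)
      then have "(\<lambda>b. complex_of_real (Arg (inverse_lift b $ pos d \<delta> p j))) \<in> relative_phases"
        using j unfolding relative_phases_def by (intro image_eqI[of _ _ "(j, i)"]) auto
      then have "derives V (0 + 0 + 1) {\<lambda>b. complex_of_real (\<phi> b j) + complex_of_real (Arg (inverse_lift b $ pos d \<delta> p j))}"
        using less.prems(2,3) j by (intro derives_add derives_avail) auto
      then show "derives V 1 {\<lambda>b. complex_of_real (\<phi>' b p)}" using p by (simp add: \<phi>'_def)
    qed (use fin in auto)
    moreover have "solves X (V \<union> ?W) (card {0<..<\<delta>} + ((d - card (S \<union> M)) * \<delta> + 5 * d)) (?P \<phi> S j)"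
    proof (rule solves_arg_max)
      let ?h = "\<lambda>i b. complex_of_real (cmod (inverse_lift b $ pos d \<delta> ((j + i) mod d) ((j + i) mod d)))"
      have "k \<in> {0<..<\<delta>}" using k by simp
      then show "{0<..<\<delta>} \<noteq> {}" by blast
      fix i assume "i \<in> {0<..<\<delta>}"
      then have i: "0 < i" "i < \<delta>" by auto
      show "?h i \<in> V \<union> ?W"
        using less.prems(1) d_pos by (auto simp: magnitudes_def)
      have "solves {b \<in> X. \<forall>k\<in>{0<..<\<delta>}. Re (?h k b) \<le> Re (?h i b)} (V \<union> ?W)
          ((d - card (S \<union> M)) * \<delta> + 5 * d) (?P \<phi>' (S \<union> M) ((j + i) mod d))"
      proof (rule less.hyps)
        show "d - card (S \<union> M) < d - card S" using cardSM M1 cardd by simp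
        show "(\<lambda>b. complex_of_real (\<phi>' b p)) \<in> V \<union> ?W" if "p < d" for p
          using less.prems(3)[OF that] by (cases "p \<in> M") (auto simp: \<phi>'_def)
        have "(j + i) mod d = idx d (int j + int i)" using idx_nat[of "j + i"] by simp
        then show "(j + i) mod d \<in> S \<union> M" using i by (auto simp: M_def)
      qed (use less.prems SM in auto)
      then show "solves {b \<in> X. \<forall>k\<in>{0<..<\<delta>}. Re (?h k b) \<le> Re (?h i b)} (V \<union> ?W)
          ((d - card (S \<union> M)) * \<delta> + 5 * d) (?P \<phi> S j)"
      proof (rule solves_mono)
        fix b out
        assume b: "b \<in> {b \<in> X. \<forall>k\<in>{0<..<\<delta>}. Re (?h k b) \<le> Re (?h i b)}"
          and "?P \<phi>' (S \<union> M) ((j + i) mod d) b out"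
        then obtain \<psi> where \<psi>: "sync_loop d \<delta> (inverse_lift b) (\<phi>' b) (S \<union> M) ((j + i) mod d) \<psi>"
          and out: "out = recovered b \<psi>" by blast
        have "sync_loop d \<delta> (inverse_lift b) (\<phi> b) S j \<psi>"
        proof (rule sync_loop.step[OF _ M_def _ _ _ \<psi>])
          show "\<exists>i>0. i < \<delta> \<and> (j + i) mod d \<notin> S" using k by blast
          show "\<forall>p. p \<notin> M \<longrightarrow> \<phi>' b p = \<phi> b p" by (simp add: \<phi>'_def)
          show "is_arg_max (\<lambda>i. cmod (inverse_lift b $ pos d \<delta> ((j + i) mod d) ((j + i) mod d)))
              (\<lambda>i. 0 < i \<and> i < \<delta>) i"
            using b i by (auto simp: is_arg_max_def not_less)
          show "\<forall>p\<in>M. \<exists>\<alpha>\<in>{- pi..pi}. \<exists>\<beta>\<in>{- pi..pi}.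
              is_Arg (inverse_lift b $ pos d \<delta> p j) \<alpha> \<and> is_Arg (inverse_lift b $ pos d \<delta> j p) \<beta> \<and> \<beta> = - \<alpha> \<and>
              \<phi>' b p = \<phi> b j + (\<alpha> - \<beta>) / 2"
          proof
            fix p assume p: "p \<in> M"
            then obtain i where i: "p = idx d (int j + i)" "1 - int \<delta> \<le> i" "i \<le> int \<delta> - 1" by (auto simp: M_def)
            let ?\<alpha> = "Arg (inverse_lift b $ pos d \<delta> p j)"
            have "p < d" "p \<noteq> j" using p M less.prems(5) by (auto simp: M_def)
            then have "inverse_lift b $ pos d \<delta> j p = cnj (inverse_lift b $ pos d \<delta> p j)"
              using j near_neighbour[OF j i(2,3,1)] by (intro inverse_lift_pos_swap) auto
            then have "is_Arg (inverse_lift b $ pos d \<delta> p j) ?\<alpha> \<and> is_Arg (inverse_lift b $ pos d \<delta> j p) (- ?\<alpha>) \<and>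
                - ?\<alpha> = - ?\<alpha> \<and> \<phi>' b p = \<phi> b j + (?\<alpha> - - ?\<alpha>) / 2"
              using is_Arg_Arg is_Arg_cnj[OF is_Arg_Arg] p by (simp add: \<phi>'_def)
            moreover have "?\<alpha> \<in> {- pi..pi}" "- ?\<alpha> \<in> {- pi..pi}"
              using Arg_bounded[of "inverse_lift b $ pos d \<delta> p j"] by auto
            ultimately show "\<exists>\<alpha>\<in>{- pi..pi}. \<exists>\<beta>\<in>{- pi..pi}.
              is_Arg (inverse_lift b $ pos d \<delta> p j) \<alpha> \<and> is_Arg (inverse_lift b $ pos d \<delta> j p) \<beta> \<and> \<beta> = - \<alpha> \<and>
              \<phi>' b p = \<phi> b j + (\<alpha> - \<beta>) / 2" by blast
          qed
        qed
        then show "?P \<phi> S j b out" using out by blast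
      qed auto
    qed simp
    ultimately have "solves X V (card M * 1 + (card {0<..<\<delta>} + ((d - card (S \<union> M)) * \<delta> + 5 * d))) (?P \<phi> S j)"
      by (rule solves_derives)
    moreover have "card M * 1 + (card {0<..<\<delta>} + ((d - card (S \<union> M)) * \<delta> + 5 * d)) \<le> (d - card S) * \<delta> + 5 * d"
    proof -
        \<comment> \<open>with \<open>card M = m + 1\<close> and \<open>\<delta> = \<delta>' + 1\<close> the slack is \<open>m * \<delta>'\<close>\<close>
      define e where "e = d - card (S \<union> M)"
      have "d - card S = e + card M" using cardSM cardd by (simp add: e_def)
      moreover obtain m where "card M = Suc m" using M1 by (cases "card M") auto
      moreover obtain \<delta>' where "\<delta> = Suc \<delta>'" using \<delta>_pos by (cases \<delta>) auto
      ultimately show ?thesis by (simp add: algebra_simps flip: e_def)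
    qed
    ultimately show ?thesis by (rule solves_cost_mono)
  qed
qed

text \<open>
  The summands of the cost are, in this order: the Fourier transforms of the \<open>d\<close> blocks, the
  deconvolution for \<open>\<delta>\<close> offsets, moduli and arguments, the initial phase \<open>0\<close>, and the tree that
  finds the largest diagonal entry and synchronizes.
\<close>

lemma solves_block_pr:
  assumes K: "2 * N \<le> 2 ^ K" and k: "d < 2 ^ k"
  shows "solves (carrier_vec (meas_dim d \<delta>)) measured_values
    (d * ((36 * K + 38) * 2 ^ K + N * 3) + (\<delta> * (d * 15) + \<delta> * (d * (1 + k * 16)) + \<delta> * (d * 9))
      + (d + d * N * 2) + 1 + (d + (d * \<delta> + 5 * d)))
    (\<lambda>b out. block_pr d \<delta> mask b (vec_of_list out))"
proof -
  let ?P = "\<lambda>b out. block_pr d \<delta> mask b (vec_of_list out)"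
  let ?H = "{\<lambda>b. deconvolved b j r | j r. j < \<delta>}"
  let ?cS = "d * ((36 * K + 38) * 2 ^ K + N * 3)"
  let ?cH = "\<delta> * (d * 15) + \<delta> * (d * (1 + k * 16)) + \<delta> * (d * 9)"
  have H: "derives measured_values (?cS + ?cH) ?H"
    by (rule derives_chain[OF derives_spectrum[OF K] derives_mono[OF derives_deconvolved[OF k]]]) auto
  have "derives ?H (d * 1 + d * N * 2) (magnitudes \<union> relative_phases)"
    by (rule derives_trans[OF derives_magnitudes derives_mono[OF derives_relative_phases]]) auto
  then have "derives (measured_values \<union> ?H) (d + d * N * 2) (magnitudes \<union> relative_phases)"
    by (rule derives_mono) auto
  then have y: "derives measured_values (?cS + ?cH + (d + d * N * 2)) (magnitudes \<union> relative_phases)"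
    by (rule derives_chain[OF H]) simp
  let ?V = "measured_values \<union> (magnitudes \<union> relative_phases)"
  have "derives ?V 1 {\<lambda>_. of_nat 0}" by (rule derives_const)
  from derives_trans[OF y this]
  have all: "derives measured_values (?cS + ?cH + (d + d * N * 2) + 1)
      (magnitudes \<union> relative_phases \<union> {\<lambda>_. of_nat 0})" .
  let ?U = "measured_values \<union> (magnitudes \<union> relative_phases \<union> {\<lambda>_. of_nat 0})"
  obtain B where B: "inverts_mat (lifted_mat d \<delta> mask) B" "inverts_mat B (lifted_mat d \<delta> mask)"
    using lifted_mat_invertible by blast
  have "solves (carrier_vec (meas_dim d \<delta>)) ?U (card {..<d} + (d * \<delta> + 5 * d)) ?P"
  proof (rule solves_arg_max)
    let ?h = "\<lambda>a b. complex_of_real (cmod (inverse_lift b $ pos d \<delta> a a))"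
    show "{..<d} \<noteq> {}" using d_pos by auto
    fix a assume a: "a \<in> {..<d}"
    then show "?h a \<in> ?U" by (auto simp: magnitudes_def)
    have "solves {b \<in> carrier_vec (meas_dim d \<delta>). \<forall>k\<in>{..<d}. Re (?h k b) \<le> Re (?h a b)} ?U
        ((d - card {a}) * \<delta> + 5 * d)
        (\<lambda>b out. \<exists>\<psi>. sync_loop d \<delta> (inverse_lift b) ((\<lambda>_ _. 0) b) {a} a \<psi> \<and> out = recovered b \<psi>)"
      by (rule solves_sync_loop) (use a in auto)
    then show "solves {b \<in> carrier_vec (meas_dim d \<delta>). \<forall>k\<in>{..<d}. Re (?h k b) \<le> Re (?h a b)} ?U (d * \<delta> + 5 * d) ?P"
    proof (rule solves_mono)
      fix b out
      assume b: "b \<in> {b \<in> carrier_vec (meas_dim d \<delta>). \<forall>k\<in>{..<d}. Re (?h k b) \<le> Re (?h a b)}"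
        and "\<exists>\<psi>. sync_loop d \<delta> (inverse_lift b) ((\<lambda>_ _. 0) b) {a} a \<psi> \<and> out = recovered b \<psi>"
      then obtain \<psi> where \<psi>: "sync_loop d \<delta> (inverse_lift b) (\<lambda>_. 0) {a} a \<psi>"
        and out: "out = recovered b \<psi>" by blast
      have "is_arg_max (\<lambda>j. cmod (inverse_lift b $ pos d \<delta> j j)) (\<lambda>j. j < d) a"
        using a b by (auto simp: is_arg_max_def not_less)
      then have "greedy_sync d \<delta> (inverse_lift b) \<psi>"
        unfolding greedy_sync_def using \<psi> by (intro exI[of _ a] exI[of _ "\<lambda>_. 0"]) auto
      moreover have "inverse_lift b = B *\<^sub>v (perm_mat d \<delta> *\<^sub>v map_vec complex_of_real b)"
        using b by (intro inverse_eq_inverse_lift[OF B, symmetric]) auto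
      moreover have "vec_of_list out = vec d (\<lambda>j. complex_of_real (sqrt (cmod (inverse_lift b $ pos d \<delta> j j)))
          * exp (\<i> * complex_of_real (\<psi> j)))"
        by (rule eq_vecI) (simp_all add: out recovered_def vec_of_list_index)
      ultimately show "?P b out" unfolding block_pr_def using B by blast
    qed auto
  qed simp
  from solves_derives[OF all this] show ?thesis by simp
qed

lemma block_pr_prog:
  assumes K: "2 * N \<le> 2 ^ K" and k: "d < 2 ^ k"
  shows "\<exists>t. \<forall>b \<in> carrier_vec (meas_dim d \<delta>).
    block_pr d \<delta> mask b (vec_of_list (prog_out t (input_regs b))) \<and>
    prog_cost t (input_regs b)
      \<le> d * ((36 * K + 38) * 2 ^ K + N * 3) + (\<delta> * (d * 15) + \<delta> * (d * (1 + k * 16)) + \<delta> * (d * 9))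
        + (d + d * N * 2) + 1 + (d + (d * \<delta> + 5 * d))"
proof (rule solves_prog[OF solves_block_pr[OF assms]])
  show "\<forall>f\<in>measured_values. \<exists>r<meas_dim d \<delta>. \<forall>b\<in>carrier_vec (meas_dim d \<delta>). input_regs b r = f b"
    by (auto simp: measured_values_def input_regs_def)
qed

text \<open>
  The lengths \<open>2 ^ K\<close> and \<open>2 ^ k\<close> are chosen minimal, so both are at most \<open>4 * d \<le> d\<^sup>2\<close>, and \<open>2 ^ K \<le> 8 * \<delta>\<close>.
  Hence \<open>K\<close> and \<open>k\<close> are at most \<open>4 * ln d\<close>. The terms without a logarithm are absorbed by
  \<open>1 \<le> ln d\<close>.
\<close>

lemma block_pr_prog_cost:
  "\<exists>t. \<forall>b \<in> carrier_vec (meas_dim d \<delta>).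
    block_pr d \<delta> mask b (vec_of_list (prog_out t (input_regs b))) \<and>
    real (prog_cost t (input_regs b)) \<le> 2000 * (real \<delta> * real d * ln (real d))"
proof -
  obtain K where K: "2 * N \<le> 2 ^ K" "2 ^ K < 2 * (2 * N)" using power2_above[of "2 * N"] N_pos by auto
  obtain k where k: "d + 1 \<le> 2 ^ k" "2 ^ k < 2 * (d + 1)" using power2_above[of "d + 1"] by auto
  obtain t where t: "\<forall>b \<in> carrier_vec (meas_dim d \<delta>).
    block_pr d \<delta> mask b (vec_of_list (prog_out t (input_regs b))) \<and>
    prog_cost t (input_regs b)
      \<le> d * ((36 * K + 38) * 2 ^ K + N * 3) + (\<delta> * (d * 15) + \<delta> * (d * (1 + k * 16)) + \<delta> * (d * 9))
        + (d + d * N * 2) + 1 + (d + (d * \<delta> + 5 * d))"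
    using block_pr_prog[of K k] K(1) k(1) by auto
  have dd: "4 * d \<le> d * d" using d_ge by simp
  define l where "l = ln (real d)"
  have log_bound: "real m \<le> 4 * l" if "2 ^ m \<le> 4 * d" for m
  proof -
    have "(2::real) ^ m \<le> real d * real d"
      using of_nat_mono[OF order_trans[OF that dd], where 'a = real] by simp
    then have "ln (2 ^ m) \<le> ln (real d * real d)" using d_pos by (simp del: ln_realpow)
    then have "real m * ln 2 \<le> 2 * l" using d_pos by (simp add: ln_mult ln_realpow l_def)
    moreover have "real m * (1 / 2) \<le> real m * ln 2" using ln2_ge_two_thirds by (intro mult_left_mono) auto
    ultimately show ?thesis by simp
  qed
  have "2 ^ K \<le> 4 * d" using K(2) \<delta>_double by auto
  then have Kl: "real K \<le> 4 * l" by (rule log_bound)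
  have "2 ^ k \<le> 4 * d" using k(2) d_ge by auto
  then have kl: "real k \<le> 4 * l" by (rule log_bound)
  have l1: "1 \<le> l"
  proof -
    have "exp 1 \<le> real d" using exp_le d_ge by linarith
    then show ?thesis using d_pos by (simp add: l_def ln_ge_iff)
  qed
  let ?D = "real \<delta> * real d"
  have D: "real d \<le> ?D" "1 \<le> ?D" "0 \<le> ?D"
  proof -
    show "real d \<le> ?D" using mult_right_mono[of 1 "real \<delta>" "real d"] \<delta>_pos by simp
    then show "1 \<le> ?D" using d_pos by linarith
  qed simp
  have lin: "?D \<le> ?D * l" using mult_left_mono[OF l1 D(3)] by simp
  have "real (d * ((36 * K + 38) * 2 ^ K + N * 3) + (\<delta> * (d * 15) + \<delta> * (d * (1 + k * 16)) + \<delta> * (d * 9))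
        + (d + d * N * 2) + 1 + (d + (d * \<delta> + 5 * d))) \<le> 2000 * (?D * l)" (is "real ?c \<le> _")
  proof -
    have "real d * ((36 * real K + 38) * 2 ^ K) \<le> real d * ((36 * (4 * l) + 38) * (8 * real \<delta>))"
    proof (intro mult_left_mono mult_mono add_mono Kl)
      have "2 ^ K \<le> 8 * \<delta>" using K(2) by auto
      then show "(2::real) ^ K \<le> 8 * real \<delta>"
        using of_nat_mono[of "2 ^ K" "8 * \<delta>", where 'a = real] by simp
    qed (use l1 in auto)
    also have "\<dots> = 1152 * (?D * l) + 304 * ?D" by (simp add: algebra_simps)
    finally have 1: "real d * ((36 * real K + 38) * 2 ^ K) \<le> 1152 * (?D * l) + 304 * ?D" .
    have 2: "real d * real N \<le> 2 * ?D"
    proof -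
      have "real N \<le> 2 * real \<delta>" by simp
      from mult_left_mono[OF this, of "real d"] show ?thesis by (simp add: mult_ac)
    qed
    have 3: "?D * real k \<le> 4 * (?D * l)" using mult_left_mono[OF kl D(3)] by (simp add: mult_ac)
    have "real (d * ((36 * K + 38) * 2 ^ K + n * 3) + (\<delta> * (d * 15) + \<delta> * (d * (1 + k * 16)) + \<delta> * (d * 9))
        + (d + d * n * 2) + 1 + (d + (d * \<delta> + 5 * d)))
      = real d * ((36 * real K + 38) * 2 ^ K) + 5 * (real d * real n) + 26 * ?D + 16 * (?D * real k) + 7 * real d + 1" for n
      by (simp add: algebra_simps)
    then have "real ?c = real d * ((36 * real K + 38) * 2 ^ K) + 5 * (real d * real N) + 26 * ?D + 16 * (?D * real k) + 7 * real d + 1" .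
    also have "\<dots> \<le> 2000 * (?D * l)" using 1 2 3 D lin by linarith
    finally show ?thesis .
  qed
  note total = this
  have "real (prog_cost t (input_regs b)) \<le> 2000 * (?D * l)" if "b \<in> carrier_vec (meas_dim d \<delta>)" for b
  proof -
    have "prog_cost t (input_regs b) \<le> ?c" using t that by blast
    then have "real (prog_cost t (input_regs b)) \<le> real ?c" by (rule of_nat_mono)
    with total show ?thesis by (rule order_trans[rotated])
  qed
  then show ?thesis using t unfolding l_def by blast
qed

end


section \<open>The recovery theorem\<close>

theorem theorem5:
  shows "(\<exists>C C' :: real. 0 < C \<and> 0 < C' \<and>
            (\<forall>(d :: nat) (\<delta> :: nat) (x :: complex vec) (n :: real vec).
               0 < \<delta> \<longrightarrow> \<delta> < d div 2 \<longrightarrow> 2 < d \<longrightarrow>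
               x \<in> carrier_vec d \<longrightarrow> n \<in> carrier_vec (meas_dim d \<delta>) \<longrightarrow>
               flat ((\<delta> - 3) div 2) x \<longrightarrow>
               (l2norm x)\<^sup>2 \<ge> C * (real \<delta> - 1) * (real d)\<^sup>2 * l2norm n \<longrightarrow>
               (let b = meas d \<delta> (exp_mask d \<delta>) x + n in
                  (\<exists>z. block_pr d \<delta> (exp_mask d \<delta>) b z) \<and>
                  (\<forall>z. block_pr d \<delta> (exp_mask d \<delta>) b z \<longrightarrow>
                     z \<in> carrier_vec d \<and>
                     (\<exists>\<theta>. is_arg_min (\<lambda>\<theta>. (l2norm (x - exp (\<i> * complex_of_real \<theta>) \<cdot>\<^sub>v z))\<^sup>2)
                             (\<lambda>\<theta>. \<theta> \<in> {0..2 * pi}) \<theta> \<and>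
                          (l2norm (x - exp (\<i> * complex_of_real \<theta>) \<cdot>\<^sub>v z))\<^sup>2
                            \<le> C' * (real d)\<^sup>2 * (real \<delta> - 1) * l2norm n)))))
       \<and> (\<exists>K :: real. 0 < K \<and>
            (\<forall>(d :: nat) (\<delta> :: nat). 0 < \<delta> \<longrightarrow> \<delta> < d div 2 \<longrightarrow> 2 < d \<longrightarrow>
               (\<exists>t :: prog. \<forall>b \<in> carrier_vec (meas_dim d \<delta>).
                  block_pr d \<delta> (exp_mask d \<delta>) b (vec_of_list (prog_out t (input_regs b))) \<and>
                  real (prog_cost t (input_regs b)) \<le> K * (real \<delta> * real d * ln (real d)))))"
proof (intro conjI)
  have recovery: "(\<exists>z. block_pr d \<delta> (exp_mask d \<delta>) (meas d \<delta> (exp_mask d \<delta>) x + n) z) \<and>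
      (\<forall>z. block_pr d \<delta> (exp_mask d \<delta>) (meas d \<delta> (exp_mask d \<delta>) x + n) z \<longrightarrow> z \<in> carrier_vec d \<and>
        (\<exists>\<theta>. is_arg_min (\<lambda>\<theta>. (l2norm (x - exp (\<i> * complex_of_real \<theta>) \<cdot>\<^sub>v z))\<^sup>2)
           (\<lambda>\<theta>. \<theta> \<in> {0..2 * pi}) \<theta> \<and>
         (l2norm (x - exp (\<i> * complex_of_real \<theta>) \<cdot>\<^sub>v z))\<^sup>2
           \<le> 120 * exp 3 * (real d)\<^sup>2 * (real \<delta> - 1) * l2norm n))"
    if \<delta>: "0 < \<delta>" "\<delta> < d div 2" and d2: "2 < d"
      and x: "x \<in> carrier_vec d" and n: "n \<in> carrier_vec (meas_dim d \<delta>)"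
      and flat: "flat ((\<delta> - 3) div 2) x"
      and noise: "32 * exp 3 * (real \<delta> - 1) * (real d)\<^sup>2 * l2norm n \<le> (l2norm x)\<^sup>2" for d \<delta> x n
  proof -
    interpret local_correlation d \<delta> using \<delta> by unfold_locales
    have "meas d \<delta> mask x + n \<in> carrier_vec (meas_dim d \<delta>)" using meas_carrier n by simp
    then have "\<exists>z. block_pr d \<delta> mask (meas d \<delta> mask x + n) z" using block_pr_prog_cost by blast
    then show ?thesis using block_pr_recovery[OF x n flat noise] by blast
  qed
  show "\<exists>C C'. 0 < C \<and> 0 < C' \<and> (\<forall>d \<delta> x n. 0 < \<delta> \<longrightarrow> \<delta> < d div 2 \<longrightarrow> 2 < d \<longrightarrow>
      x \<in> carrier_vec d \<longrightarrow> n \<in> carrier_vec (meas_dim d \<delta>) \<longrightarrow> flat ((\<delta> - 3) div 2) x \<longrightarrow>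
      (l2norm x)\<^sup>2 \<ge> C * (real \<delta> - 1) * (real d)\<^sup>2 * l2norm n \<longrightarrow>
      (let b = meas d \<delta> (exp_mask d \<delta>) x + n in
         (\<exists>z. block_pr d \<delta> (exp_mask d \<delta>) b z) \<and>
         (\<forall>z. block_pr d \<delta> (exp_mask d \<delta>) b z \<longrightarrow> z \<in> carrier_vec d \<and>
            (\<exists>\<theta>. is_arg_min (\<lambda>\<theta>. (l2norm (x - exp (\<i> * complex_of_real \<theta>) \<cdot>\<^sub>v z))\<^sup>2)
               (\<lambda>\<theta>. \<theta> \<in> {0..2 * pi}) \<theta> \<and>
             (l2norm (x - exp (\<i> * complex_of_real \<theta>) \<cdot>\<^sub>v z))\<^sup>2
               \<le> C' * (real d)\<^sup>2 * (real \<delta> - 1) * l2norm n))))"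
    unfolding Let_def
  proof (rule exI[of _ "32 * exp 3"], rule exI[of _ "120 * exp 3"], intro conjI)
    show "0 < 32 * exp (3 :: real)" "0 < 120 * exp (3 :: real)" by simp_all
  qed (intro allI impI, rule recovery; assumption)
next
  have "\<exists>t. \<forall>b \<in> carrier_vec (meas_dim d \<delta>).
      block_pr d \<delta> (exp_mask d \<delta>) b (vec_of_list (prog_out t (input_regs b))) \<and>
      real (prog_cost t (input_regs b)) \<le> 2000 * (real \<delta> * real d * ln (real d))"
    if "0 < \<delta>" "\<delta> < d div 2" for d \<delta>
  proof -
    interpret local_correlation d \<delta> using that by unfold_locales
    show ?thesis by (rule block_pr_prog_cost)
  qed
  then show "\<exists>K. 0 < K \<and> (\<forall>d \<delta>. 0 < \<delta> \<longrightarrow> \<delta> < d div 2 \<longrightarrow> 2 < d \<longrightarrow>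
      (\<exists>t. \<forall>b \<in> carrier_vec (meas_dim d \<delta>).
         block_pr d \<delta> (exp_mask d \<delta>) b (vec_of_list (prog_out t (input_regs b))) \<and>
         real (prog_cost t (input_regs b)) \<le> K * (real \<delta> * real d * ln (real d))))"
    by (intro exI[of _ 2000]) simp
qed


end
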